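(* Let $\xi$ be a centered real random variable with unit variance and finite fourth moment, and for each $n$ let $W_n$ be an $n\times n$ real symmetric random matrix whose entries above the main diagonal are iid copies of $\xi$ (all matrices defined on a common probability space). Fix any sequence of positive integers $d=d(n)$ with $d(n)=O(\log n)$, $d(n)\to\infty$, and $n\,d(n)$ even for every $n$. Then there exists a sequence of non-random $d$-regular (simple) graphs on $n$ vertices with adjacency matrices $A_n$ such that $$\mathbb{P}\Big(\liminf_{n\to\infty}\Big\|\tfrac{1}{\sqrt{d}}A_n\circ W_n\Big\|>2\Big)=1,$$ where $\circ$ is the entrywise (Hadamard) product and $\|\cdot\|$ the spectral norm.
   Context: Since $A_n$ is the adjacency matrix of a simple graph its diagonal is zero, so the diagonal entries of $W_n$ play no role.
   Formalization: The d-regular graphs are asserted only for all sufficiently large n, since none exists when d(n) ≥ n (for example at n = 1, where d(1) ≥ 1); the liminf does not depend on the finitely many remaining n. *)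

theory Defs
  imports "HOL-Probability.Probability" "HOL-Library.Landau_Symbols"
begin

text \<open>An n x n real matrix is represented as a function nat => nat => real,
  only the entries with indices below n being relevant.\<close>

definition spec_norm :: "nat \<Rightarrow> (nat \<Rightarrow> nat \<Rightarrow> real) \<Rightarrow> real" where
  "spec_norm n M = Sup {sqrt (\<Sum>i<n. (\<Sum>j<n. M i j * x j)\<^sup>2) | x. (\<Sum>j<n. (x j)\<^sup>2) = 1}"

definition regular_adj :: "nat \<Rightarrow> nat \<Rightarrow> (nat \<Rightarrow> nat \<Rightarrow> real) \<Rightarrow> bool" where
  "regular_adj n d A \<longleftrightarrow>
     (\<forall>i<n. \<forall>j<n. A i j \<in> {0, 1} \<and> A i j = A j i) \<and>
     (\<forall>i<n. A i i = 0) \<and>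
     (\<forall>i<n. (\<Sum>j<n. A i j) = real d)"

end

theory Submission
  imports Defs "HOL-Real_Asymp.Real_Asymp"
begin

text \<open>The graph consists of about \<open>n / 2d\<close> disjoint copies of the complete bipartite graph
  \<open>K\<^bsub>d,d\<^esub>\<close>, so the norm is at least the largest norm of about \<open>n / 2d\<close> independent
  \<open>d \<times> d\<close> iid blocks \<open>X\<close>. Since \<open>d = O(log n)\<close>, it suffices (Borel-Cantelli) that for every
  \<open>c > 0\<close> there is \<open>\<epsilon> > 0\<close> with \<open>\<parallel>X\<parallel>\<^sup>2 > (4 + \<epsilon>) d\<close> with probability at least \<open>exp (- c d)\<close>.

  Let \<open>S\<close> be the Gram matrix, divided by \<open>d\<close>, of all but a small proportion of the rows. Unless \<open>S\<close>
  already has an eigenvalue above \<open>4 + \<epsilon>\<close>, its resolvent \<open>G\<close> at \<open>\<zeta> = 4 + 2\<epsilon>\<close> is bounded and,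
  by leave-one-out, its normalised trace \<open>\<tau>\<close> nearly satisfies \<open>\<zeta> \<tau> (1 - \<tau>) = 1\<close>. The square-root
  singularity of this equation at \<open>\<zeta> = 4\<close> makes the trace of \<open>G\<^sup>2\<close> large, so for a fresh row \<open>r\<close> the
  vector \<open>u = G r\<close> has Rayleigh quotient close to 4; it is also delocalized. Each of the remaining
  rows has a large inner product with \<open>u\<close> with a probability bounded below, and asking this
  of all of them costs only \<open>exp (- c d)\<close> and lifts the Rayleigh quotient above \<open>4 + \<epsilon>\<close>.\<close>

section \<open>Resolvents of bounded symmetric matrices\<close>

text \<open>With only a fourth moment, quadratic forms are controlled by their variance and typical
  behaviour is secured merely with probability 1/2. That suffices, since the exponentially small
  cost is paid only for the rows held back. The obstacle is a trade-off in a parameter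
  \<open>h\<close>: a proportion of order \<open>h\<close> of the rows is held back, but the
  Rayleigh quotient of \<open>u\<close> may miss 4 by order \<open>sqrt h\<close>, which is much
  larger. So every held-back row has to contribute about \<open>1 / sqrt h\<close> times its typical
  amount. Delocalization makes this affordable: a linear form without dominant coordinates splits
  into \<open>k\<close> independent pieces of comparable weight, and asking each piece to be
  positive with a margin multiplies the typical square by order \<open>k\<close> at the price
  \<open>pl ^ Suc k\<close> per row. With \<open>k\<close> of order \<open>1 / sqrt h\<close> the
  total price is exponential in \<open>d\<close> at a rate of order \<open>sqrt h\<close>, which is
  below any prescribed rate for small \<open>h\<close>. The spectral input is a single approximate
  quadratic equation, used at the two points \<open>\<zeta>\<close> and
  \<open>\<zeta> + h\<close>.\<close>

definition ip :: "nat \<Rightarrow> (nat \<Rightarrow> real) \<Rightarrow> (nat \<Rightarrow> real) \<Rightarrow> real" where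
  "ip d x y = (\<Sum>i<d. x i * y i)"

definition mv :: "nat \<Rightarrow> (nat \<Rightarrow> nat \<Rightarrow> real) \<Rightarrow> (nat \<Rightarrow> real) \<Rightarrow> nat \<Rightarrow> real" where
  "mv d A x i = (\<Sum>j<d. A i j * x j)"

definition tr :: "nat \<Rightarrow> (nat \<Rightarrow> nat \<Rightarrow> real) \<Rightarrow> real" where
  "tr d A = (\<Sum>i<d. A i i)"

definition unit_vec :: "nat \<Rightarrow> nat \<Rightarrow> real" where
  "unit_vec k i = (if i = k then 1 else 0)"

lemma ip_commute: "ip d x y = ip d y x"
  by (simp add: ip_def mult.commute)

lemma ip_cong:
  "(\<And>i. i < d \<Longrightarrow> x i = x' i) \<Longrightarrow> (\<And>i. i < d \<Longrightarrow> y i = y' i) \<Longrightarrow> ip d x y = ip d x' y'"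
  by (simp add: ip_def)

lemma ip_diff_left: "ip d (\<lambda>i. x i - y i) z = ip d x z - ip d y z"
  by (simp add: ip_def left_diff_distrib sum_subtractf)

lemma ip_diff_right: "ip d z (\<lambda>i. x i - y i) = ip d z x - ip d z y"
  by (simp add: ip_def right_diff_distrib sum_subtractf)

lemma ip_scale_left: "ip d (\<lambda>i. c * x i) z = c * ip d x z"
  by (simp add: ip_def sum_distrib_left mult.assoc)

lemma ip_scale_right: "ip d x (\<lambda>i. c * z i) = c * ip d x z"
  by (simp add: ip_def sum_distrib_left mult_ac)

lemma ip_self_nonneg: "0 \<le> ip d x x"
  by (simp add: ip_def sum_nonneg)

lemma ip_self_eq_0: "ip d x x = 0 \<Longrightarrow> i < d \<Longrightarrow> x i = 0"
  by (simp add: ip_def sum_nonneg_eq_0_iff)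

lemma ip_Cauchy_Schwarz: "(ip d x y)\<^sup>2 \<le> ip d x x * ip d y y"
  using Cauchy_Schwarz_ineq_sum[of x y "{..<d}"] by (simp add: ip_def power2_eq_square)

lemma ip_unit_vec: "k < d \<Longrightarrow> ip d (unit_vec k) x = x k"
  by (simp add: ip_def unit_vec_def if_distrib[of "\<lambda>z. z * _"] cong: if_cong)

lemma mv_unit_vec: "k < d \<Longrightarrow> mv d A (unit_vec k) i = A i k"
  by (simp add: mv_def unit_vec_def if_distrib cong: if_cong)

lemma mv_diff: "mv d A (\<lambda>i. x i - y i) i = mv d A x i - mv d A y i"
  by (simp add: mv_def right_diff_distrib sum_subtractf)

lemma mv_scale: "mv d A (\<lambda>i. c * x i) i = c * mv d A x i"
  by (simp add: mv_def sum_distrib_left mult_ac)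

lemma ip_mv_symmetric:
  assumes "\<And>i j. i < d \<Longrightarrow> j < d \<Longrightarrow> A i j = A j i"
  shows "ip d (mv d A x) y = ip d x (mv d A y)"
proof -
  have "ip d (mv d A x) y = (\<Sum>i<d. \<Sum>j<d. A i j * x j * y i)"
    by (simp add: ip_def mv_def sum_distrib_right)
  also have "\<dots> = (\<Sum>j<d. \<Sum>i<d. A i j * x j * y i)"
    by (rule sum.swap)
  also have "\<dots> = ip d x (mv d A y)"
    by (auto simp: ip_def mv_def sum_distrib_left assms mult_ac intro!: sum.cong)
  finally show ?thesis .
qed

section \<open>Matrix powers, the Neumann series and the inverse of \<zeta> - S\<close>

primrec matpow :: "nat \<Rightarrow> (nat \<Rightarrow> nat \<Rightarrow> real) \<Rightarrow> nat \<Rightarrow> nat \<Rightarrow> nat \<Rightarrow> real" where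
  "matpow d S 0 = (\<lambda>i j. unit_vec j i)"
| "matpow d S (Suc k) = (\<lambda>i j. \<Sum>l<d. S i l * matpow d S k l j)"

text \<open>The Neumann series is measurable in the entries of \<open>S\<close>; where it diverges, its value is junk.\<close>

definition resolvent :: "nat \<Rightarrow> (nat \<Rightarrow> nat \<Rightarrow> real) \<Rightarrow> real \<Rightarrow> nat \<Rightarrow> nat \<Rightarrow> real" where
  "resolvent d S \<zeta> i j = (\<Sum>k. matpow d S k i j / \<zeta> ^ Suc k)"

text \<open>The two bounds have different jobs: \<open>norm_le\<close> makes the Neumann series
  converge, while \<open>form_le\<close> makes \<zeta> - S coercive for b < \<zeta> and thereby
  drives the inequalities for the resolvent.\<close>

locale sym_bounded =
  fixes d :: nat and S :: "nat \<Rightarrow> nat \<Rightarrow> real" and b :: real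
  assumes sym: "S i j = S j i"
    and b_pos: "0 < b"
    and form_le: "ip d x (mv d S x) \<le> b * ip d x x"
    and norm_le: "ip d (mv d S x) (mv d S x) \<le> b\<^sup>2 * ip d x x"
begin

lemma matpow_norm_le:
  assumes "j < d"
  shows "ip d (\<lambda>i. matpow d S k i j) (\<lambda>i. matpow d S k i j) \<le> (b ^ k)\<^sup>2"
proof (induction k)
  case 0
  have "ip d (unit_vec j) (unit_vec j) = 1"
    using ip_unit_vec[OF assms] by (simp add: unit_vec_def)
  then show ?case by simp
next
  case (Suc k)
  have "(\<lambda>i. matpow d S (Suc k) i j) = mv d S (\<lambda>i. matpow d S k i j)"
    by (simp add: mv_def fun_eq_iff)
  then have "ip d (\<lambda>i. matpow d S (Suc k) i j) (\<lambda>i. matpow d S (Suc k) i j)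
      \<le> b\<^sup>2 * ip d (\<lambda>i. matpow d S k i j) (\<lambda>i. matpow d S k i j)"
    using norm_le by simp
  also have "\<dots> \<le> b\<^sup>2 * (b ^ k)\<^sup>2"
    by (rule mult_left_mono[OF Suc]) simp
  finally show ?case by (simp add: power_mult_distrib)
qed

lemma matpow_abs_le:
  assumes "i < d" "j < d"
  shows "\<bar>matpow d S k i j\<bar> \<le> b ^ k"
proof -
  have "(matpow d S k i j)\<^sup>2 \<le> ip d (\<lambda>i. matpow d S k i j) (\<lambda>i. matpow d S k i j)"
    using assms(1) member_le_sum[of i "{..<d}" "\<lambda>i. (matpow d S k i j)\<^sup>2"]
    by (simp add: ip_def power2_eq_square)
  with matpow_norm_le[OF assms(2), of k] have "(matpow d S k i j)\<^sup>2 \<le> (b ^ k)\<^sup>2"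
    by linarith
  then show ?thesis
    using b_pos by (metis abs_le_square_iff abs_of_nonneg less_imp_le zero_le_power)
qed

lemma matpow_summable:
  assumes "i < d" "j < d" "b < \<zeta>"
  shows "summable (\<lambda>k. matpow d S k i j / \<zeta> ^ Suc k)"
proof (rule summable_comparison_test)
  have "norm (matpow d S k i j / \<zeta> ^ Suc k) \<le> (b / \<zeta>) ^ k * (1 / \<zeta>)" for k
  proof -
    have "\<bar>matpow d S k i j\<bar> / \<zeta> ^ Suc k \<le> b ^ k / \<zeta> ^ Suc k"
      using matpow_abs_le[OF assms(1,2)] assms(3) b_pos by (intro divide_right_mono) auto
    then show ?thesis
      using assms(3) b_pos by (simp add: power_divide abs_mult mult.commute)
  qed
  then show "\<exists>N. \<forall>k\<ge>N. norm (matpow d S k i j / \<zeta> ^ Suc k) \<le> (b / \<zeta>) ^ k * (1 / \<zeta>)"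
    by blast
  show "summable (\<lambda>k. (b / \<zeta>) ^ k * (1 / \<zeta>))"
    using assms(3) b_pos by (intro summable_mult2 summable_geometric) auto
qed

text \<open>Applying \<zeta> - S to the series term by term telescopes, and only the zeroth power,
  the identity, survives. So \<open>resolvent\<close> is a right inverse of \<zeta> - S.\<close>

lemma resolvent_eq:
  assumes "i < d" "j < d" "b < \<zeta>"
  shows "\<zeta> * resolvent d S \<zeta> i j - (\<Sum>l<d. S i l * resolvent d S \<zeta> l j) = unit_vec j i"
proof -
  have l0: "\<zeta> > 0" using assms b_pos by linarith
  define f where "f k = matpow d S k i j / \<zeta> ^ k" for k
  have sm: "summable (\<lambda>k. matpow d S k l j / \<zeta> ^ Suc k)" if "l < d" for l
    using matpow_summable[OF that assms(2,3)] .
  have 1: "(\<lambda>k. \<zeta> * (matpow d S k i j / \<zeta> ^ Suc k)) sums (\<zeta> * resolvent d S \<zeta> i j)"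
    unfolding resolvent_def by (intro sums_mult summable_sums sm assms)
  have 2: "(\<lambda>k. \<Sum>l<d. S i l * (matpow d S k l j / \<zeta> ^ Suc k)) sums
      (\<Sum>l<d. S i l * resolvent d S \<zeta> l j)"
    unfolding resolvent_def by (intro sums_sum sums_mult summable_sums sm) auto
  have 3: "\<zeta> * (matpow d S k i j / \<zeta> ^ Suc k) - (\<Sum>l<d. S i l * (matpow d S k l j / \<zeta> ^ Suc k))
      = f k - f (Suc k)" for k
    using l0 by (simp add: f_def sum_divide_distrib)
  have "(\<lambda>k. f k - f (Suc k)) sums
      (\<zeta> * resolvent d S \<zeta> i j - (\<Sum>l<d. S i l * resolvent d S \<zeta> l j))"
    using sums_diff[OF 1 2] unfolding 3 .
  moreover have "(\<lambda>k. f k - f (Suc k)) sums (f 0 - 0)"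
  proof (rule telescope_sums')
    have "(\<lambda>k. \<zeta> * (matpow d S k i j / \<zeta> ^ Suc k)) \<longlonglongrightarrow> 0"
      using 1 by (intro summable_LIMSEQ_zero sums_summable)
    then show "f \<longlonglongrightarrow> 0" using l0 by (simp add: f_def[abs_def])
  qed
  ultimately have "\<zeta> * resolvent d S \<zeta> i j - (\<Sum>l<d. S i l * resolvent d S \<zeta> l j) = f 0 - 0"
    by (rule sums_unique2)
  then show ?thesis by (simp add: f_def)
qed

lemma resolvent_apply:
  assumes "i < d" "b < \<zeta>"
  shows "\<zeta> * mv d (resolvent d S \<zeta>) x i - mv d S (mv d (resolvent d S \<zeta>) x) i = x i"
proof -
  let ?G = "resolvent d S \<zeta>"
  have "mv d S (mv d ?G x) i = (\<Sum>l<d. \<Sum>j<d. S i l * ?G l j * x j)"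
    by (simp add: mv_def sum_distrib_left mult.assoc)
  also have "\<dots> = (\<Sum>j<d. (\<Sum>l<d. S i l * ?G l j) * x j)"
    by (subst sum.swap) (simp add: sum_distrib_right)
  finally have "\<zeta> * mv d ?G x i - mv d S (mv d ?G x) i
      = (\<Sum>j<d. (\<zeta> * ?G i j - (\<Sum>l<d. S i l * ?G l j)) * x j)"
    by (simp add: mv_def sum_distrib_left sum_subtractf left_diff_distrib mult.assoc)
  also have "\<dots> = (\<Sum>j<d. unit_vec j i * x j)"
    using resolvent_eq[OF assms(1) _ assms(2)] by (intro sum.cong) auto
  also have "\<dots> = x i"
    using assms(1) by (simp add: unit_vec_def if_distrib[of "\<lambda>z. z * _"] cong: if_cong)
  finally show ?thesis .
qed

lemma coercive_unique:
  assumes "b < \<zeta>" "\<And>i. i < d \<Longrightarrow> \<zeta> * z i - mv d S z i = 0" "i < d"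
  shows "z i = 0"
proof -
  have "0 = ip d z (\<lambda>i. \<zeta> * z i - mv d S z i)"
    using assms(2) by (simp add: ip_def)
  also have "\<dots> = \<zeta> * ip d z z - ip d z (mv d S z)"
    by (simp add: ip_diff_right ip_scale_right)
  finally have "\<zeta> * ip d z z \<le> b * ip d z z"
    using form_le[of z] by linarith
  then have "(\<zeta> - b) * ip d z z \<le> 0" by (simp add: algebra_simps)
  then have "ip d z z \<le> 0" using assms(1) by (simp add: mult_le_0_iff)
  with ip_self_nonneg[of d z] have "ip d z z = 0" by linarith
  then show ?thesis using ip_self_eq_0 assms(3) by blast
qed

text \<open>Identities between resolvents are proved through this lemma: it is enough to check the
  linear equation that the candidate vector solves.\<close>

lemma resolvent_unique:
  assumes "b < \<zeta>" "\<And>i. i < d \<Longrightarrow> \<zeta> * y i - mv d S y i = x i" "i < d"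
  shows "y i = mv d (resolvent d S \<zeta>) x i"
proof -
  let ?w = "mv d (resolvent d S \<zeta>) x"
  have "y i - ?w i = 0"
  proof (rule coercive_unique[OF assms(1) _ assms(3)])
    fix i assume i: "i < d"
    show "\<zeta> * (y i - ?w i) - mv d S (\<lambda>i. y i - ?w i) i = 0"
      unfolding mv_diff right_diff_distrib
      using assms(2)[OF i] resolvent_apply[OF i assms(1), of x] by linarith
  qed
  then show ?thesis by simp
qed

lemma ip_resolvent:
  assumes "b < \<zeta>"
  shows "ip d x (mv d (resolvent d S \<zeta>) y) = \<zeta> * ip d (mv d (resolvent d S \<zeta>) x) (mv d (resolvent d S \<zeta>) y)
    - ip d (mv d S (mv d (resolvent d S \<zeta>) x)) (mv d (resolvent d S \<zeta>) y)"
proof -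
  have "ip d x (mv d (resolvent d S \<zeta>) y) = ip d (\<lambda>i. \<zeta> * mv d (resolvent d S \<zeta>) x i
      - mv d S (mv d (resolvent d S \<zeta>) x) i) (mv d (resolvent d S \<zeta>) y)"
    using resolvent_apply[OF _ assms, of _ x] by (intro ip_cong) auto
  then show ?thesis by (simp add: ip_diff_left ip_scale_left)
qed

lemma resolvent_self_adjoint:
  assumes "b < \<zeta>"
  shows "ip d x (mv d (resolvent d S \<zeta>) y) = ip d (mv d (resolvent d S \<zeta>) x) y"
proof -
  let ?x = "mv d (resolvent d S \<zeta>) x" and ?y = "mv d (resolvent d S \<zeta>) y"
  have "ip d (mv d S ?x) ?y = ip d ?x (mv d S ?y)"
    by (rule ip_mv_symmetric) (rule sym)
  then have "ip d x ?y = ip d y ?x"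
    using ip_resolvent[OF assms, of x y] ip_resolvent[OF assms, of y x]
      ip_commute[of d ?y ?x] ip_commute[of d "mv d S ?y" ?x] by simp
  then show ?thesis using ip_commute[of d y ?x] by simp
qed

lemma resolvent_sym:
  assumes "b < \<zeta>" "i < d" "j < d"
  shows "resolvent d S \<zeta> i j = resolvent d S \<zeta> j i"
proof -
  have "ip d (unit_vec i) (mv d (resolvent d S \<zeta>) (unit_vec j))
      = ip d (unit_vec j) (mv d (resolvent d S \<zeta>) (unit_vec i))"
    unfolding resolvent_self_adjoint[OF assms(1), of "unit_vec i"] by (rule ip_commute)
  then show ?thesis
    unfolding ip_unit_vec[OF assms(2)] ip_unit_vec[OF assms(3)]
      mv_unit_vec[OF assms(2)] mv_unit_vec[OF assms(3)] .
qed

text \<open>With y = G x the form equals <y, (\<zeta> - S) y>, and \<open>form_le\<close> bounds the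
  part with S.\<close>

lemma resolvent_form_ge:
  assumes "b < \<zeta>"
  shows "(\<zeta> - b) * ip d (mv d (resolvent d S \<zeta>) x) (mv d (resolvent d S \<zeta>) x)
    \<le> ip d x (mv d (resolvent d S \<zeta>) x)"
proof -
  let ?y = "mv d (resolvent d S \<zeta>) x"
  have "ip d x ?y = \<zeta> * ip d ?y ?y - ip d ?y (mv d S ?y)"
    using ip_resolvent[OF assms, of x x] ip_commute[of d "mv d S ?y" ?y] by simp
  then show ?thesis using form_le[of ?y] by (simp add: algebra_simps)
qed

lemma resolvent_form_nonneg:
  assumes "b < \<zeta>"
  shows "0 \<le> ip d x (mv d (resolvent d S \<zeta>) x)"
proof -
  have "0 \<le> (\<zeta> - b) * ip d (mv d (resolvent d S \<zeta>) x) (mv d (resolvent d S \<zeta>) x)"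
    using assms ip_self_nonneg by simp
  also note resolvent_form_ge[OF assms]
  finally show ?thesis .
qed

text \<open>Cauchy-Schwarz bounds the square of the form by |x|^2 |G x|^2;
  \<open>resolvent_form_ge\<close> trades |G x|^2 for the form itself, and one factor
  cancels.\<close>

lemma resolvent_form_le:
  assumes "b < \<zeta>"
  shows "ip d x (mv d (resolvent d S \<zeta>) x) \<le> ip d x x / (\<zeta> - b)"
proof -
  let ?y = "mv d (resolvent d S \<zeta>) x"
  have "(\<zeta> - b) * (ip d x ?y)\<^sup>2 \<le> (\<zeta> - b) * (ip d x x * ip d ?y ?y)"
    using assms ip_Cauchy_Schwarz by (intro mult_left_mono) auto
  also have "\<dots> = ip d x x * ((\<zeta> - b) * ip d ?y ?y)" by simp
  also have "\<dots> \<le> ip d x x * ip d x ?y"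
    using resolvent_form_ge[OF assms] ip_self_nonneg by (intro mult_left_mono) auto
  finally have *: "((\<zeta> - b) * ip d x ?y) * ip d x ?y \<le> ip d x x * ip d x ?y"
    by (simp add: power2_eq_square mult.assoc)
  show ?thesis
  proof (cases "ip d x ?y = 0")
    case True
    then show ?thesis using assms ip_self_nonneg[of d x] by simp
  next
    case False
    with resolvent_form_nonneg[OF assms, of x] have "0 < ip d x ?y" by simp
    with * have "(\<zeta> - b) * ip d x ?y \<le> ip d x x" by simp
    then show ?thesis using assms by (simp add: field_simps)
  qed
qed

lemma resolvent_norm_le:
  assumes "b < \<zeta>"
  shows "ip d (mv d (resolvent d S \<zeta>) x) (mv d (resolvent d S \<zeta>) x) \<le> ip d x x / (\<zeta> - b)\<^sup>2"
proof -
  have "(\<zeta> - b) * ip d (mv d (resolvent d S \<zeta>) x) (mv d (resolvent d S \<zeta>) x) \<le> ip d x x / (\<zeta> - b)"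
    using resolvent_form_ge[OF assms, of x] resolvent_form_le[OF assms, of x] by linarith
  then show ?thesis using assms by (simp add: pos_le_divide_eq power2_eq_square mult_ac)
qed

section \<open>Dependence of the resolvent on the spectral parameter\<close>

lemma resolvent_identity:
  assumes "b < \<zeta>" "b < \<zeta>'" "i < d"
  shows "mv d (resolvent d S \<zeta>) x i - mv d (resolvent d S \<zeta>') x i
    = (\<zeta>' - \<zeta>) * mv d (resolvent d S \<zeta>') (mv d (resolvent d S \<zeta>) x) i"
proof -
  let ?G = "resolvent d S \<zeta>" and ?G' = "resolvent d S \<zeta>'"
  let ?z = "\<lambda>i. mv d ?G x i - mv d ?G' x i"
  have "?z i = mv d ?G' (\<lambda>i. (\<zeta>' - \<zeta>) * mv d ?G x i) i"
  proof (rule resolvent_unique[OF assms(2) _ assms(3)])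
    fix i assume i: "i < d"
    show "\<zeta>' * ?z i - mv d S ?z i = (\<zeta>' - \<zeta>) * mv d ?G x i"
      using resolvent_apply[OF i assms(1), of x] resolvent_apply[OF i assms(2), of x]
      by (simp add: mv_diff algebra_simps)
  qed
  then show ?thesis by (simp add: mv_scale)
qed

lemma resolvent_diag_diff:
  assumes "b < \<zeta>" "b < \<zeta>'" "k < d"
  shows "resolvent d S \<zeta> k k - resolvent d S \<zeta>' k k
    = (\<zeta>' - \<zeta>) * ip d (mv d (resolvent d S \<zeta>') (unit_vec k)) (mv d (resolvent d S \<zeta>) (unit_vec k))"
proof -
  let ?g = "mv d (resolvent d S \<zeta>) (unit_vec k)"
  have "resolvent d S \<zeta> k k - resolvent d S \<zeta>' k k = (\<zeta>' - \<zeta>) * mv d (resolvent d S \<zeta>') ?g k"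
    using resolvent_identity[OF assms, of "unit_vec k"] assms(3) by (simp add: mv_unit_vec)
  also have "mv d (resolvent d S \<zeta>') ?g k = ip d (unit_vec k) (mv d (resolvent d S \<zeta>') ?g)"
    using assms(3) by (simp add: ip_unit_vec)
  also have "\<dots> = ip d (mv d (resolvent d S \<zeta>') (unit_vec k)) ?g"
    by (rule resolvent_self_adjoint[OF assms(2)])
  finally show ?thesis .
qed

lemma resolvent_trace_antimono:
  assumes "b < \<zeta>" "\<zeta> < \<zeta>'"
  shows "tr d (resolvent d S \<zeta>') \<le> tr d (resolvent d S \<zeta>)"
  unfolding tr_def
proof (rule sum_mono)
  fix k assume "k \<in> {..<d}"
  then have k: "k < d" by simp
  let ?g = "mv d (resolvent d S \<zeta>) (unit_vec k)" and ?g' = "mv d (resolvent d S \<zeta>') (unit_vec k)"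
  have b': "b < \<zeta>'" using assms by linarith
  \<comment> \<open>Expressing \<open>?g\<close> through \<open>?g'\<close> by the resolvent
    identity turns the mixed product into |\<open>?g'\<close>|^2 plus a nonnegative form.\<close>
  have "ip d ?g' ?g = ip d ?g' (\<lambda>i. ?g' i - (\<zeta> - \<zeta>') * mv d (resolvent d S \<zeta>) ?g' i)"
  proof (rule ip_cong)
    fix i assume "i < d"
    from resolvent_identity[OF b' assms(1) this, of "unit_vec k"]
    show "?g i = ?g' i - (\<zeta> - \<zeta>') * mv d (resolvent d S \<zeta>) ?g' i" by linarith
  qed simp
  also have "\<dots> = ip d ?g' ?g' + (\<zeta>' - \<zeta>) * ip d ?g' (mv d (resolvent d S \<zeta>) ?g')"
    unfolding ip_diff_right ip_scale_right by (simp add: algebra_simps)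
  also have "\<dots> \<ge> 0"
    using assms resolvent_form_nonneg[OF assms(1)] ip_self_nonneg by simp
  finally have "0 \<le> (\<zeta>' - \<zeta>) * ip d ?g' ?g" using assms by simp
  then show "resolvent d S \<zeta>' k k \<le> resolvent d S \<zeta> k k"
    unfolding resolvent_diag_diff[OF assms(1) b' k, symmetric] by simp
qed

text \<open>The derivative of the trace in \<zeta> is minus the trace of G^2, that is, minus the
  squared Frobenius norm, and this norm decreases in \<zeta>. Read backwards, a large drop of the
  trace over a short interval forces the trace of G^2 to be large.\<close>

lemma resolvent_trace_diff_le:
  assumes "b < \<zeta>" "\<zeta> < \<zeta>'"
  shows "tr d (resolvent d S \<zeta>) - tr d (resolvent d S \<zeta>')
    \<le> (\<zeta>' - \<zeta>) * (\<Sum>i<d. \<Sum>j<d. (resolvent d S \<zeta> i j)\<^sup>2)"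
proof -
  let ?G = "resolvent d S \<zeta>" and ?G' = "resolvent d S \<zeta>'"
  have b': "b < \<zeta>'" using assms by linarith
  have "?G k k - ?G' k k \<le> (\<zeta>' - \<zeta>) * (\<Sum>j<d. (?G k j)\<^sup>2)" if k: "k < d" for k
  proof -
    let ?g = "mv d ?G (unit_vec k)"
    have "ip d (mv d ?G' (unit_vec k)) ?g = ip d (\<lambda>i. ?g i - (\<zeta>' - \<zeta>) * mv d ?G' ?g i) ?g"
    proof (rule ip_cong)
      fix i assume "i < d"
      from resolvent_identity[OF assms(1) b' this, of "unit_vec k"]
      show "mv d ?G' (unit_vec k) i = ?g i - (\<zeta>' - \<zeta>) * mv d ?G' ?g i" by linarith
    qed simp
    also have "\<dots> = ip d ?g ?g - (\<zeta>' - \<zeta>) * ip d ?g (mv d ?G' ?g)"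
      by (simp add: ip_diff_left ip_scale_left ip_commute)
    also have "\<dots> \<le> ip d ?g ?g"
      using resolvent_form_nonneg[OF b', of ?g] assms by simp
    also have "\<dots> = (\<Sum>j<d. (?G j k)\<^sup>2)"
      unfolding ip_def mv_unit_vec[OF k] power2_eq_square ..
    also have "\<dots> = (\<Sum>j<d. (?G k j)\<^sup>2)"
      using resolvent_sym[OF assms(1) k] by (intro sum.cong refl arg_cong[where f = "\<lambda>z. z\<^sup>2"]) simp
    finally show ?thesis
      unfolding resolvent_diag_diff[OF assms(1) b' k] using assms by (intro mult_left_mono) auto
  qed
  then have "(\<Sum>k<d. ?G k k - ?G' k k) \<le> (\<Sum>k<d. (\<zeta>' - \<zeta>) * (\<Sum>j<d. (?G k j)\<^sup>2))"
    by (intro sum_mono) auto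
  then show ?thesis by (simp add: tr_def sum_subtractf sum_distrib_left)
qed

end


section \<open>Gram matrices and leave-one-out identities\<close>

definition gram :: "nat \<Rightarrow> (nat \<Rightarrow> nat \<Rightarrow> real) \<Rightarrow> nat set \<Rightarrow> nat \<Rightarrow> nat \<Rightarrow> real" where
  "gram d X J i j = (\<Sum>a\<in>J. X a i * X a j) / real d"

text \<open>For positive \<open>d\<close>, the largest eigenvalue of \<open>gram d X J\<close> is at
  most \<open>b\<close>; equivalently the matrix with rows \<open>J\<close> has norm at most sqrt (b
  d). The negation, with all \<open>d\<close> rows, is the event wanted for a block.\<close>

definition gram_bounded :: "nat \<Rightarrow> (nat \<Rightarrow> nat \<Rightarrow> real) \<Rightarrow> nat set \<Rightarrow> real \<Rightarrow> bool" where
  "gram_bounded d X J b \<longleftrightarrow> (\<forall>x. (\<Sum>a\<in>J. (ip d (X a) x)\<^sup>2) \<le> b * real d * ip d x x)"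

lemma mv_gram: "mv d (gram d X J) y i = (\<Sum>a\<in>J. X a i * ip d (X a) y) / real d"
proof -
  have "mv d (gram d X J) y i = (\<Sum>j<d. \<Sum>a\<in>J. X a i * X a j * y j) / real d"
    by (simp add: mv_def gram_def sum_distrib_right sum_divide_distrib)
  also have "\<dots> = (\<Sum>a\<in>J. X a i * ip d (X a) y) / real d"
    by (subst sum.swap) (simp add: ip_def sum_distrib_left mult.assoc)
  finally show ?thesis .
qed

lemma ip_gram:
  "ip d x (mv d (gram d X J) y) = (\<Sum>a\<in>J. ip d (X a) x * ip d (X a) y) / real d"
proof -
  have "ip d x (mv d (gram d X J) y) = (\<Sum>i<d. \<Sum>a\<in>J. X a i * x i * ip d (X a) y) / real d"
    unfolding mv_gram ip_def[of d x] by (simp add: sum_distrib_left sum_divide_distrib mult_ac)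
  also have "\<dots> = (\<Sum>a\<in>J. ip d (X a) x * ip d (X a) y) / real d"
    by (subst sum.swap) (simp add: ip_def[of d _ x] sum_distrib_right)
  finally show ?thesis .
qed

lemma gram_bounded_mono:
  assumes "gram_bounded d X J b" "J' \<subseteq> J" "finite J"
  shows "gram_bounded d X J' b"
  unfolding gram_bounded_def
proof
  fix x
  have "(\<Sum>a\<in>J'. (ip d (X a) x)\<^sup>2) \<le> (\<Sum>a\<in>J. (ip d (X a) x)\<^sup>2)"
    using assms by (intro sum_mono2) auto
  then show "(\<Sum>a\<in>J'. (ip d (X a) x)\<^sup>2) \<le> b * real d * ip d x x"
    using assms(1) unfolding gram_bounded_def by (meson order_trans)
qed

text \<open>For the norm bound put y = S x. Then d |y|^2 is the sum of <X a, y> <X a, x> over the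
  rows; Cauchy-Schwarz and the assumed bound for both vectors leave a factor |y|^2 to
  cancel.\<close>

lemma gram_sym_bounded:
  assumes "gram_bounded d X J b" "0 < b" "0 < d"
  shows "sym_bounded d (gram d X J) b"
proof
  let ?S = "gram d X J"
  show "?S i j = ?S j i" for i j
    by (simp add: gram_def mult.commute)
  show "0 < b" by fact
  have B: "(\<Sum>a\<in>J. (ip d (X a) x)\<^sup>2) \<le> b * real d * ip d x x" for x
    using assms(1) by (simp add: gram_bounded_def)
  show "ip d x (mv d ?S x) \<le> b * ip d x x" for x
    using B[of x] assms(3) by (simp add: ip_gram power2_eq_square field_simps)
  show "ip d (mv d ?S x) (mv d ?S x) \<le> b\<^sup>2 * ip d x x" for x
  proof -
    define y where "y = mv d ?S x"
    have "(real d * ip d y y)\<^sup>2 = (\<Sum>a\<in>J. ip d (X a) y * ip d (X a) x)\<^sup>2"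
      using ip_gram[of d y X J x] assms(3) by (simp add: y_def)
    also have "\<dots> \<le> (\<Sum>a\<in>J. (ip d (X a) y)\<^sup>2) * (\<Sum>a\<in>J. (ip d (X a) x)\<^sup>2)"
      by (rule Cauchy_Schwarz_ineq_sum)
    also have "\<dots> \<le> (b * real d * ip d y y) * (b * real d * ip d x x)"
      using B assms ip_self_nonneg by (intro mult_mono) (auto intro!: sum_nonneg)
    finally have "(real d)\<^sup>2 * (ip d y y * ip d y y) \<le> (real d)\<^sup>2 * (ip d y y * (b\<^sup>2 * ip d x x))"
      by (simp add: power2_eq_square mult_ac)
    then have *: "ip d y y * ip d y y \<le> ip d y y * (b\<^sup>2 * ip d x x)"
      using assms(3) by simp
    have "ip d y y \<le> b\<^sup>2 * ip d x x"
    proof (cases "ip d y y = 0")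
      case True
      then show ?thesis using ip_self_nonneg[of d x] by simp
    next
      case False
      with ip_self_nonneg[of d y] have "0 < ip d y y" by simp
      then show ?thesis using * by simp
    qed
    then show ?thesis by (simp add: y_def)
  qed
qed

text \<open>The Sherman-Morrison formula in a form free of divisions. The last bound is uniform in
  \<open>r\<close>: deleting a row changes the trace by a bounded amount, however long the row
  is.\<close>

lemma rank_one_update:
  assumes S: "sym_bounded d S b" and S': "sym_bounded d S' b" and "b < \<zeta>" "0 < d"
    and upd: "\<And>i j. S i j = S' i j + r i * r j / real d"
  defines "G \<equiv> resolvent d S \<zeta>" and "G' \<equiv> resolvent d S' \<zeta>"
  defines "t \<equiv> ip d r (mv d G' r) / real d" and "s \<equiv> ip d r (mv d G r) / real d"
  shows "s = t * (1 + s)" and "0 \<le> s" and "0 \<le> tr d G - tr d G'"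
    and "tr d G - tr d G' \<le> 1 / (\<zeta> - b)"
proof -
  interpret A: sym_bounded d S b by fact
  interpret A': sym_bounded d S' b by fact
  have mvS: "mv d S x i = mv d S' x i + r i * ip d r x / real d" for x i
    by (simp add: mv_def upd ip_def sum.distrib distrib_right sum_distrib_left sum_divide_distrib mult.assoc)
  \<comment> \<open>Since S = S' + r r^T / d, the operator \<zeta> - S sends G' x to x minus a
    multiple of \<open>r\<close>; uniqueness gives the rest.\<close>
  have upd1: "mv d G' x i = mv d G (\<lambda>i. x i - ip d r (mv d G' x) / real d * r i) i" if "i < d" for x i
    unfolding G_def
  proof (rule A.resolvent_unique[OF assms(3) _ that])
    fix i assume "i < d"
    from A'.resolvent_apply[OF this assms(3), of x]
    show "\<zeta> * mv d G' x i - mv d S (mv d G' x) i = x i - ip d r (mv d G' x) / real d * r i"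
      by (simp add: mvS G'_def mult_ac)
  qed
  have Gr: "mv d G' r i = (1 - t) * mv d G r i" if "i < d" for i
  proof -
    have "(\<lambda>i. r i - t * r i) = (\<lambda>i. (1 - t) * r i)"
      by (simp add: fun_eq_iff algebra_simps)
    then show ?thesis using upd1[OF that, of r] unfolding t_def by (simp add: mv_scale)
  qed
  have ts: "t = (1 - t) * s"
  proof -
    have "ip d r (mv d G' r) = ip d r (\<lambda>i. (1 - t) * mv d G r i)"
      using Gr by (intro ip_cong) auto
    then show ?thesis unfolding t_def[symmetric] s_def ip_scale_right
      using t_def by simp
  qed
  then show "s = t * (1 + s)" by (simp add: algebra_simps)
  show s0: "0 \<le> s"
    unfolding s_def G_def using A.resolvent_form_nonneg[OF assms(3)] by simp
  have t0: "0 \<le> t"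
    unfolding t_def G'_def using A'.resolvent_form_nonneg[OF assms(3)] by simp
  have t1: "t < 1"
  proof (rule ccontr)
    assume "\<not> t < 1"
    then have "(1 - t) * s \<le> 0" using s0 by (simp add: mult_nonpos_nonneg)
    with ts \<open>\<not> t < 1\<close> show False by linarith
  qed
  have diag: "G k k - G' k k = (1 - t) * (mv d G r k)\<^sup>2 / real d" if k: "k < d" for k
  proof -
    have c: "ip d r (mv d G' (unit_vec k)) = (1 - t) * mv d G r k"
    proof -
      have "ip d r (mv d G' (unit_vec k)) = ip d (mv d G' r) (unit_vec k)"
        unfolding G'_def by (rule A'.resolvent_self_adjoint[OF assms(3)])
      also have "\<dots> = mv d G' r k"
        by (subst ip_commute) (rule ip_unit_vec[OF k])
      finally show ?thesis using Gr[OF k] by simp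
    qed
    have "G' k k = mv d G' (unit_vec k) k" by (simp add: mv_unit_vec k)
    also have "\<dots> = mv d G (\<lambda>i. unit_vec k i - ((1 - t) * mv d G r k / real d) * r i) k"
      using upd1[OF k, of "unit_vec k"] unfolding c .
    also have "\<dots> = G k k - (1 - t) * mv d G r k / real d * mv d G r k"
      unfolding mv_diff mv_scale mv_unit_vec[OF k] ..
    finally show ?thesis by (simp add: power2_eq_square)
  qed
  have trd: "tr d G - tr d G' = (1 - t) * ip d (mv d G r) (mv d G r) / real d"
  proof -
    have "tr d G - tr d G' = (\<Sum>k<d. G k k - G' k k)" by (simp add: tr_def sum_subtractf)
    also have "\<dots> = (\<Sum>k<d. (1 - t) * (mv d G r k)\<^sup>2 / real d)"
      using diag by (intro sum.cong) auto
    finally show ?thesis by (simp add: ip_def power2_eq_square sum_distrib_left sum_divide_distrib)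
  qed
  show "0 \<le> tr d G - tr d G'"
    unfolding trd using t1 ip_self_nonneg[of d "mv d G r"] by simp
  have "(\<zeta> - b) * ip d (mv d G r) (mv d G r) \<le> ip d r (mv d G r)"
    unfolding G_def by (rule A.resolvent_form_ge[OF assms(3)])
  then have "ip d (mv d G r) (mv d G r) \<le> ip d r (mv d G r) / (\<zeta> - b)"
    using assms(3) by (simp add: pos_le_divide_eq mult.commute)
  then have "ip d (mv d G r) (mv d G r) / real d \<le> s / (\<zeta> - b)"
    unfolding s_def divide_divide_eq_left mult.commute[of "real d"]
    unfolding divide_divide_eq_left[symmetric] by (rule divide_right_mono) simp
  then have "(1 - t) * (ip d (mv d G r) (mv d G r) / real d) \<le> (1 - t) * (s / (\<zeta> - b))"
    using t1 by (intro mult_left_mono) auto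
  \<comment> \<open>The factor \<open>1 - t\<close> exactly undoes the growth of \<open>s\<close>,
    which makes the bound independent of \<open>r\<close>.\<close>
  also have "\<dots> = t / (\<zeta> - b)" using ts by simp
  also have "\<dots> \<le> 1 / (\<zeta> - b)" using t1 assms(3) by (intro divide_right_mono) auto
  finally show "tr d G - tr d G' \<le> 1 / (\<zeta> - b)" unfolding trd by simp
qed

text \<open>The sum is d times the trace of S G, and S G = \<zeta> G - I.\<close>

lemma sum_forms_resolvent:
  assumes "gram_bounded d X J b" "0 < b" "0 < d" "b < \<zeta>"
  defines "G \<equiv> resolvent d (gram d X J) \<zeta>"
  shows "(\<Sum>a\<in>J. ip d (X a) (mv d G (X a))) = real d * (\<zeta> * tr d G - real d)"
proof -
  interpret sym_bounded d "gram d X J" b by (rule gram_sym_bounded[OF assms(1-3)])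
  have "ip d (X a) (mv d G (X a)) = (\<Sum>i<d. \<Sum>j<d. X a i * G i j * X a j)" for a
    by (simp add: ip_def mv_def sum_distrib_left mult.assoc)
  then have "(\<Sum>a\<in>J. ip d (X a) (mv d G (X a))) = (\<Sum>a\<in>J. \<Sum>i<d. \<Sum>j<d. X a i * G i j * X a j)"
    by simp
  also have "\<dots> = (\<Sum>i<d. \<Sum>a\<in>J. \<Sum>j<d. X a i * G i j * X a j)" by (rule sum.swap)
  also have "\<dots> = (\<Sum>i<d. \<Sum>j<d. \<Sum>a\<in>J. X a i * G i j * X a j)"
    by (intro sum.cong refl sum.swap)
  also have "\<dots> = (\<Sum>i<d. \<Sum>j<d. real d * (gram d X J i j * G j i))"
  proof (intro sum.cong refl)
    fix i j assume "i \<in> {..<d}" "j \<in> {..<d}"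
    then have "G i j = G j i" unfolding G_def using resolvent_sym[OF assms(4)] by simp
    then show "(\<Sum>a\<in>J. X a i * G i j * X a j) = real d * (gram d X J i j * G j i)"
      using assms(3) by (simp add: gram_def sum_distrib_right) (simp add: mult_ac)
  qed
  also have "\<dots> = real d * (\<Sum>i<d. \<Sum>j<d. gram d X J i j * G j i)"
    by (simp add: sum_distrib_left)
  also have "(\<Sum>i<d. \<Sum>j<d. gram d X J i j * G j i) = (\<Sum>i<d. \<zeta> * G i i - 1)"
  proof (rule sum.cong[OF refl])
    fix i assume "i \<in> {..<d}"
    then show "(\<Sum>j<d. gram d X J i j * G j i) = \<zeta> * G i i - 1"
      using resolvent_eq[of i i, OF _ _ assms(4)] by (simp add: G_def unit_vec_def)
  qed
  finally show ?thesis by (simp add: tr_def sum_subtractf sum_distrib_left)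
qed

text \<open>The forms \<open>s a\<close>, summed over the rows and divided by \<open>d\<close>, give
  \<zeta> \<tau> - 1, while \<open>s a = t a * (1 + s a)\<close> with the leave-one-out form
  \<open>t a\<close>. If every \<open>t a\<close> were equal to \<tau>, the left-hand side would
  vanish; so it is governed by the sum of \<open>(t a - \<tau>) * (1 + s a)\<close>. The differences
  are small for random rows because \<open>G' a\<close> does not involve row
  \<open>a\<close>.\<close>

lemma self_consistent_error:
  assumes gb: "gram_bounded d X J b" and "0 < b" "0 < d" "b < \<zeta>" "finite J"
  defines "\<tau> \<equiv> tr d (resolvent d (gram d X J) \<zeta>) / real d"
  defines "G' \<equiv> \<lambda>a. resolvent d (gram d X (J - {a})) \<zeta>"
  shows "\<bar>\<zeta> * \<tau> - 1 - \<tau> * (real (card J) / real d + \<zeta> * \<tau> - 1)\<bar> \<le> (\<Sum>a\<in>J.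
      (\<bar>ip d (X a) (mv d (G' a) (X a)) - tr d (G' a)\<bar> / real d + 1 / (real d * (\<zeta> - b)))
      * (1 + ip d (X a) (X a) / (real d * (\<zeta> - b)))) / real d"
proof -
  let ?G = "resolvent d (gram d X J) \<zeta>"
  define s where "s a = ip d (X a) (mv d ?G (X a)) / real d" for a
  define t where "t a = ip d (X a) (mv d (G' a) (X a)) / real d" for a
  interpret A: sym_bounded d "gram d X J" b by (rule gram_sym_bounded) fact+
  have upd: "s a = t a * (1 + s a)" "0 \<le> s a" "0 \<le> tr d ?G - tr d (G' a)"
     "tr d ?G - tr d (G' a) \<le> 1 / (\<zeta> - b)" if a: "a \<in> J" for a
  proof -
    have "gram d X J i j = gram d X (J - {a}) i j + X a i * X a j / real d" for i j
      using sum.remove[OF assms(5) a, of "\<lambda>a. X a i * X a j"]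
      by (simp add: gram_def add_divide_distrib)
    note R = rank_one_update[OF A.sym_bounded_axioms gram_sym_bounded[OF gram_bounded_mono[OF gb, of "J - {a}"]]
        assms(4,3) this]
    show "s a = t a * (1 + s a)" "0 \<le> s a" "0 \<le> tr d ?G - tr d (G' a)"
     "tr d ?G - tr d (G' a) \<le> 1 / (\<zeta> - b)"
      using R assms(2,3,5) unfolding s_def t_def G'_def by auto
  qed
  have "(\<Sum>a\<in>J. s a) = \<zeta> * tr d ?G - real d"
    using sum_forms_resolvent[OF assms(1-4)] assms(3)
    by (simp add: s_def sum_divide_distrib[symmetric])
  then have sums: "(\<Sum>a\<in>J. s a) = real d * (\<zeta> * \<tau> - 1)"
    using assms(3) by (simp add: \<tau>_def right_diff_distrib)
  have "real d * (\<zeta> * \<tau> - 1 - \<tau> * (real (card J) / real d + \<zeta> * \<tau> - 1))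
      = (\<Sum>a\<in>J. s a) - \<tau> * (real (card J) + (\<Sum>a\<in>J. s a))"
    unfolding sums using assms(3) by (simp add: field_simps)
  also have "\<dots> = (\<Sum>a\<in>J. s a - \<tau> * (1 + s a))"
    by (simp add: sum_subtractf sum_distrib_left sum.distrib distrib_left)
  also have "\<dots> = (\<Sum>a\<in>J. (t a - \<tau>) * (1 + s a))"
    using upd(1) by (intro sum.cong refl) (metis left_diff_distrib)
  finally have "real d * \<bar>\<zeta> * \<tau> - 1 - \<tau> * (real (card J) / real d + \<zeta> * \<tau> - 1)\<bar>
      = \<bar>\<Sum>a\<in>J. (t a - \<tau>) * (1 + s a)\<bar>"
    by (metis abs_mult abs_of_nat)
  also have "\<dots> \<le> (\<Sum>a\<in>J. \<bar>(t a - \<tau>) * (1 + s a)\<bar>)" by (rule sum_abs)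
  also have "\<dots> \<le> (\<Sum>a\<in>J.
      (\<bar>ip d (X a) (mv d (G' a) (X a)) - tr d (G' a)\<bar> / real d + 1 / (real d * (\<zeta> - b)))
      * (1 + ip d (X a) (X a) / (real d * (\<zeta> - b))))"
  proof (rule sum_mono)
    fix a assume a: "a \<in> J"
    \<comment> \<open>The first part is the fluctuation of the quadratic form, the second the effect
      of deleting one row on the trace.\<close>
    have "t a - \<tau> = (ip d (X a) (mv d (G' a) (X a)) - tr d (G' a)) / real d - (tr d ?G - tr d (G' a)) / real d"
      by (simp add: t_def \<tau>_def diff_divide_distrib)
    then have "\<bar>t a - \<tau>\<bar> \<le> \<bar>(ip d (X a) (mv d (G' a) (X a)) - tr d (G' a)) / real d\<bar>
        + \<bar>(tr d ?G - tr d (G' a)) / real d\<bar>"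
      by linarith
    also have "\<bar>(tr d ?G - tr d (G' a)) / real d\<bar> \<le> 1 / (\<zeta> - b) / real d"
      unfolding abs_divide using upd(3,4)[OF a] by (intro frac_le) (use assms(3,4) in auto)
    finally have 1: "\<bar>t a - \<tau>\<bar> \<le> \<bar>ip d (X a) (mv d (G' a) (X a)) - tr d (G' a)\<bar> / real d
        + 1 / (real d * (\<zeta> - b))" by (simp add: mult.commute)
    have "s a \<le> ip d (X a) (X a) / (\<zeta> - b) / real d"
      unfolding s_def using A.resolvent_form_le[OF assms(4)] by (intro divide_right_mono) auto
    then have 2: "\<bar>1 + s a\<bar> \<le> 1 + ip d (X a) (X a) / (real d * (\<zeta> - b))"
      using upd(2)[OF a] by (simp add: mult.commute)
    show "\<bar>(t a - \<tau>) * (1 + s a)\<bar> \<le> (\<bar>ip d (X a) (mv d (G' a) (X a)) - tr d (G' a)\<bar> / real d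
        + 1 / (real d * (\<zeta> - b))) * (1 + ip d (X a) (X a) / (real d * (\<zeta> - b)))"
      unfolding abs_mult by (intro mult_mono 1 2) (use assms(3,4) in auto)
  qed
  finally show ?thesis using assms(3) by (simp add: field_simps)
qed


section \<open>Moments of linear and quadratic forms\<close>

lemma ennreal_mult_add:
  assumes "0 \<le> a" "0 \<le> b" "0 \<le> c" "0 \<le> e"
  shows "ennreal (a + (b * c + e)) = ennreal a + (ennreal b * ennreal c + ennreal e)"
  using assms by (simp add: ennreal_mult)

locale entry_law = prob_space \<mu> for \<mu> :: "real measure" +
  assumes sets_\<mu> [measurable_cong]: "sets \<mu> = sets borel"
    and int4: "integrable \<mu> (\<lambda>x. x ^ 4)"
    and mean0: "(\<integral>x. x \<partial>\<mu>) = 0"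
    and var1: "(\<integral>x. x\<^sup>2 \<partial>\<mu>) = 1"
begin

definition "m3 = (\<integral>x. x ^ 3 \<partial>\<mu>)"
definition "m4 = (\<integral>x. x ^ 4 \<partial>\<mu>)"
text \<open>One constant under which the inductions for both moment bounds close:
  \<open>m4 + 2 * m3\<^sup>2\<close> absorbs the contribution of a new coordinate after a square is
  completed, and the summand 4 absorbs the mixed terms.\<close>

definition "K = 4 + m4 + 2 * m3\<^sup>2"

lemma integrable_powers [simp]:
  "integrable \<mu> (\<lambda>x. x)" "integrable \<mu> (\<lambda>x. x\<^sup>2)" "integrable \<mu> (\<lambda>x. x ^ 3)" "integrable \<mu> (\<lambda>x. x ^ 4)"
proof -
  have dom: "integrable \<mu> (\<lambda>x. 1 + x ^ 4)" using int4 by simp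
  have "\<bar>x\<bar> ^ k \<le> 1 + x ^ 4" if "k \<le> 4" for k :: nat and x :: real
  proof (cases "\<bar>x\<bar> \<le> 1")
    case True
    then have "\<bar>x\<bar> ^ k \<le> 1" by (simp add: power_le_one)
    then show ?thesis by (simp add: add_increasing2)
  next
    case False
    then have "\<bar>x\<bar> ^ k \<le> \<bar>x\<bar> ^ 4" using that by (intro power_increasing) auto
    then show ?thesis by simp
  qed
  then have "integrable \<mu> (\<lambda>x. x ^ k)" if "k \<le> 4" for k
    using that by (intro Bochner_Integration.integrable_bound[OF dom]) (auto simp: power_abs)
  from this[of 1] this[of 2] this[of 3]
  show "integrable \<mu> (\<lambda>x. x)" "integrable \<mu> (\<lambda>x. x\<^sup>2)" "integrable \<mu> (\<lambda>x. x ^ 3)" by simp_all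
  show "integrable \<mu> (\<lambda>x. x ^ 4)" by (rule int4)
qed

lemma m4_nonneg: "0 \<le> m4"
  unfolding m4_def by (intro Bochner_Integration.integral_nonneg) simp

lemma K_ge: "4 \<le> K" "m4 + 2 * m3\<^sup>2 \<le> K"
  using m4_nonneg by (simp_all add: K_def)

text \<open>The linear coefficient \<open>cb\<close> is absent from the conclusion because the mean
  is 0, so applications have to name it.\<close>

lemma nn_integral_quartic:
  assumes "\<And>y. p y = ca + cb * y + cc * y\<^sup>2 + ce * y ^ 3 + cf * y ^ 4" "\<And>y. 0 \<le> p y"
  shows "(\<integral>\<^sup>+y. ennreal (p y) \<partial>\<mu>) = ennreal (ca + cc + ce * m3 + cf * m4)"
proof -
  have "(\<integral>\<^sup>+y. ennreal (p y) \<partial>\<mu>) = ennreal (\<integral>y. p y \<partial>\<mu>)"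
    using assms(2) unfolding assms(1) by (intro nn_integral_eq_integral) auto
  also have "(\<integral>y. p y \<partial>\<mu>) = ca + cc + ce * m3 + cf * m4"
    unfolding assms(1) by (simp add: mean0 var1 m3_def m4_def prob_space)
  finally show ?thesis .
qed

lemma product_sigma_finite_const: "product_sigma_finite (\<lambda>_. \<mu>)"
  by (intro product_sigma_finite.intro) (rule sigma_finite_measure)

lemma space_\<mu>: "space \<mu> = UNIV"
  using sets_eq_imp_space_eq[OF sets_\<mu>] by simp

lemma linear_form_second_moment:
  assumes "finite I"
  shows "(\<integral>\<^sup>+r. ennreal ((\<Sum>i\<in>I. g i * r i)\<^sup>2) \<partial>PiM I (\<lambda>_. \<mu>)) = ennreal (\<Sum>i\<in>I. (g i)\<^sup>2)"
  using assms
proof (induction I rule: finite_induct)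
  case empty
  then show ?case by simp
next
  case (insert n I)
  interpret product_sigma_finite "\<lambda>_. \<mu>" by (rule product_sigma_finite_const)
  interpret P: prob_space "PiM I (\<lambda>_. \<mu>)" by (intro prob_space_PiM prob_space_axioms)
  have s: "(\<Sum>i\<in>I. g i * (x(n := y)) i) = (\<Sum>i\<in>I. g i * x i)" for x y
    using insert.hyps by (intro sum.cong) auto
  have "(\<integral>\<^sup>+r. ennreal ((\<Sum>i\<in>insert n I. g i * r i)\<^sup>2) \<partial>PiM (insert n I) (\<lambda>_. \<mu>))
      = (\<integral>\<^sup>+x. (\<integral>\<^sup>+y. ennreal ((g n * y + (\<Sum>i\<in>I. g i * x i))\<^sup>2) \<partial>\<mu>) \<partial>PiM I (\<lambda>_. \<mu>))"
    using insert.hyps by (subst product_nn_integral_insert) (auto simp: s fun_upd_same simp del: fun_upd_apply)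
  also have "\<dots> = (\<integral>\<^sup>+x. ennreal ((g n)\<^sup>2) + ennreal ((\<Sum>i\<in>I. g i * x i)\<^sup>2) \<partial>PiM I (\<lambda>_. \<mu>))"
  proof (intro nn_integral_cong)
    fix x
    let ?T = "\<Sum>i\<in>I. g i * x i"
    have "(\<integral>\<^sup>+y. ennreal ((g n * y + ?T)\<^sup>2) \<partial>\<mu>) = ennreal (?T\<^sup>2 + (g n)\<^sup>2 + 0 * m3 + 0 * m4)"
      by (rule nn_integral_quartic[where cb = "2 * g n * ?T"]) (simp add: power2_eq_square algebra_simps, simp)
    then show "(\<integral>\<^sup>+y. ennreal ((g n * y + ?T)\<^sup>2) \<partial>\<mu>) = ennreal ((g n)\<^sup>2) + ennreal (?T\<^sup>2)"
      by (simp add: add.commute)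
  qed
  also have "\<dots> = ennreal ((g n)\<^sup>2) + (\<integral>\<^sup>+x. ennreal ((\<Sum>i\<in>I. g i * x i)\<^sup>2) \<partial>PiM I (\<lambda>_. \<mu>))"
    by (subst nn_integral_add) (auto simp: P.emeasure_space_1)
  also have "\<dots> = ennreal (\<Sum>i\<in>insert n I. (g i)\<^sup>2)"
    using insert by (simp add: sum_nonneg)
  finally show ?case .
qed

text \<open>Induction on the coordinates, integrating the new one first. The third-moment term has
  no sign and is absorbed by completing the square in \<open>T x - g n * m3\<close>; this raises the
  coefficient 6 of the mixed term to 8, which fits into 2 K.\<close>

lemma linear_form_fourth_moment:
  assumes "finite I"
  shows "(\<integral>\<^sup>+r. ennreal ((\<Sum>i\<in>I. g i * r i) ^ 4) \<partial>PiM I (\<lambda>_. \<mu>)) \<le> ennreal (K * (\<Sum>i\<in>I. (g i)\<^sup>2)\<^sup>2)"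
  using assms
proof (induction I rule: finite_induct)
  case empty
  then show ?case by simp
next
  case (insert n I)
  interpret product_sigma_finite "\<lambda>_. \<mu>" by (rule product_sigma_finite_const)
  interpret P: prob_space "PiM I (\<lambda>_. \<mu>)" by (intro prob_space_PiM prob_space_axioms)
  let ?P = "PiM I (\<lambda>_. \<mu>)"
  define T where "T x = (\<Sum>i\<in>I. g i * x i)" for x
  define v where "v = (\<Sum>i\<in>I. (g i)\<^sup>2)"
  have v0: "0 \<le> v" by (simp add: v_def sum_nonneg)
  have [measurable]: "T \<in> borel_measurable ?P" unfolding T_def by measurable
  have s: "(\<Sum>i\<in>I. g i * (x(n := y)) i) = T x" for x y
    unfolding T_def using insert.hyps by (intro sum.cong) auto
  have "(\<integral>\<^sup>+r. ennreal ((\<Sum>i\<in>insert n I. g i * r i) ^ 4) \<partial>PiM (insert n I) (\<lambda>_. \<mu>))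
      = (\<integral>\<^sup>+x. (\<integral>\<^sup>+y. ennreal ((g n * y + T x) ^ 4) \<partial>\<mu>) \<partial>?P)"
    using insert.hyps by (subst product_nn_integral_insert) (auto simp: s fun_upd_same simp del: fun_upd_apply)
  also have "\<dots> \<le> (\<integral>\<^sup>+x. ennreal (K * (g n) ^ 4) + (ennreal (8 * (g n)\<^sup>2) * ennreal ((T x)\<^sup>2)
        + ennreal ((T x) ^ 4)) \<partial>?P)"
  proof (intro nn_integral_mono)
    fix x
    have "(\<integral>\<^sup>+y. ennreal ((g n * y + T x) ^ 4) \<partial>\<mu>)
        = ennreal ((T x) ^ 4 + 6 * (g n)\<^sup>2 * (T x)\<^sup>2 + (4 * (g n) ^ 3 * T x) * m3 + (g n) ^ 4 * m4)"
      by (rule nn_integral_quartic[where cb = "4 * g n * (T x) ^ 3"])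
         (simp add: power4_eq_xxxx power3_eq_cube power2_eq_square algebra_simps, simp)
    also have "\<dots> \<le> ennreal (K * (g n) ^ 4 + (8 * (g n)\<^sup>2 * (T x)\<^sup>2 + (T x) ^ 4))"
    proof (rule ennreal_leI)
      have "0 \<le> 2 * (g n)\<^sup>2 * (T x - g n * m3)\<^sup>2" by simp
      then have "(4 * (g n) ^ 3 * T x) * m3 \<le> 2 * (g n)\<^sup>2 * (T x)\<^sup>2 + 2 * m3\<^sup>2 * (g n) ^ 4"
        by (simp add: power4_eq_xxxx power3_eq_cube power2_eq_square algebra_simps)
      moreover have "(m4 + 2 * m3\<^sup>2) * (g n) ^ 4 \<le> K * (g n) ^ 4"
        using K_ge(2) by (intro mult_right_mono) auto
      ultimately show "(T x) ^ 4 + 6 * (g n)\<^sup>2 * (T x)\<^sup>2 + (4 * (g n) ^ 3 * T x) * m3 + (g n) ^ 4 * m4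
          \<le> K * (g n) ^ 4 + (8 * (g n)\<^sup>2 * (T x)\<^sup>2 + (T x) ^ 4)"
        by (simp add: algebra_simps)
    qed
    also have "\<dots> = ennreal (K * (g n) ^ 4) + (ennreal (8 * (g n)\<^sup>2) * ennreal ((T x)\<^sup>2) + ennreal ((T x) ^ 4))"
      using K_ge(1) by (intro ennreal_mult_add) auto
    finally show "(\<integral>\<^sup>+y. ennreal ((g n * y + T x) ^ 4) \<partial>\<mu>) \<le> \<dots>" .
  qed
  also have "\<dots> = ennreal (K * (g n) ^ 4) + (ennreal (8 * (g n)\<^sup>2) * (\<integral>\<^sup>+x. ennreal ((T x)\<^sup>2) \<partial>?P)
        + (\<integral>\<^sup>+x. ennreal ((T x) ^ 4) \<partial>?P))"
    by (simp add: nn_integral_add nn_integral_cmult P.emeasure_space_1)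
  also have "(\<integral>\<^sup>+x. ennreal ((T x)\<^sup>2) \<partial>?P) = ennreal v"
    unfolding T_def v_def by (rule linear_form_second_moment) fact
  also have "(\<integral>\<^sup>+x. ennreal ((T x) ^ 4) \<partial>?P) \<le> ennreal (K * v\<^sup>2)"
    using insert.IH by (simp add: T_def v_def)
  also have "ennreal (K * (g n) ^ 4) + (ennreal (8 * (g n)\<^sup>2) * ennreal v + ennreal (K * v\<^sup>2))
      = ennreal (K * (g n) ^ 4 + (8 * (g n)\<^sup>2 * v + K * v\<^sup>2))"
    using K_ge(1) v0 by (intro ennreal_mult_add[symmetric]) auto
  also have "\<dots> \<le> ennreal (K * (\<Sum>i\<in>insert n I. (g i)\<^sup>2)\<^sup>2)"
  proof (rule ennreal_leI)
    have "(2 * ((g n)\<^sup>2 * v)) * 4 \<le> (2 * ((g n)\<^sup>2 * v)) * K"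
      using K_ge(1) v0 by (intro mult_left_mono) auto
    moreover have "(\<Sum>i\<in>insert n I. (g i)\<^sup>2) = (g n)\<^sup>2 + v"
      using insert.hyps by (simp add: v_def)
    ultimately show "K * (g n) ^ 4 + (8 * (g n)\<^sup>2 * v + K * v\<^sup>2) \<le> K * (\<Sum>i\<in>insert n I. (g i)\<^sup>2)\<^sup>2"
      by (simp add: power4_eq_xxxx power2_eq_square algebra_simps)
  qed
  finally show ?case by (simp add: add_mono)
qed

text \<open>A new coordinate y changes the centred form into Q + 2 y L + a (y^2 - 1), with L linear
  in the old coordinates and a the new diagonal entry. Integrating over y leaves Q^2 with
  coefficient 1; the third-moment term is absorbed by a square, giving 6 L^2. Off-diagonal entries
  are counted twice in the Frobenius norm, so 2 K is available for this 6.\<close>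

lemma quadratic_form_variance:
  assumes sym: "\<And>i j. i < n \<Longrightarrow> j < n \<Longrightarrow> A i j = A j i"
  shows "(\<integral>\<^sup>+r. ennreal ((ip n r (mv n A r) - tr n A)\<^sup>2) \<partial>PiM {..<n} (\<lambda>_. \<mu>))
    \<le> ennreal (K * (\<Sum>i<n. \<Sum>j<n. (A i j)\<^sup>2))"
  using sym
proof (induction n)
  case 0
  then show ?case by (simp add: ip_def tr_def)
next
  case (Suc n)
  interpret product_sigma_finite "\<lambda>_. \<mu>" by (rule product_sigma_finite_const)
  interpret P: prob_space "PiM {..<n} (\<lambda>_. \<mu>)" by (intro prob_space_PiM prob_space_axioms)
  let ?P = "PiM {..<n} (\<lambda>_. \<mu>)"
  define Q where "Q x = ip n x (mv n A x) - tr n A" for x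
  define L where "L x = (\<Sum>j<n. A n j * x j)" for x
  define V where "V = (\<Sum>i<n. \<Sum>j<n. (A i j)\<^sup>2)"
  define v where "v = (\<Sum>j<n. (A n j)\<^sup>2)"
  have nonneg: "0 \<le> V" "0 \<le> v" by (simp_all add: V_def v_def sum_nonneg)
  have [measurable]: "Q \<in> borel_measurable ?P" "L \<in> borel_measurable ?P"
    unfolding Q_def L_def ip_def mv_def by measurable
  have [measurable]: "(\<lambda>r. (ip (Suc n) r (mv (Suc n) A r) - tr (Suc n) A)\<^sup>2)
      \<in> borel_measurable (PiM (insert n {..<n}) (\<lambda>_. \<mu>))"
    unfolding ip_def mv_def by measurable (auto simp: less_Suc_eq)
  have split: "ip (Suc n) (x(n := y)) (mv (Suc n) A (x(n := y))) - tr (Suc n) A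
      = Q x + 2 * y * L x + A n n * (y\<^sup>2 - 1)" for x y
  proof -
    have e: "(\<Sum>j<n. f j * (x(n := y)) j) = (\<Sum>j<n. f j * x j)" for f
      by (intro sum.cong) auto
    have "(\<Sum>i<n. (x(n := y)) i * ((\<Sum>j<n. A i j * x j) + A i n * y))
        = (\<Sum>i<n. x i * (\<Sum>j<n. A i j * x j) + y * (A n i * x i))"
      using Suc.prems by (intro sum.cong) (auto simp: algebra_simps)
    also have "\<dots> = ip n x (mv n A x) + y * L x"
      by (simp add: sum.distrib ip_def mv_def L_def sum_distrib_left)
    finally have "(\<Sum>i<n. (x(n := y)) i * ((\<Sum>j<n. A i j * x j) + A i n * y))
        = ip n x (mv n A x) + y * L x" .
    moreover have "ip (Suc n) (x(n := y)) (mv (Suc n) A (x(n := y)))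
        = (\<Sum>i<n. (x(n := y)) i * ((\<Sum>j<n. A i j * x j) + A i n * y)) + y * (L x + A n n * y)"
      by (simp add: ip_def[of "Suc n"] mv_def[of "Suc n"] e L_def fun_upd_same del: fun_upd_apply)
    ultimately show ?thesis
      by (simp add: Q_def tr_def algebra_simps power2_eq_square)
  qed
  have "(\<integral>\<^sup>+r. ennreal ((ip (Suc n) r (mv (Suc n) A r) - tr (Suc n) A)\<^sup>2) \<partial>PiM {..<Suc n} (\<lambda>_. \<mu>))
      = (\<integral>\<^sup>+x. (\<integral>\<^sup>+y. ennreal ((Q x + 2 * y * L x + A n n * (y\<^sup>2 - 1))\<^sup>2) \<partial>\<mu>) \<partial>?P)"
    unfolding lessThan_Suc by (subst product_nn_integral_insert) (auto simp: split)
  also have "\<dots> \<le> (\<integral>\<^sup>+x. ennreal (K * (A n n)\<^sup>2) + (6 * ennreal ((L x)\<^sup>2)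
        + ennreal ((Q x)\<^sup>2)) \<partial>?P)"
  proof (intro nn_integral_mono)
    fix x
    let ?a = "A n n"
    have "(\<integral>\<^sup>+y. ennreal ((Q x + 2 * y * L x + ?a * (y\<^sup>2 - 1))\<^sup>2) \<partial>\<mu>)
        = ennreal ((Q x - ?a)\<^sup>2 + (4 * (L x)\<^sup>2 + 2 * (Q x - ?a) * ?a) + (4 * ?a * L x) * m3 + ?a\<^sup>2 * m4)"
      by (rule nn_integral_quartic[where cb = "4 * (Q x - ?a) * L x"])
         (simp add: power4_eq_xxxx power3_eq_cube power2_eq_square algebra_simps, simp)
    also have "\<dots> \<le> ennreal (K * ?a\<^sup>2 + (6 * (L x)\<^sup>2 + (Q x)\<^sup>2))"
    proof (rule ennreal_leI)
      have "0 \<le> 2 * (L x - ?a * m3)\<^sup>2" by simp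
      then have "(4 * ?a * L x) * m3 \<le> 2 * (L x)\<^sup>2 + 2 * m3\<^sup>2 * ?a\<^sup>2"
        by (simp add: power2_eq_square algebra_simps)
      moreover have "m4 * ?a\<^sup>2 + 2 * m3\<^sup>2 * ?a\<^sup>2 \<le> K * ?a\<^sup>2"
        using K_ge(2) unfolding distrib_right[symmetric] by (intro mult_right_mono) auto
      moreover have "(Q x - ?a)\<^sup>2 + (4 * (L x)\<^sup>2 + 2 * (Q x - ?a) * ?a) + (4 * ?a * L x) * m3 + ?a\<^sup>2 * m4
          = (Q x)\<^sup>2 - ?a\<^sup>2 + 4 * (L x)\<^sup>2 + (4 * ?a * L x) * m3 + m4 * ?a\<^sup>2"
        by (simp add: power2_eq_square algebra_simps)
      moreover have "0 \<le> ?a\<^sup>2" by simp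
      ultimately show "(Q x - ?a)\<^sup>2 + (4 * (L x)\<^sup>2 + 2 * (Q x - ?a) * ?a) + (4 * ?a * L x) * m3 + ?a\<^sup>2 * m4
          \<le> K * ?a\<^sup>2 + (6 * (L x)\<^sup>2 + (Q x)\<^sup>2)"
        by linarith
    qed
    also have "\<dots> = ennreal (K * ?a\<^sup>2) + (6 * ennreal ((L x)\<^sup>2) + ennreal ((Q x)\<^sup>2))"
      using K_ge(1) ennreal_mult_add[of "K * ?a\<^sup>2" 6 "(L x)\<^sup>2" "(Q x)\<^sup>2"] by simp
    finally show "(\<integral>\<^sup>+y. ennreal ((Q x + 2 * y * L x + ?a * (y\<^sup>2 - 1))\<^sup>2) \<partial>\<mu>) \<le> \<dots>" .
  qed
  also have "\<dots> = ennreal (K * (A n n)\<^sup>2) + (6 * (\<integral>\<^sup>+x. ennreal ((L x)\<^sup>2) \<partial>?P)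
        + (\<integral>\<^sup>+x. ennreal ((Q x)\<^sup>2) \<partial>?P))"
    by (simp add: nn_integral_add nn_integral_cmult P.emeasure_space_1)
  also have "(\<integral>\<^sup>+x. ennreal ((L x)\<^sup>2) \<partial>?P) = ennreal v"
    unfolding L_def v_def by (rule linear_form_second_moment) simp
  also have "ennreal (K * (A n n)\<^sup>2) + (6 * ennreal v + (\<integral>\<^sup>+x. ennreal ((Q x)\<^sup>2) \<partial>?P))
      \<le> ennreal (K * (A n n)\<^sup>2) + (6 * ennreal v + ennreal (K * V))"
    using Suc.IH Suc.prems by (intro add_mono) (auto simp: Q_def V_def)
  also have "\<dots> = ennreal (K * (A n n)\<^sup>2 + (6 * v + K * V))"
    using K_ge(1) nonneg ennreal_mult_add[of "K * (A n n)\<^sup>2" 6 v "K * V"] by simp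
  also have "\<dots> \<le> ennreal (K * (\<Sum>i<Suc n. \<Sum>j<Suc n. (A i j)\<^sup>2))"
  proof (rule ennreal_leI)
    have "(\<Sum>i<n. (A i n)\<^sup>2) = v"
      unfolding v_def using Suc.prems by (intro sum.cong) auto
    then have "(\<Sum>i<Suc n. \<Sum>j<Suc n. (A i j)\<^sup>2) = V + v + (v + (A n n)\<^sup>2)"
      by (simp add: V_def v_def sum.distrib)
    moreover have "v * 6 \<le> v * (2 * K)"
      using K_ge(1) nonneg by (intro mult_left_mono) auto
    ultimately show "K * (A n n)\<^sup>2 + (6 * v + K * V) \<le> K * (\<Sum>i<Suc n. \<Sum>j<Suc n. (A i j)\<^sup>2)"
      by (simp add: algebra_simps)
  qed
  finally show ?case .
qed

end


section \<open>Anti-concentration of delocalized linear forms\<close>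

text \<open>For a centered variable with unit variance and fourth moment at most \<open>K\<close>, the left-hand side has
  expectation at least \<open>1 / (8 K)\<close>.\<close>

lemma quartic_minorant:
  fixes t K :: real
  assumes "1 \<le> K"
  shows "t + t\<^sup>2 / (2 * K) - t ^ 4 / (4 * K\<^sup>2) - 1 / (8 * K) \<le> (1 + 4 * K\<^sup>2) * (if 1 / (16 * K) \<le> t then 1 else 0)"
proof -
  define q where "q = 1 / (2 * K)"
  have q: "0 < q" "q \<le> 1 / 2" using assms by (auto simp: q_def)
  have e: "t + t\<^sup>2 / (2 * K) - t ^ 4 / (4 * K\<^sup>2) - 1 / (8 * K) = t + q * t\<^sup>2 - q\<^sup>2 * t ^ 4 - q / 4"
    using assms by (simp add: q_def power2_eq_square field_simps)
  have K: "1 / (16 * K) = q / 8" "1 + 4 * K\<^sup>2 = 1 + 1 / q\<^sup>2"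
    by (simp_all add: q_def power2_eq_square)
  consider "q / 8 \<le> t" | "0 \<le> t" "t < q / 8" | "t < 0" by linarith
  then show ?thesis
  proof cases
    case 1
    \<comment> \<open>Completing the square bounds \<open>2 * t\<^sup>2 - q\<^sup>2 * t ^ 4\<close>;
      one of the two copies of \<open>t\<^sup>2\<close> pays for the quadratic term, the other for
      the linear one.\<close>
    have "0 \<le> (q * t\<^sup>2 - 1 / q)\<^sup>2" by simp
    then have "2 * t\<^sup>2 - q\<^sup>2 * t ^ 4 \<le> 1 / q\<^sup>2"
      using q by (simp add: power2_eq_square power4_eq_xxxx algebra_simps)
    moreover have "q * t\<^sup>2 \<le> 1 * t\<^sup>2" using q by (intro mult_right_mono) auto
    moreover have "0 \<le> (t - 1 / 2)\<^sup>2" by simp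
    then have "t \<le> 1 + t\<^sup>2" by (simp add: power2_eq_square algebra_simps)
    ultimately have "t + q * t\<^sup>2 - q\<^sup>2 * t ^ 4 - q / 4 \<le> 1 + 1 / q\<^sup>2" using q by linarith
    then show ?thesis unfolding e K using 1 by simp
  next
    case 2
    have "q * t\<^sup>2 \<le> 1 * t\<^sup>2" using q by (intro mult_right_mono) auto
    moreover have "t\<^sup>2 \<le> t * 1" unfolding power2_eq_square using 2 q by (intro mult_left_mono) auto
    moreover have "0 \<le> q\<^sup>2 * t ^ 4" by simp
    ultimately have "t + q * t\<^sup>2 - q\<^sup>2 * t ^ 4 - q / 4 \<le> 0" using 2 by linarith
    then show ?thesis unfolding e K using 2 by simp
  next
    case 3
    define z where "z = - t"
    have z: "0 < z" "t = - z" using 3 by (auto simp: z_def)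
    have "q * z \<le> 1 + q\<^sup>2 * z ^ 3"
    proof (cases "q * z \<le> 1")
      case True
      then show ?thesis using z q by (simp add: add_increasing2)
    next
      case False
      then have "1 * z \<le> (q * z) * z" using z by (intro mult_right_mono) auto
      also have "\<dots> \<le> (q * z) * ((q * z) * z)"
        using False z q by (intro mult_left_mono) auto
      finally have "z \<le> q\<^sup>2 * z ^ 3" by (simp add: power2_eq_square power3_eq_cube mult_ac)
      moreover have "q * z \<le> 1 * z" using q z by (intro mult_right_mono) auto
      ultimately show ?thesis by linarith
    qed
    then have "z * (q * z) \<le> z * (1 + q\<^sup>2 * z ^ 3)" using z by (intro mult_left_mono) auto
    then have "q * z\<^sup>2 \<le> z + q\<^sup>2 * z ^ 4"
      by (simp add: power2_eq_square power3_eq_cube power4_eq_xxxx algebra_simps)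
    then have "t + q * t\<^sup>2 - q\<^sup>2 * t ^ 4 - q / 4 \<le> 0" using z q by simp
    then show ?thesis unfolding e K using 3 q by simp
  qed
qed

text \<open>Adding elements one at a time, the sum overshoots \<theta> by at most \<theta> when it
  first reaches it.\<close>

lemma exists_subset_sum_between:
  fixes w :: "'a \<Rightarrow> real"
  assumes "finite I" "0 < \<theta>" "\<And>i. i \<in> I \<Longrightarrow> w i \<le> \<theta>" "\<theta> \<le> sum w I"
  shows "\<exists>J\<subseteq>I. \<theta> \<le> sum w J \<and> sum w J \<le> 2 * \<theta>"
  using assms
proof (induction I rule: finite_induct)
  case empty
  then show ?case by auto
next
  case (insert n I)
  show ?case
  proof (cases "\<theta> \<le> sum w I")
    case True
    then obtain J where "J \<subseteq> I" "\<theta> \<le> sum w J" "sum w J \<le> 2 * \<theta>"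
      using insert by auto
    then show ?thesis by (intro exI[of _ J]) auto
  next
    case False
    have "sum w (insert n I) = w n + sum w I" using insert.hyps by simp
    moreover have "w n \<le> \<theta>" using insert.prems by simp
    ultimately show ?thesis using insert.prems(3) False by (intro exI[of _ "insert n I"]) auto
  qed
qed

context entry_law begin

text \<open>Integrate the quartic minorant: the linear term has mean 0, the square gains 1 / (2 K)
  and the fourth moment costs at most 1 / (4 K). The sign of the form is controlled, not only its
  absolute value, so that independent contributions can later be added.\<close>

lemma linear_form_lower_tail_unit:
  assumes I: "finite I" and unit: "(\<Sum>i\<in>I. (g i)\<^sup>2) = 1"
  shows "1 / (8 * K * (1 + 4 * K\<^sup>2))
    \<le> measure (PiM I (\<lambda>_. \<mu>)) {r \<in> space (PiM I (\<lambda>_. \<mu>)). 1 / (16 * K) \<le> (\<Sum>i\<in>I. g i * r i)}"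
proof -
  let ?P = "PiM I (\<lambda>_. \<mu>)"
  interpret P: prob_space ?P by (intro prob_space_PiM prob_space_axioms)
  define T where "T r = (\<Sum>i\<in>I. g i * r i)" for r
  have [measurable]: "T \<in> borel_measurable ?P" unfolding T_def by measurable
  have nn2: "(\<integral>\<^sup>+r. ennreal ((T r)\<^sup>2) \<partial>?P) = 1"
    using linear_form_second_moment[OF I, of g] unit by (simp add: T_def)
  have nn4: "(\<integral>\<^sup>+r. ennreal ((T r) ^ 4) \<partial>?P) \<le> ennreal K"
    using linear_form_fourth_moment[OF I, of g] unit by (simp add: T_def)
  have i2: "integrable ?P (\<lambda>r. (T r)\<^sup>2)"
    by (rule integrableI_nonneg) (auto simp: nn2)
  have i4: "integrable ?P (\<lambda>r. (T r) ^ 4)"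
    by (rule integrableI_nonneg) (use nn4 in \<open>auto intro: le_less_trans\<close>)
  have e2: "(\<integral>r. (T r)\<^sup>2 \<partial>?P) = 1"
    using nn2 by (subst integral_eq_nn_integral) auto
  have e4: "(\<integral>r. (T r) ^ 4 \<partial>?P) \<le> K"
    using nn4 K_ge(1) by (subst integral_eq_nn_integral) (auto intro: enn2real_leI)
  have comp: "distr ?P \<mu> (\<lambda>r. r i) = \<mu>" if "i \<in> I" for i
    by (rule distr_PiM_component) (use that prob_space_axioms I in auto)
  have ir: "integrable ?P (\<lambda>r. r i)" and er: "(\<integral>r. r i \<partial>?P) = 0" if i: "i \<in> I" for i
  proof -
    have "integrable (distr ?P \<mu> (\<lambda>r. r i)) (\<lambda>x. x)"
      unfolding comp[OF i] by simp
    then show "integrable ?P (\<lambda>r. r i)"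
      using i by (subst (asm) integrable_distr_eq) auto
    have "(\<integral>x. x \<partial>distr ?P \<mu> (\<lambda>r. r i)) = 0"
      unfolding comp[OF i] by (rule mean0)
    then show "(\<integral>r. r i \<partial>?P) = 0"
      using i by (subst (asm) integral_distr) auto
  qed
  have i1: "integrable ?P T" unfolding T_def using ir by auto
  have e1: "(\<integral>r. T r \<partial>?P) = 0"
    unfolding T_def using ir er by (subst Bochner_Integration.integral_sum) auto
  let ?A = "{r \<in> space ?P. 1 / (16 * K) \<le> T r}"
  have K0: "0 < K" using K_ge(1) by simp
  have "1 / (8 * K) \<le> (\<integral>r. T r \<partial>?P) + (\<integral>r. (T r)\<^sup>2 \<partial>?P) / (2 * K)
      - (\<integral>r. (T r) ^ 4 \<partial>?P) / (4 * K\<^sup>2) - 1 / (8 * K)"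
  proof -
    have "(\<integral>r. (T r) ^ 4 \<partial>?P) / (4 * K\<^sup>2) \<le> K / (4 * K\<^sup>2)"
      using e4 by (intro divide_right_mono) auto
    then show ?thesis unfolding e1 e2 using K0 by (simp add: power2_eq_square field_simps)
  qed
  also have "\<dots> = (\<integral>r. T r + (T r)\<^sup>2 / (2 * K) - (T r) ^ 4 / (4 * K\<^sup>2) - 1 / (8 * K) \<partial>?P)"
    using i1 i2 i4 by (simp add: P.prob_space)
  also have "\<dots> \<le> (\<integral>r. (1 + 4 * K\<^sup>2) * indicator ?A r \<partial>?P)"
  proof (rule integral_mono)
    fix r assume "r \<in> space ?P"
    then show "T r + (T r)\<^sup>2 / (2 * K) - (T r) ^ 4 / (4 * K\<^sup>2) - 1 / (8 * K) \<le> (1 + 4 * K\<^sup>2) * indicator ?A r"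
      using quartic_minorant[of K "T r"] K_ge(1) by (simp add: indicator_def split: if_splits)
  qed (use i1 i2 i4 in \<open>auto simp: less_top[symmetric]\<close>)
  also have "\<dots> = (1 + 4 * K\<^sup>2) * measure ?P ?A" by simp
  finally have "1 / (8 * K) / (1 + 4 * K\<^sup>2) \<le> measure ?P ?A"
    by (subst pos_divide_le_eq) (auto simp: add_pos_nonneg mult.commute)
  then show ?thesis unfolding T_def by simp
qed

definition "cl = 1 / (16 * K)"
definition "pl = 1 / (8 * K * (1 + 4 * K\<^sup>2))"

lemma cl_pos: "0 < cl" and pl_pos: "0 < pl" and pl_le: "pl \<le> 1"
proof -
  have "0 < K" "1 \<le> 8 * K" using K_ge(1) by auto
  then show "0 < cl" "0 < pl" by (auto simp: cl_def pl_def add_pos_nonneg)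
  have "1 * 1 \<le> 8 * K * (1 + 4 * K\<^sup>2)"
    using \<open>1 \<le> 8 * K\<close> by (intro mult_mono) auto
  then show "pl \<le> 1" by (simp add: pl_def)
qed

lemma linear_form_lower_tail:
  assumes I: "finite I"
  shows "pl \<le> measure (PiM I (\<lambda>_. \<mu>)) {r \<in> space (PiM I (\<lambda>_. \<mu>)). cl * sqrt (\<Sum>i\<in>I. (g i)\<^sup>2) \<le> (\<Sum>i\<in>I. g i * r i)}"
proof -
  interpret P: prob_space "PiM I (\<lambda>_. \<mu>)" by (intro prob_space_PiM prob_space_axioms)
  define v where "v = (\<Sum>i\<in>I. (g i)\<^sup>2)"
  show ?thesis
  proof (cases "v = 0")
    case True
    then have "g i = 0" if "i \<in> I" for i
      using that I by (simp add: v_def sum_nonneg_eq_0_iff)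
    then have "{r \<in> space (PiM I (\<lambda>_. \<mu>)). cl * sqrt v \<le> (\<Sum>i\<in>I. g i * r i)} = space (PiM I (\<lambda>_. \<mu>))"
      using True by auto
    then show ?thesis using pl_le by (simp add: v_def P.prob_space)
  next
    case False
    moreover have "0 \<le> v" by (simp add: v_def sum_nonneg)
    ultimately have v: "0 < v" by simp
    have "(\<Sum>i\<in>I. (g i / sqrt v)\<^sup>2) = 1"
      using v by (simp add: power_divide sum_divide_distrib[symmetric] v_def[symmetric])
    from linear_form_lower_tail_unit[OF I this]
    have "pl \<le> measure (PiM I (\<lambda>_. \<mu>)) {r \<in> space (PiM I (\<lambda>_. \<mu>)). cl \<le> (\<Sum>i\<in>I. g i / sqrt v * r i)}"
      by (simp add: pl_def cl_def)
    moreover have "(\<Sum>i\<in>I. g i / sqrt v * r i) = (\<Sum>i\<in>I. g i * r i) / sqrt v" for r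
      by (simp add: sum_divide_distrib)
    ultimately show ?thesis using v unfolding v_def[symmetric] by (simp add: pos_le_divide_eq)
  qed
qed

text \<open>Small coordinates allow the index set to be cut into \<open>k\<close> pieces with
  squared mass between \<theta> and 2 \<theta>. The pieces are independent, each exceeds
  \<open>cl * sqrt \<theta>\<close> with probability at least \<open>pl\<close>, and these margins
  add up linearly in \<open>k\<close>. The additional factor \<open>pl\<close> is spent on the
  leftover indices, whose sum is only asked to be nonnegative.\<close>

lemma delocalized_form_tail_aux:
  assumes "finite I" "0 < \<theta>" "\<And>i. i \<in> I \<Longrightarrow> (u i)\<^sup>2 \<le> \<theta>" "real k * (2 * \<theta>) \<le> (\<Sum>i\<in>I. (u i)\<^sup>2)"
  shows "ennreal (pl ^ Suc k) \<le> emeasure (PiM I (\<lambda>_. \<mu>))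
    {r \<in> space (PiM I (\<lambda>_. \<mu>)). real k * (cl * sqrt \<theta>) \<le> (\<Sum>i\<in>I. u i * r i)}"
  using assms
proof (induction k arbitrary: I)
  case 0
  interpret P: prob_space "PiM I (\<lambda>_. \<mu>)" by (intro prob_space_PiM prob_space_axioms)
  have "pl \<le> measure (PiM I (\<lambda>_. \<mu>)) {r \<in> space (PiM I (\<lambda>_. \<mu>)). cl * sqrt (\<Sum>i\<in>I. (u i)\<^sup>2) \<le> (\<Sum>i\<in>I. u i * r i)}"
    by (rule linear_form_lower_tail) fact
  also have "\<dots> \<le> measure (PiM I (\<lambda>_. \<mu>)) {r \<in> space (PiM I (\<lambda>_. \<mu>)). 0 \<le> (\<Sum>i\<in>I. u i * r i)}"
  proof (intro P.finite_measure_mono)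
    have "0 \<le> cl * sqrt (\<Sum>i\<in>I. (u i)\<^sup>2)" using cl_pos by (simp add: sum_nonneg)
    then show "{r \<in> space (PiM I (\<lambda>_. \<mu>)). cl * sqrt (\<Sum>i\<in>I. (u i)\<^sup>2) \<le> (\<Sum>i\<in>I. u i * r i)}
      \<subseteq> {r \<in> space (PiM I (\<lambda>_. \<mu>)). 0 \<le> (\<Sum>i\<in>I. u i * r i)}" by auto
  qed measurable
  finally show ?case by (simp add: P.emeasure_eq_measure)
next
  case (Suc k)
  interpret product_sigma_finite "\<lambda>_. \<mu>" by (rule product_sigma_finite_const)
  have "\<theta> \<le> real (Suc k) * (2 * \<theta>)" using Suc.prems(2) by (simp add: algebra_simps)
  with Suc.prems(4) have "\<theta> \<le> (\<Sum>i\<in>I. (u i)\<^sup>2)" by linarith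
  from exists_subset_sum_between[OF Suc.prems(1-3) this]
  obtain J where J: "J \<subseteq> I" "\<theta> \<le> (\<Sum>i\<in>J. (u i)\<^sup>2)" "(\<Sum>i\<in>J. (u i)\<^sup>2) \<le> 2 * \<theta>" by auto
  define J' where "J' = I - J"
  have fin: "finite J" "finite J'" and I: "I = J \<union> J'" "J \<inter> J' = {}"
    using Suc.prems(1) J(1) finite_subset by (auto simp: J'_def)
  have "(\<Sum>i\<in>I. (u i)\<^sup>2) = (\<Sum>i\<in>J. (u i)\<^sup>2) + (\<Sum>i\<in>J'. (u i)\<^sup>2)"
    unfolding I(1) using fin I(2) by (intro sum.union_disjoint)
  then have "real k * (2 * \<theta>) \<le> (\<Sum>i\<in>J'. (u i)\<^sup>2)"
    using Suc.prems(4) J(3) by (simp add: algebra_simps)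
  from Suc.IH[OF fin(2) Suc.prems(2) _ this] Suc.prems(3)
  have IH: "ennreal (pl ^ Suc k) \<le> emeasure (PiM J' (\<lambda>_. \<mu>))
    {r \<in> space (PiM J' (\<lambda>_. \<mu>)). real k * (cl * sqrt \<theta>) \<le> (\<Sum>i\<in>J'. u i * r i)}" (is "_ \<le> emeasure _ ?B")
    by (auto simp: J'_def)
  interpret PJ: prob_space "PiM J (\<lambda>_. \<mu>)" by (intro prob_space_PiM prob_space_axioms)
  let ?A = "{r \<in> space (PiM J (\<lambda>_. \<mu>)). cl * sqrt \<theta> \<le> (\<Sum>i\<in>J. u i * r i)}"
  let ?C = "{r \<in> space (PiM I (\<lambda>_. \<mu>)). real (Suc k) * (cl * sqrt \<theta>) \<le> (\<Sum>i\<in>I. u i * r i)}"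
  have "pl \<le> measure (PiM J (\<lambda>_. \<mu>)) {r \<in> space (PiM J (\<lambda>_. \<mu>)). cl * sqrt (\<Sum>i\<in>J. (u i)\<^sup>2) \<le> (\<Sum>i\<in>J. u i * r i)}"
    by (rule linear_form_lower_tail) fact
  also have "\<dots> \<le> measure (PiM J (\<lambda>_. \<mu>)) ?A"
  proof (intro PJ.finite_measure_mono)
    have "cl * sqrt \<theta> \<le> cl * sqrt (\<Sum>i\<in>J. (u i)\<^sup>2)" using cl_pos J(2) by simp
    then show "{r \<in> space (PiM J (\<lambda>_. \<mu>)). cl * sqrt (\<Sum>i\<in>J. (u i)\<^sup>2) \<le> (\<Sum>i\<in>J. u i * r i)} \<subseteq> ?A"
      by auto
  qed measurable
  finally have A: "ennreal pl \<le> emeasure (PiM J (\<lambda>_. \<mu>)) ?A"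
    by (simp add: PJ.emeasure_eq_measure)
  have "ennreal (pl ^ Suc (Suc k)) = ennreal pl * ennreal (pl ^ Suc k)"
    using pl_pos by (simp add: ennreal_mult')
  also have "\<dots> \<le> emeasure (PiM J (\<lambda>_. \<mu>)) ?A * emeasure (PiM J' (\<lambda>_. \<mu>)) ?B"
    by (intro mult_mono A IH) auto
  also have "\<dots> = (\<integral>\<^sup>+x. indicator ?A x * emeasure (PiM J' (\<lambda>_. \<mu>)) ?B \<partial>PiM J (\<lambda>_. \<mu>))"
    by (subst nn_integral_multc) auto
  also have "\<dots> = (\<integral>\<^sup>+x. (\<integral>\<^sup>+y. indicator ?A x * indicator ?B y \<partial>PiM J' (\<lambda>_. \<mu>)) \<partial>PiM J (\<lambda>_. \<mu>))"
    by (subst nn_integral_cmult) auto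
  also have "\<dots> \<le> (\<integral>\<^sup>+x. (\<integral>\<^sup>+y. indicator ?C (merge J J' (x, y)) \<partial>PiM J' (\<lambda>_. \<mu>)) \<partial>PiM J (\<lambda>_. \<mu>))"
  proof (intro nn_integral_mono)
    fix x y assume xy: "x \<in> space (PiM J (\<lambda>_. \<mu>))" "y \<in> space (PiM J' (\<lambda>_. \<mu>))"
    let ?m = "merge J J' (x, y)"
    have "?m \<in> space (PiM I (\<lambda>_. \<mu>))"
      using xy by (auto simp: space_PiM space_\<mu> PiE_iff I(1) extensional_def merge_def)
    moreover have "(\<Sum>i\<in>I. u i * ?m i) = (\<Sum>i\<in>J. u i * x i) + (\<Sum>i\<in>J'. u i * y i)"
    proof -
      have "(\<Sum>i\<in>I. u i * ?m i) = (\<Sum>i\<in>J. u i * ?m i) + (\<Sum>i\<in>J'. u i * ?m i)"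
        unfolding I(1) using fin I(2) by (intro sum.union_disjoint)
      also have "(\<Sum>i\<in>J. u i * ?m i) = (\<Sum>i\<in>J. u i * x i)"
        by (intro sum.cong) (auto simp: merge_def)
      also have "(\<Sum>i\<in>J'. u i * ?m i) = (\<Sum>i\<in>J'. u i * y i)"
        using I(2) by (intro sum.cong) (auto simp: merge_def)
      finally show ?thesis .
    qed
    ultimately show "indicator ?A x * indicator ?B y \<le> (indicator ?C ?m :: ennreal)"
      by (auto simp: indicator_def algebra_simps)
  qed
  also have "\<dots> = (\<integral>\<^sup>+r. indicator ?C r \<partial>PiM I (\<lambda>_. \<mu>))"
    unfolding I(1) using fin I(2)
    by (intro product_nn_integral_fold[symmetric]) auto
  also have "\<dots> = emeasure (PiM I (\<lambda>_. \<mu>)) ?C" by simp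
  finally show ?case .
qed

text \<open>With pieces of mass |u|^2 / (2 k) the linear form exceeds its standard deviation by a
  factor of order sqrt k. The probability depends on \<open>k\<close> and the law alone, not on the
  dimension.\<close>

lemma delocalized_form_tail:
  assumes "0 < k" "0 < ip d u u" "\<And>i. i < d \<Longrightarrow> (u i)\<^sup>2 \<le> ip d u u / (2 * real k)"
  shows "ennreal (pl ^ Suc k) \<le> emeasure (PiM {..<d} (\<lambda>_. \<mu>))
    {r \<in> space (PiM {..<d} (\<lambda>_. \<mu>)). cl\<^sup>2 * real k / 2 * ip d u u \<le> (ip d r u)\<^sup>2}"
proof -
  let ?P = "PiM {..<d} (\<lambda>_. \<mu>)"
  define \<theta> where "\<theta> = ip d u u / (2 * real k)"
  have \<theta>: "0 < \<theta>" using assms by (simp add: \<theta>_def)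
  have "ennreal (pl ^ Suc k) \<le> emeasure ?P {r \<in> space ?P. real k * (cl * sqrt \<theta>) \<le> (\<Sum>i<d. u i * r i)}"
    using assms \<theta> by (intro delocalized_form_tail_aux)
      (auto simp: \<theta>_def ip_def power2_eq_square)
  also have "\<dots> \<le> emeasure ?P {r \<in> space ?P. cl\<^sup>2 * real k / 2 * ip d u u \<le> (ip d r u)\<^sup>2}"
  proof (intro emeasure_mono subsetI)
    fix r assume "r \<in> {r \<in> space ?P. real k * (cl * sqrt \<theta>) \<le> (\<Sum>i<d. u i * r i)}"
    then have r: "r \<in> space ?P" "real k * (cl * sqrt \<theta>) \<le> ip d r u"
      by (auto simp: ip_def mult.commute)
    have "(real k * (cl * sqrt \<theta>))\<^sup>2 \<le> (ip d r u)\<^sup>2"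
      using r(2) cl_pos \<theta> by (intro power_mono) auto
    moreover have "(real k * (cl * sqrt \<theta>))\<^sup>2 = cl\<^sup>2 * real k / 2 * ip d u u"
    proof -
      have "(real k * (cl * sqrt \<theta>))\<^sup>2 = (real k)\<^sup>2 * cl\<^sup>2 * \<theta>"
        using \<theta> by (simp add: power_mult_distrib)
      then show ?thesis using assms(1) by (simp add: \<theta>_def power2_eq_square)
    qed
    ultimately show "r \<in> {r \<in> space ?P. cl\<^sup>2 * real k / 2 * ip d u u \<le> (ip d r u)\<^sup>2}"
      using r(1) by simp
  next
    show "{r \<in> space ?P. cl\<^sup>2 * real k / 2 * ip d u u \<le> (ip d r u)\<^sup>2} \<in> sets ?P"
      unfolding ip_def by measurable
  qed
  finally show ?thesis .
qed

end


section \<open>Measurability and leave-one-out integration\<close>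

text \<open>Both sides of the inequality are continuous in \<open>x\<close>. The rational vectors
  are taken extensional so that they form a countable set, which makes the event measurable.\<close>

lemma gram_bounded_iff_rational:
  "gram_bounded d X J b \<longleftrightarrow>
    (\<forall>x\<in>PiE {..<d} (\<lambda>_. \<rat>). (\<Sum>a\<in>J. (ip d (X a) x)\<^sup>2) \<le> b * real d * ip d x x)"
proof
  assume R: "\<forall>x\<in>PiE {..<d} (\<lambda>_. \<rat>). (\<Sum>a\<in>J. (ip d (X a) x)\<^sup>2) \<le> b * real d * ip d x x"
  show "gram_bounded d X J b"
    unfolding gram_bounded_def
  proof
    fix x :: "nat \<Rightarrow> real"
    have "\<exists>q\<in>\<rat>. x i < q \<and> q < x i + 1 / real (Suc n)" for i n
      by (rule Rats_dense_in_real) simp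
    then obtain q where q: "\<And>i n. q i n \<in> \<rat>" "\<And>i n. x i < q i n" "\<And>i n. q i n < x i + 1 / real (Suc n)"
      by metis
    have lim: "q i \<longlonglongrightarrow> x i" for i
    proof (rule tendsto_sandwich)
      show "(\<lambda>n. x i) \<longlonglongrightarrow> x i" by simp
      show "(\<lambda>n. x i + 1 / real (Suc n)) \<longlonglongrightarrow> x i"
        using tendsto_add[OF tendsto_const[of "x i"] LIMSEQ_inverse_real_of_nat] by (simp add: inverse_eq_divide)
    qed (use q in \<open>auto intro!: always_eventually less_imp_le\<close>)
    define y where "y n = restrict (\<lambda>i. q i n) {..<d}" for n
    have ylim: "(\<lambda>n. y n i) \<longlonglongrightarrow> x i" if "i < d" for i
      using lim[of i] that by (simp add: y_def)
    have "(\<lambda>n. (\<Sum>a\<in>J. (ip d (X a) (y n))\<^sup>2)) \<longlonglongrightarrow> (\<Sum>a\<in>J. (ip d (X a) x)\<^sup>2)"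
      unfolding ip_def by (intro tendsto_intros ylim) auto
    moreover have "(\<lambda>n. b * real d * ip d (y n) (y n)) \<longlonglongrightarrow> b * real d * ip d x x"
      unfolding ip_def by (intro tendsto_intros ylim) auto
    moreover have "(\<Sum>a\<in>J. (ip d (X a) (y n))\<^sup>2) \<le> b * real d * ip d (y n) (y n)" for n
      using R q(1) by (auto simp: y_def)
    ultimately show "(\<Sum>a\<in>J. (ip d (X a) x)\<^sup>2) \<le> b * real d * ip d x x"
      by (intro LIMSEQ_le) auto
  qed
qed (simp add: gram_bounded_def)

lemma gram_cong: "(\<And>a. a \<in> J \<Longrightarrow> X a = Y a) \<Longrightarrow> gram d X J = gram d Y J"
  by (simp add: gram_def fun_eq_iff)

lemma gram_bounded_cong:
  assumes "\<And>a i. a \<in> J \<Longrightarrow> i < d \<Longrightarrow> X a i = Y a i"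
  shows "gram_bounded d X J b = gram_bounded d Y J b"
proof -
  have "ip d (X a) x = ip d (Y a) x" if "a \<in> J" for a x
    using assms that by (intro ip_cong) auto
  then show ?thesis by (simp add: gram_bounded_def)
qed

section \<open>Frobenius norms of a symmetric matrix and of its square\<close>

context
  fixes d :: nat and G :: "nat \<Rightarrow> nat \<Rightarrow> real" and c :: real
  assumes sym: "\<And>i j. i < d \<Longrightarrow> j < d \<Longrightarrow> G i j = G j i"
    and norm: "\<And>x. ip d (mv d G x) (mv d G x) \<le> c * ip d x x"
begin

lemma sym_row_norm_le:
  assumes "i < d"
  shows "(\<Sum>j<d. (G i j)\<^sup>2) \<le> c"
proof -
  have "(\<Sum>j<d. (G i j)\<^sup>2) = (\<Sum>j<d. (G j i)\<^sup>2)"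
    using sym[OF assms] by (intro sum.cong) simp_all
  also have "\<dots> = ip d (mv d G (unit_vec i)) (mv d G (unit_vec i))"
    unfolding ip_def mv_unit_vec[OF assms] power2_eq_square ..
  also have "\<dots> \<le> c * ip d (unit_vec i) (unit_vec i)" by (rule norm)
  also have "ip d (unit_vec i) (unit_vec i) = 1"
    using ip_unit_vec[OF assms] by (simp add: unit_vec_def)
  finally show ?thesis by simp
qed

lemma sym_frobenius_le: "(\<Sum>i<d. \<Sum>j<d. (G i j)\<^sup>2) \<le> c * real d"
  using sum_mono[of "{..<d}" "\<lambda>i. \<Sum>j<d. (G i j)\<^sup>2" "\<lambda>_. c"] sym_row_norm_le
  by (simp add: mult.commute)

text \<open>Turns |G r|^2 into a quadratic form in \<open>r\<close>, so that the variance bound for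
  quadratic forms also applies to it.\<close>

lemma ip_square: "ip d (mv d G x) (mv d G x) = ip d x (mv d (\<lambda>i j. \<Sum>l<d. G i l * G l j) x)"
proof -
  have "mv d (\<lambda>i j. \<Sum>l<d. G i l * G l j) x i = mv d G (mv d G x) i" for i
  proof -
    have "mv d (\<lambda>i j. \<Sum>l<d. G i l * G l j) x i = (\<Sum>j<d. \<Sum>l<d. G i l * G l j * x j)"
      by (simp add: mv_def sum_distrib_right)
    also have "\<dots> = (\<Sum>l<d. \<Sum>j<d. G i l * G l j * x j)" by (rule sum.swap)
    finally show ?thesis by (simp add: mv_def sum_distrib_left mult.assoc)
  qed
  then have "mv d (\<lambda>i j. \<Sum>l<d. G i l * G l j) x = mv d G (mv d G x)" ..
  then show ?thesis using ip_mv_symmetric[of d G x "mv d G x", OF sym] by simp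
qed

lemma tr_square: "tr d (\<lambda>i j. \<Sum>l<d. G i l * G l j) = (\<Sum>i<d. \<Sum>j<d. (G i j)\<^sup>2)"
  unfolding tr_def using sym by (intro sum.cong refl) (auto simp: power2_eq_square)

lemma square_frobenius_le:
  "(\<Sum>i<d. \<Sum>j<d. (\<Sum>l<d. G i l * G l j)\<^sup>2) \<le> c * (c * real d)"
proof -
  have c: "0 \<le> c" if "0 < d"
    using order_trans[OF _ sym_row_norm_le[OF that]] by (simp add: sum_nonneg)
  have "(\<Sum>i<d. \<Sum>j<d. (\<Sum>l<d. G i l * G l j)\<^sup>2) = (\<Sum>j<d. \<Sum>i<d. (\<Sum>l<d. G i l * G l j)\<^sup>2)"
    by (rule sum.swap)
  also have "\<dots> \<le> (\<Sum>j<d. c * c)"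
  proof (rule sum_mono)
    fix j assume "j \<in> {..<d}"
    then have j: "j < d" by simp
    have "(\<Sum>i<d. (\<Sum>l<d. G i l * G l j)\<^sup>2) = ip d (mv d G (\<lambda>l. G l j)) (mv d G (\<lambda>l. G l j))"
      by (simp add: ip_def mv_def power2_eq_square)
    also have "\<dots> \<le> c * ip d (\<lambda>l. G l j) (\<lambda>l. G l j)" by (rule norm)
    also have "ip d (\<lambda>l. G l j) (\<lambda>l. G l j) = (\<Sum>l<d. (G j l)\<^sup>2)"
      unfolding ip_def power2_eq_square using sym[OF j] by (intro sum.cong) simp_all
    also have "c * (\<Sum>l<d. (G j l)\<^sup>2) \<le> c * c"
      using sym_row_norm_le[OF j] c j by (intro mult_left_mono) auto
    finally show "(\<Sum>i<d. (\<Sum>l<d. G i l * G l j)\<^sup>2) \<le> c * c" .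
  qed
  finally show ?thesis by (simp add: mult_ac)
qed

end

section \<open>Random rows: measurability and integrating out a single row\<close>

context entry_law begin

abbreviation "rowM d \<equiv> PiM {..<d} (\<lambda>_. \<mu>)"
abbreviation "rowsM d A \<equiv> PiM A (\<lambda>_. rowM d)"

lemma prob_space_row: "prob_space (rowM d)"
  by (intro prob_space_PiM prob_space_axioms)

lemma prob_space_rows: "prob_space (rowsM d A)"
  by (intro prob_space_PiM prob_space_row)

lemma product_sigma_finite_rows: "product_sigma_finite (\<lambda>_. rowM d)"
  using prob_space_row[of d]
  by (intro product_sigma_finite.intro prob_space_imp_sigma_finite)

lemma measurable_entry [measurable (raw)]:
  assumes "a \<in> A" "i < d"
  shows "(\<lambda>X. X a i) \<in> borel_measurable (rowsM d A)"
proof -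
  have "(\<lambda>X. X a) \<in> measurable (rowsM d A) (rowM d)"
    using assms by (intro measurable_component_singleton)
  moreover have "(\<lambda>r. r i) \<in> measurable (rowM d) \<mu>"
    using assms by (intro measurable_component_singleton) simp
  ultimately have "(\<lambda>X. X a i) \<in> measurable (rowsM d A) \<mu>"
    by (rule measurable_compose)
  then show ?thesis by (simp cong: measurable_cong_sets add: sets_\<mu>)
qed

lemma measurable_gram:
  assumes "J \<subseteq> A" "i < d" "j < d"
  shows "(\<lambda>X. gram d X J i j) \<in> borel_measurable (rowsM d A)"
  unfolding gram_def using assms by (auto intro!: borel_measurable_sum borel_measurable_divide borel_measurable_times measurable_entry)

lemma measurable_matpow:
  assumes "J \<subseteq> A" "i < d" "j < d"
  shows "(\<lambda>X. matpow d (gram d X J) k i j) \<in> borel_measurable (rowsM d A)"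
  using assms(2)
proof (induction k arbitrary: i)
  case 0
  then show ?case by simp
next
  case (Suc k)
  then show ?case
    using assms by (auto intro!: borel_measurable_sum borel_measurable_times measurable_gram)
qed

lemma measurable_resolvent:
  assumes "J \<subseteq> A" "i < d" "j < d"
  shows "(\<lambda>X. resolvent d (gram d X J) \<zeta> i j) \<in> borel_measurable (rowsM d A)"
  unfolding resolvent_def
  by (intro borel_measurable_suminf borel_measurable_divide measurable_matpow assms borel_measurable_const)

lemma sets_gram_bounded:
  assumes "J \<subseteq> A"
  shows "{X \<in> space (rowsM d A). gram_bounded d X J b} \<in> sets (rowsM d A)"
proof -
  have "countable (PiE {..<d} (\<lambda>_. \<rat> :: real set))"
    by (intro countable_PiE countable_rat) auto
  moreover have "{X \<in> space (rowsM d A). (\<Sum>a\<in>J. (ip d (X a) x)\<^sup>2) \<le> b * real d * ip d x x} \<in> sets (rowsM d A)" for x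
  proof -
    have "(\<lambda>X. \<Sum>a\<in>J. (ip d (X a) x)\<^sup>2) \<in> borel_measurable (rowsM d A)"
      unfolding ip_def using assms
      by (intro borel_measurable_sum borel_measurable_power borel_measurable_times measurable_entry) auto
    then show ?thesis by measurable
  qed
  ultimately have "{X \<in> space (rowsM d A). \<forall>x\<in>PiE {..<d} (\<lambda>_. \<rat>).
      (\<Sum>a\<in>J. (ip d (X a) x)\<^sup>2) \<le> b * real d * ip d x x} \<in> sets (rowsM d A)"
    by (intro sets.sets_Collect_countable_All')
  then show ?thesis by (simp add: gram_bounded_iff_rational)
qed

lemma leave_out_integral:
  assumes A: "finite A" "a \<in> A" "J \<subseteq> A - {a}" and b: "0 < b" "b < \<zeta>" "0 < d"
    and meas: "(\<lambda>X. f (resolvent d (gram d X J) \<zeta>) (X a)) \<in> borel_measurable (rowsM d A)"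
    and bound: "\<And>G. (\<And>i j. i < d \<Longrightarrow> j < d \<Longrightarrow> G i j = G j i) \<Longrightarrow>
      (\<And>x. ip d (mv d G x) (mv d G x) \<le> 1 / (\<zeta> - b)\<^sup>2 * ip d x x) \<Longrightarrow>
      (\<integral>\<^sup>+r. f G r \<partial>rowM d) \<le> c"
  shows "(\<integral>\<^sup>+X. f (resolvent d (gram d X J) \<zeta>) (X a) * indicator {X. gram_bounded d X J b} X \<partial>rowsM d A) \<le> c"
proof -
  interpret product_sigma_finite "\<lambda>_. rowM d" by (rule product_sigma_finite_rows)
  interpret P: prob_space "rowsM d (A - {a})" by (rule prob_space_rows)
  have ins: "insert a (A - {a}) = A" using A by auto
  have "(\<lambda>X. indicator {X \<in> space (rowsM d A). gram_bounded d X J b} X :: ennreal) \<in> borel_measurable (rowsM d A)"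
    using A by (intro borel_measurable_indicator sets_gram_bounded) auto
  then have meas': "(\<lambda>X. f (resolvent d (gram d X J) \<zeta>) (X a) * indicator {X \<in> space (rowsM d A). gram_bounded d X J b} X)
      \<in> borel_measurable (rowsM d A)"
    using meas by (intro borel_measurable_times_ennreal) auto
  have "(\<integral>\<^sup>+X. f (resolvent d (gram d X J) \<zeta>) (X a) * indicator {X. gram_bounded d X J b} X \<partial>rowsM d A)
      = (\<integral>\<^sup>+X. f (resolvent d (gram d X J) \<zeta>) (X a) * indicator {X \<in> space (rowsM d A). gram_bounded d X J b} X \<partial>rowsM d A)"
    by (intro nn_integral_cong) (auto simp: indicator_def)
  also have "\<dots> = (\<integral>\<^sup>+X. f (resolvent d (gram d X J) \<zeta>) (X a) * indicator {X \<in> space (rowsM d A). gram_bounded d X J b} X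
        \<partial>rowsM d (insert a (A - {a})))"
    unfolding ins ..
  also have "\<dots> = (\<integral>\<^sup>+x. (\<integral>\<^sup>+y. f (resolvent d (gram d (x(a := y)) J) \<zeta>) ((x(a := y)) a)
      * indicator {X \<in> space (rowsM d A). gram_bounded d X J b} (x(a := y)) \<partial>rowM d) \<partial>rowsM d (A - {a}))"
    using A meas' by (intro product_nn_integral_insert) (simp_all only: ins, auto)
  also have "\<dots> \<le> (\<integral>\<^sup>+x. c \<partial>rowsM d (A - {a}))"
  proof (intro nn_integral_mono)
    fix x
    have g: "gram d (x(a := y)) J = gram d x J" "gram_bounded d (x(a := y)) J b = gram_bounded d x J b" for y
      using A by (auto intro!: gram_cong gram_bounded_cong)
    show "(\<integral>\<^sup>+y. f (resolvent d (gram d (x(a := y)) J) \<zeta>) ((x(a := y)) a)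
      * indicator {X \<in> space (rowsM d A). gram_bounded d X J b} (x(a := y)) \<partial>rowM d) \<le> c"
    proof (cases "gram_bounded d x J b")
      case True
      interpret sym_bounded d "gram d x J" b using True b(1,3) by (rule gram_sym_bounded)
      have "(\<integral>\<^sup>+y. f (resolvent d (gram d (x(a := y)) J) \<zeta>) ((x(a := y)) a)
          * indicator {X \<in> space (rowsM d A). gram_bounded d X J b} (x(a := y)) \<partial>rowM d)
          \<le> (\<integral>\<^sup>+y. f (resolvent d (gram d x J) \<zeta>) y \<partial>rowM d)"
        by (intro nn_integral_mono) (auto simp: g indicator_def)
      also have "\<dots> \<le> c"
        using resolvent_sym[OF b(2)] resolvent_norm_le[OF b(2)] by (intro bound) auto
      finally show ?thesis .
    next
      case False
      then show ?thesis by (simp add: g)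
    qed
  qed
  also have "\<dots> = c" by (simp add: P.emeasure_space_1)
  finally show ?thesis .
qed

lemma nn_integral_form_le:
  assumes "\<And>i j. i < d \<Longrightarrow> j < d \<Longrightarrow> G i j = G j i" "\<And>x. ip d (mv d G x) (mv d G x) \<le> c * ip d x x"
  shows "(\<integral>\<^sup>+r. ennreal ((ip d r (mv d G r) - tr d G)\<^sup>2) \<partial>rowM d) \<le> ennreal (K * c * real d)"
proof -
  have "(\<integral>\<^sup>+r. ennreal ((ip d r (mv d G r) - tr d G)\<^sup>2) \<partial>rowM d) \<le> ennreal (K * (\<Sum>i<d. \<Sum>j<d. (G i j)\<^sup>2))"
    using assms(1) by (rule quadratic_form_variance)
  also have "\<dots> \<le> ennreal (K * (c * real d))"
    using sym_frobenius_le[of d G c, OF assms] K_ge(1) by (intro ennreal_leI mult_left_mono) auto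
  finally show ?thesis by (simp add: mult.assoc)
qed

lemma nn_integral_square_form_le:
  assumes "\<And>i j. i < d \<Longrightarrow> j < d \<Longrightarrow> G i j = G j i" "\<And>x. ip d (mv d G x) (mv d G x) \<le> c * ip d x x"
  shows "(\<integral>\<^sup>+r. ennreal ((ip d (mv d G r) (mv d G r) - (\<Sum>i<d. \<Sum>j<d. (G i j)\<^sup>2))\<^sup>2) \<partial>rowM d)
    \<le> ennreal (K * (c * (c * real d)))"
proof -
  have s: "(\<Sum>l<d. G i l * G l j) = (\<Sum>l<d. G j l * G l i)" if "i < d" "j < d" for i j
    using assms(1)[OF that(1)] assms(1)[OF that(2)] by (intro sum.cong) simp_all
  have eq: "ip d (mv d G r) (mv d G r) - (\<Sum>i<d. \<Sum>j<d. (G i j)\<^sup>2)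
      = ip d r (mv d (\<lambda>i j. \<Sum>l<d. G i l * G l j) r) - tr d (\<lambda>i j. \<Sum>l<d. G i l * G l j)" for r
    using ip_square[of d G c r] tr_square[of d G c] assms by auto
  have "(\<integral>\<^sup>+r. ennreal ((ip d (mv d G r) (mv d G r) - (\<Sum>i<d. \<Sum>j<d. (G i j)\<^sup>2))\<^sup>2) \<partial>rowM d)
      \<le> ennreal (K * (\<Sum>i<d. \<Sum>j<d. (\<Sum>l<d. G i l * G l j)\<^sup>2))"
    unfolding eq using s by (rule quadratic_form_variance)
  also have "\<dots> \<le> ennreal (K * (c * (c * real d)))"
    using square_frobenius_le[of d G c, OF assms] K_ge(1) by (intro ennreal_leI mult_left_mono) auto
  finally show ?thesis .
qed

text \<open>The source of delocalization: a sum of fourth powers of order d forces every squared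
  coordinate of G r down to order sqrt d, whereas |G r|^2 will be of order d.\<close>

lemma nn_integral_quartic_sum_le:
  assumes "\<And>i j. i < d \<Longrightarrow> j < d \<Longrightarrow> G i j = G j i" "\<And>x. ip d (mv d G x) (mv d G x) \<le> c * ip d x x"
  shows "(\<integral>\<^sup>+r. ennreal (\<Sum>i<d. (mv d G r i) ^ 4) \<partial>rowM d) \<le> ennreal (K * c\<^sup>2 * real d)"
proof -
  have "(\<integral>\<^sup>+r. ennreal (\<Sum>i<d. (mv d G r i) ^ 4) \<partial>rowM d) = (\<integral>\<^sup>+r. (\<Sum>i<d. ennreal ((mv d G r i) ^ 4)) \<partial>rowM d)"
    by (simp add: sum_ennreal)
  also have "\<dots> = (\<Sum>i<d. \<integral>\<^sup>+r. ennreal ((mv d G r i) ^ 4) \<partial>rowM d)"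
    unfolding mv_def by (intro nn_integral_sum) measurable
  also have "\<dots> \<le> (\<Sum>i<d. ennreal (K * c\<^sup>2))"
  proof (rule sum_mono)
    fix i assume "i \<in> {..<d}"
    then have i: "i < d" by simp
    have "(\<integral>\<^sup>+r. ennreal ((mv d G r i) ^ 4) \<partial>rowM d) \<le> ennreal (K * (\<Sum>j<d. (G i j)\<^sup>2)\<^sup>2)"
      unfolding mv_def by (rule linear_form_fourth_moment) simp
    also have "\<dots> \<le> ennreal (K * c\<^sup>2)"
      using sym_row_norm_le[of d G c, OF assms i] K_ge(1)
      by (intro ennreal_leI mult_left_mono power_mono) (auto intro: sum_nonneg)
    finally show "(\<integral>\<^sup>+r. ennreal ((mv d G r i) ^ 4) \<partial>rowM d) \<le> ennreal (K * c\<^sup>2)" .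
  qed
  also have "\<dots> = ennreal (K * c\<^sup>2 * real d)"
    using K_ge(1) by (simp add: ennreal_of_nat_eq_real_of_nat ennreal_mult'[symmetric] mult_ac)
  finally show ?thesis .
qed

end


section \<open>The self-consistent equation for the Stieltjes transform\<close>

text \<open>Decouples the product into squares whose expectations are known: \<open>q\<close> stands
  for the fluctuation of a quadratic form and \<rho> for the squared length of a row, which is close
  to D.\<close>

lemma error_term_le:
  fixes q \<rho> D \<Delta> :: real
  assumes "0 < D" "0 < \<Delta>" "0 \<le> \<rho>"
  shows "(\<bar>q\<bar> / D + 1 / (D * \<Delta>)) * (1 + \<rho> / (D * \<Delta>))
    \<le> (1 / (D * \<Delta>\<^sup>2) + 1 + 2 / \<Delta>\<^sup>2) / sqrt D
      + (1 / (D * sqrt D) * q\<^sup>2 + 2 / (D\<^sup>2 * \<Delta>\<^sup>2 * sqrt D) * (\<rho> - D)\<^sup>2)"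
proof -
  define s where "s = sqrt D"
  have s: "0 < s" "D = s\<^sup>2" using assms by (auto simp: s_def)
  define x where "x = \<bar>q\<bar> / D + 1 / (D * \<Delta>)"
  define y where "y = 1 + \<rho> / (D * \<Delta>)"
  have sq: "(u + v)\<^sup>2 \<le> 2 * u\<^sup>2 + 2 * v\<^sup>2" for u v :: real
    using zero_le_power2[of "u - v"] by (simp add: power2_eq_square algebra_simps)
  \<comment> \<open>The weight \<open>s = sqrt D\<close> balances the two factors: typically
    \<open>x\<close> has order 1 / sqrt D and \<open>y\<close> order 1.\<close>
  have "0 \<le> (s * x - y)\<^sup>2 / (2 * s)" using s by simp
  then have "x * y \<le> s / 2 * x\<^sup>2 + y\<^sup>2 / (2 * s)"
    using s by (simp add: power2_eq_square field_simps)
  also have "s / 2 * x\<^sup>2 \<le> s / 2 * (2 * (\<bar>q\<bar> / D)\<^sup>2 + 2 * (1 / (D * \<Delta>))\<^sup>2)"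
    unfolding x_def using s by (intro mult_left_mono sq) auto
  also have "\<dots> = 1 / (D * s) * q\<^sup>2 + 1 / (D * \<Delta>\<^sup>2) / s"
    using s assms by (simp add: power2_eq_square field_simps)
  also have "y\<^sup>2 / (2 * s) \<le> (2 + 4 / \<Delta>\<^sup>2 + 4 * (\<rho> - D)\<^sup>2 / (D\<^sup>2 * \<Delta>\<^sup>2)) / (2 * s)"
  proof (rule divide_right_mono)
    have "\<rho>\<^sup>2 \<le> 2 * D\<^sup>2 + 2 * (\<rho> - D)\<^sup>2" using sq[of D "\<rho> - D"] by simp
    then have "\<rho>\<^sup>2 / (D * \<Delta>)\<^sup>2 \<le> (2 * D\<^sup>2 + 2 * (\<rho> - D)\<^sup>2) / (D * \<Delta>)\<^sup>2"
      by (rule divide_right_mono) simp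
    also have "\<dots> = 2 / \<Delta>\<^sup>2 + 2 * (\<rho> - D)\<^sup>2 / (D\<^sup>2 * \<Delta>\<^sup>2)"
      using assms by (simp add: power_mult_distrib add_divide_distrib)
    finally have "(\<rho> / (D * \<Delta>))\<^sup>2 \<le> 2 / \<Delta>\<^sup>2 + 2 * (\<rho> - D)\<^sup>2 / (D\<^sup>2 * \<Delta>\<^sup>2)"
      by (simp add: power_divide)
    moreover have "y\<^sup>2 \<le> 2 * 1\<^sup>2 + 2 * (\<rho> / (D * \<Delta>))\<^sup>2" unfolding y_def by (rule sq)
    ultimately show "y\<^sup>2 \<le> 2 + 4 / \<Delta>\<^sup>2 + 4 * (\<rho> - D)\<^sup>2 / (D\<^sup>2 * \<Delta>\<^sup>2)" by simp
  qed (use s in auto)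
  also have "(2 + 4 / \<Delta>\<^sup>2 + 4 * (\<rho> - D)\<^sup>2 / (D\<^sup>2 * \<Delta>\<^sup>2)) / (2 * s)
      = (1 + 2 / \<Delta>\<^sup>2) / s + 2 / (D\<^sup>2 * \<Delta>\<^sup>2 * s) * (\<rho> - D)\<^sup>2"
    using s(1) assms(1,2) by (simp add: add_divide_distrib mult_ac)
  finally show ?thesis
    unfolding x_def[symmetric] y_def[symmetric] s_def[symmetric] by (simp add: add_divide_distrib)
qed

context entry_law begin

text \<open>Collects the coefficients of the error bound after estimating 1 / d by 1.\<close>

definition "err_const \<Delta> = 1 + (3 * K + 3) / \<Delta>\<^sup>2"

lemma err_const_pos: "0 < err_const \<Delta>"
  using K_ge(1) by (auto simp: err_const_def intro!: add_pos_nonneg divide_nonneg_nonneg)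

lemma nn_integral_error_term_le:
  assumes G: "\<And>i j. i < d \<Longrightarrow> j < d \<Longrightarrow> G i j = G j i"
      "\<And>x. ip d (mv d G x) (mv d G x) \<le> 1 / \<Delta>\<^sup>2 * ip d x x"
    and "0 < \<Delta>" "0 < d"
  shows "(\<integral>\<^sup>+r. ennreal ((\<bar>ip d r (mv d G r) - tr d G\<bar> / real d + 1 / (real d * \<Delta>))
      * (1 + ip d r r / (real d * \<Delta>))) \<partial>rowM d) \<le> ennreal (err_const \<Delta> / sqrt (real d))"
proof -
  interpret P: prob_space "rowM d" by (rule prob_space_row)
  \<comment> \<open>The deviation of |r|^2 from d is the centred quadratic form of the identity, so
    the same variance bound covers it.\<close>
  define I :: "nat \<Rightarrow> nat \<Rightarrow> real" where "I i j = unit_vec j i" for i j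
  have mvI: "mv d I x i = x i" if "i < d" for x i
    using that by (simp add: mv_def I_def unit_vec_def if_distrib[of "\<lambda>z. z * _"] cong: if_cong)
  have ipI: "ip d r (mv d I r) - tr d I = ip d r r - real d" for r
  proof -
    have "ip d r (mv d I r) = ip d r r" using mvI by (intro ip_cong) auto
    then show ?thesis by (simp add: tr_def I_def unit_vec_def)
  qed
  have w: "(\<integral>\<^sup>+r. ennreal ((ip d r r - real d)\<^sup>2) \<partial>rowM d) \<le> ennreal (K * 1 * real d)"
    unfolding ipI[symmetric]
  proof (rule nn_integral_form_le)
    show "I i j = I j i" for i j by (simp add: I_def unit_vec_def)
    show "ip d (mv d I x) (mv d I x) \<le> 1 * ip d x x" for x
      using ip_cong[of d "mv d I x" x "mv d I x" x] mvI by simp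
  qed
  have q: "(\<integral>\<^sup>+r. ennreal ((ip d r (mv d G r) - tr d G)\<^sup>2) \<partial>rowM d) \<le> ennreal (K * (1 / \<Delta>\<^sup>2) * real d)"
    using G by (rule nn_integral_form_le)
  define D where "D = real d"
  have D: "1 \<le> D" using assms by (simp add: D_def)
  let ?c = "(1 / (D * \<Delta>\<^sup>2) + 1 + 2 / \<Delta>\<^sup>2) / sqrt D"
  let ?p = "1 / (D * sqrt D)" and ?w = "2 / (D\<^sup>2 * \<Delta>\<^sup>2 * sqrt D)"
  have meas [measurable]: "(\<lambda>r. ip d r (mv d G r) - tr d G) \<in> borel_measurable (rowM d)"
    "(\<lambda>r. ip d r r - D) \<in> borel_measurable (rowM d)"
    unfolding ip_def mv_def by measurable
  have nn: "0 \<le> ?c" "0 \<le> ?p" "0 \<le> ?w" using D by auto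
  have "(\<integral>\<^sup>+r. ennreal ((\<bar>ip d r (mv d G r) - tr d G\<bar> / D + 1 / (D * \<Delta>))
      * (1 + ip d r r / (D * \<Delta>))) \<partial>rowM d)
      \<le> (\<integral>\<^sup>+r. ennreal ?c + (ennreal ?p * ennreal ((ip d r (mv d G r) - tr d G)\<^sup>2)
          + ennreal ?w * ennreal ((ip d r r - D)\<^sup>2)) \<partial>rowM d)"
  proof (rule nn_integral_mono)
    fix r
    have "ennreal ((\<bar>ip d r (mv d G r) - tr d G\<bar> / D + 1 / (D * \<Delta>)) * (1 + ip d r r / (D * \<Delta>)))
        \<le> ennreal (?c + (?p * (ip d r (mv d G r) - tr d G)\<^sup>2 + ?w * (ip d r r - D)\<^sup>2))"
      using D assms(3) ip_self_nonneg by (intro ennreal_leI error_term_le) auto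
    also have "\<dots> = ennreal ?c + (ennreal ?p * ennreal ((ip d r (mv d G r) - tr d G)\<^sup>2)
          + ennreal ?w * ennreal ((ip d r r - D)\<^sup>2))"
      using nn by (simp only: ennreal_plus ennreal_mult zero_le_power2 add_nonneg_nonneg mult_nonneg_nonneg)
    finally show "ennreal ((\<bar>ip d r (mv d G r) - tr d G\<bar> / D + 1 / (D * \<Delta>)) * (1 + ip d r r / (D * \<Delta>))) \<le> \<dots>" .
  qed
  also have "\<dots> = ennreal ?c + (ennreal ?p * (\<integral>\<^sup>+r. ennreal ((ip d r (mv d G r) - tr d G)\<^sup>2) \<partial>rowM d)
      + ennreal ?w * (\<integral>\<^sup>+r. ennreal ((ip d r r - D)\<^sup>2) \<partial>rowM d))"
    by (simp add: nn_integral_add nn_integral_cmult P.emeasure_space_1)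
  also have "\<dots> \<le> ennreal ?c + (ennreal ?p * ennreal (K * (1 / \<Delta>\<^sup>2) * D) + ennreal ?w * ennreal (K * 1 * D))"
    using q w unfolding D_def[symmetric] by (intro add_mono mult_left_mono) auto
  also have "\<dots> = ennreal (?c + (?p * (K * (1 / \<Delta>\<^sup>2) * D) + ?w * (K * 1 * D)))"
    using nn K_ge(1) D by (simp only: ennreal_plus ennreal_mult add_nonneg_nonneg mult_nonneg_nonneg
        zero_le_divide_1_iff zero_le_power2 zero_le_one)
  also have "\<dots> \<le> ennreal (err_const \<Delta> / sqrt D)"
  proof (rule ennreal_leI)
    define v where "v = 1 / \<Delta>\<^sup>2"
    have v: "0 \<le> v" by (simp add: v_def)
    have "?c + (?p * (K * (1 / \<Delta>\<^sup>2) * D) + ?w * (K * 1 * D))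
        = (1 + 2 * v + K * v + (1 + 2 * K) * v / D) / sqrt D"
    proof -
      have "?c = (v / D + 1 + 2 * v) / sqrt D" by (simp add: v_def mult.commute)
      moreover have "?p * (K * (1 / \<Delta>\<^sup>2) * D) = K * v / sqrt D" using D by (simp add: v_def)
      moreover have "?w * (K * 1 * D) = 2 * K * v / D / sqrt D"
        using D by (simp add: v_def power2_eq_square mult_ac)
      ultimately show ?thesis by (simp only:) (simp add: add_divide_distrib algebra_simps)
    qed
    also have "\<dots> \<le> (1 + 2 * v + K * v + (1 + 2 * K) * v) / sqrt D"
    proof (intro divide_right_mono add_left_mono)
      have "0 \<le> (1 + 2 * K) * v" using v K_ge(1) by simp
      then show "(1 + 2 * K) * v / D \<le> (1 + 2 * K) * v"
        using D by (simp add: divide_le_eq mult_le_cancel_left1)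
    qed (use D in auto)
    also have "\<dots> = err_const \<Delta> / sqrt D"
      unfolding err_const_def v_def by (simp add: algebra_simps add_divide_distrib)
    finally show "?c + (?p * (K * (1 / \<Delta>\<^sup>2) * D) + ?w * (K * 1 * D)) \<le> err_const \<Delta> / sqrt D" .
  qed
  finally show ?thesis unfolding D_def .
qed

text \<open>The defect in the quadratic equation for the normalised trace when N rows are present in
  dimension d; for N = d it is the defect in \<zeta> \<tau> (1 - \<tau>) = 1.\<close>

definition sc_error :: "nat \<Rightarrow> nat \<Rightarrow> real \<Rightarrow> (nat \<Rightarrow> nat \<Rightarrow> real) \<Rightarrow> real" where
  "sc_error d N \<zeta> X = (let \<tau> = tr d (resolvent d (gram d X {..<N}) \<zeta>) / real d
    in \<zeta> * \<tau> - 1 - \<tau> * (real N / real d + \<zeta> * \<tau> - 1))"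

lemma measurable_form:
  assumes "J \<subseteq> A" "a \<in> A"
  shows "(\<lambda>X. ip d (X a) (mv d (resolvent d (gram d X J) \<zeta>) (X a))) \<in> borel_measurable (rowsM d A)"
    and "(\<lambda>X. tr d (resolvent d (gram d X J) \<zeta>)) \<in> borel_measurable (rowsM d A)"
    and "(\<lambda>X. ip d (X a) (X a)) \<in> borel_measurable (rowsM d A)"
    and "i < d \<Longrightarrow> (\<lambda>X. mv d (resolvent d (gram d X J) \<zeta>) (X a) i) \<in> borel_measurable (rowsM d A)"
  unfolding ip_def mv_def tr_def using assms
  by (auto intro!: borel_measurable_sum borel_measurable_times measurable_entry measurable_resolvent)

text \<open>Only rows below \<open>N\<close> enter the integrand; the sample space also carries row
  \<open>N\<close>, the fresh one, so that all later estimates live on the same space.\<close>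

lemma nn_integral_sc_error_le:
  assumes "0 < b" "b < \<zeta>" "0 < d" "N \<le> d"
  shows "(\<integral>\<^sup>+X. ennreal \<bar>sc_error d N \<zeta> X\<bar> * indicator {X. gram_bounded d X {..<N} b} X \<partial>rowsM d {..<Suc N})
    \<le> ennreal (err_const (\<zeta> - b) / sqrt (real d))"
proof -
  define f where "f G r = ennreal ((\<bar>ip d r (mv d G r) - tr d G\<bar> / real d + 1 / (real d * (\<zeta> - b)))
      * (1 + ip d r r / (real d * (\<zeta> - b))))" for G r
  define J where "J a = {..<N} - {a}" for a
  have meas: "(\<lambda>X. f (resolvent d (gram d X (J a)) \<zeta>) (X a)) \<in> borel_measurable (rowsM d {..<Suc N})" if "a < N" for a
    unfolding f_def using that
    by (intro measurable_compose[OF _ measurable_ennreal] borel_measurable_times borel_measurable_add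
        borel_measurable_divide borel_measurable_abs borel_measurable_diff borel_measurable_const measurable_form)
       (auto simp: J_def)
  have "(\<integral>\<^sup>+X. ennreal \<bar>sc_error d N \<zeta> X\<bar> * indicator {X. gram_bounded d X {..<N} b} X \<partial>rowsM d {..<Suc N})
      \<le> (\<integral>\<^sup>+X. (\<Sum>a<N. ennreal (1 / real d) * (f (resolvent d (gram d X (J a)) \<zeta>) (X a)
          * indicator {X \<in> space (rowsM d {..<Suc N}). gram_bounded d X (J a) b} X)) \<partial>rowsM d {..<Suc N})"
  proof (rule nn_integral_mono)
    fix X assume X: "X \<in> space (rowsM d {..<Suc N})"
    show "ennreal \<bar>sc_error d N \<zeta> X\<bar> * indicator {X. gram_bounded d X {..<N} b} X
      \<le> (\<Sum>a<N. ennreal (1 / real d) * (f (resolvent d (gram d X (J a)) \<zeta>) (X a)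
          * indicator {X \<in> space (rowsM d {..<Suc N}). gram_bounded d X (J a) b} X))"
    proof (cases "gram_bounded d X {..<N} b")
      case True
      \<comment> \<open>The event is relaxed to the one for the remaining rows, which does not
        involve row \<open>a\<close>; this is the form needed to integrate that row first.\<close>
      then have Ja: "gram_bounded d X (J a) b" for a
        by (rule gram_bounded_mono) (auto simp: J_def)
      have "ennreal \<bar>sc_error d N \<zeta> X\<bar> \<le> ennreal ((\<Sum>a<N.
        (\<bar>ip d (X a) (mv d (resolvent d (gram d X (J a)) \<zeta>) (X a)) - tr d (resolvent d (gram d X (J a)) \<zeta>)\<bar> / real d
          + 1 / (real d * (\<zeta> - b)))
        * (1 + ip d (X a) (X a) / (real d * (\<zeta> - b)))) / real d)"
        using self_consistent_error[OF True assms(1,3,2)]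
        by (intro ennreal_leI) (simp add: sc_error_def Let_def J_def)
      also have "\<dots> = (\<Sum>a<N. ennreal (1 / real d * ((\<bar>ip d (X a) (mv d (resolvent d (gram d X (J a)) \<zeta>) (X a)) - tr d (resolvent d (gram d X (J a)) \<zeta>)\<bar> / real d
          + 1 / (real d * (\<zeta> - b)))
        * (1 + ip d (X a) (X a) / (real d * (\<zeta> - b))))))"
        using assms(2) ip_self_nonneg[of d]
        by (subst sum_ennreal) (auto simp: sum_divide_distrib intro!: divide_nonneg_nonneg mult_nonneg_nonneg add_nonneg_nonneg)
      also have "\<dots> = (\<Sum>a<N. ennreal (1 / real d) * f (resolvent d (gram d X (J a)) \<zeta>) (X a))"
        unfolding f_def by (subst ennreal_mult'[symmetric]) auto
      finally show ?thesis using True Ja X by simp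
    next
      case False
      then show ?thesis by simp
    qed
  qed
  also have "\<dots> = (\<Sum>a<N. ennreal (1 / real d) * (\<integral>\<^sup>+X. f (resolvent d (gram d X (J a)) \<zeta>) (X a)
          * indicator {X \<in> space (rowsM d {..<Suc N}). gram_bounded d X (J a) b} X \<partial>rowsM d {..<Suc N}))"
  proof -
    have m: "(\<lambda>X. f (resolvent d (gram d X (J a)) \<zeta>) (X a)
          * indicator {X \<in> space (rowsM d {..<Suc N}). gram_bounded d X (J a) b} X) \<in> borel_measurable (rowsM d {..<Suc N})"
      if "a < N" for a
      using that by (intro borel_measurable_times_ennreal meas borel_measurable_indicator sets_gram_bounded)
        (auto simp: J_def)
    show ?thesis
      using m by (subst nn_integral_sum) (auto simp: nn_integral_cmult intro!: borel_measurable_times_ennreal)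
  qed
  also have "\<dots> \<le> (\<Sum>a<N. ennreal (1 / real d) * ennreal (err_const (\<zeta> - b) / sqrt (real d)))"
  proof (intro sum_mono mult_left_mono)
    fix a assume "a \<in> {..<N}"
    then have a: "a < N" by simp
    have "(\<integral>\<^sup>+X. f (resolvent d (gram d X (J a)) \<zeta>) (X a)
          * indicator {X \<in> space (rowsM d {..<Suc N}). gram_bounded d X (J a) b} X \<partial>rowsM d {..<Suc N})
       = (\<integral>\<^sup>+X. f (resolvent d (gram d X (J a)) \<zeta>) (X a)
          * indicator {X. gram_bounded d X (J a) b} X \<partial>rowsM d {..<Suc N})"
      by (intro nn_integral_cong) (auto simp: indicator_def)
    also have "\<dots> \<le> ennreal (err_const (\<zeta> - b) / sqrt (real d))"
    proof (rule leave_out_integral[OF _ _ _ assms(1-3) meas[OF a]])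
      show "(\<integral>\<^sup>+r. f G r \<partial>rowM d) \<le> ennreal (err_const (\<zeta> - b) / sqrt (real d))"
        if "\<And>i j. i < d \<Longrightarrow> j < d \<Longrightarrow> G i j = G j i"
          "\<And>x. ip d (mv d G x) (mv d G x) \<le> 1 / (\<zeta> - b)\<^sup>2 * ip d x x" for G
        unfolding f_def using that assms(2,3) by (intro nn_integral_error_term_le) auto
    qed (use a in \<open>auto simp: J_def\<close>)
    finally show "(\<integral>\<^sup>+X. f (resolvent d (gram d X (J a)) \<zeta>) (X a)
          * indicator {X \<in> space (rowsM d {..<Suc N}). gram_bounded d X (J a) b} X \<partial>rowsM d {..<Suc N})
        \<le> ennreal (err_const (\<zeta> - b) / sqrt (real d))" .
  qed auto
  also have "\<dots> = ennreal (real N / real d * (err_const (\<zeta> - b) / sqrt (real d)))"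
    using err_const_pos[of "\<zeta> - b"] by (simp add: ennreal_of_nat_eq_real_of_nat ennreal_mult'[symmetric] less_imp_le)
  also have "\<dots> \<le> ennreal (1 * (err_const (\<zeta> - b) / sqrt (real d)))"
    using assms(3,4) err_const_pos[of "\<zeta> - b"] by (intro ennreal_leI mult_right_mono) (auto simp: divide_le_eq)
  finally show ?thesis by simp
qed

end


section \<open>A delocalized vector near the spectral edge\<close>

text \<open>At \<zeta>, close to 4, the root \<tau> is pinned to 1/2 within sqrt h / 31. At
  \<zeta>', about h above 4, the root \<tau>' is at least sqrt h / 5 away from 1/2. Monotonicity of
  the trace decides on which side, so no continuity argument along a path in \<zeta> has to select
  the branch.\<close>

lemma stieltjes_gap:
  fixes h \<kappa> e e' \<tau> \<tau>' \<zeta> \<zeta>' :: real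
  assumes h: "0 < h" "h \<le> 1" and e: "\<bar>e\<bar> \<le> h / 1000" "\<bar>e'\<bar> \<le> h / 1000"
    and \<kappa>: "0 \<le> \<kappa>" "\<kappa> \<le> h / 1000" and \<zeta>: "\<zeta> = 4 + 2 * (h / 1000)" "\<zeta>' = \<zeta> + h"
    and \<tau>: "0 \<le> \<tau>'" "\<tau>' \<le> \<tau>"
    and eq: "\<zeta> * \<tau> - 1 - \<tau> * (1 - \<kappa> + \<zeta> * \<tau> - 1) = e"
    and eq': "\<zeta>' * \<tau>' - 1 - \<tau>' * (1 - \<kappa> + \<zeta>' * \<tau>' - 1) = e'"
  shows "\<tau> \<le> 9 / 10" "sqrt h / 10 \<le> \<tau> - \<tau>'"
proof -
  define s where "s = sqrt h"
  have s: "0 < s" "s \<le> 1" "h = s\<^sup>2" using h by (auto simp: s_def)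
  \<comment> \<open>Completing the square exhibits the double root 1/2 at \<zeta> = 4.\<close>
  have q: "\<zeta> * (\<tau> - 1 / 2)\<^sup>2 = \<zeta> / 4 - 1 + \<kappa> * \<tau> - e"
    using eq by (simp add: power2_eq_square algebra_simps)
  have q': "\<zeta>' * (\<tau>' - 1 / 2)\<^sup>2 = \<zeta>' / 4 - 1 + \<kappa> * \<tau>' - e'"
    using eq' by (simp add: power2_eq_square algebra_simps)
  have \<kappa>\<tau>: "\<kappa> * \<tau> \<le> h / 1000 * \<tau>" using \<kappa> \<tau> by (intro mult_right_mono) auto
  have le4: "4 * (\<tau> - 1 / 2)\<^sup>2 \<le> \<zeta> * (\<tau> - 1 / 2)\<^sup>2"
    using \<zeta>(1) h by (intro mult_right_mono) auto
  \<comment> \<open>A crude bound on \<tau>, needed before the perturbation \<kappa> \<tau> can be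
    treated as small.\<close>
  have \<tau>2: "\<tau> \<le> 2"
  proof (rule ccontr)
    assume "\<not> \<tau> \<le> 2"
    then have t: "2 < \<tau>" by simp
    have "4 * (\<tau> - 1 / 2)\<^sup>2 \<le> \<zeta> / 4 - 1 + h / 1000 * \<tau> - e" using le4 q \<kappa>\<tau> by linarith
    also have "\<dots> \<le> 1 + 1 * \<tau>"
    proof -
      have "h / 1000 * \<tau> \<le> 1 * \<tau>" using h t by (intro mult_right_mono) auto
      then show ?thesis using \<zeta>(1) h e(1) by linarith
    qed
    also have "\<dots> < 4 * (\<tau> - 1 / 2)\<^sup>2"
    proof -
      have "3 / 2 * (\<tau> - 1 / 2) < (\<tau> - 1 / 2) * (\<tau> - 1 / 2)"
        using t by (intro mult_strict_right_mono) auto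
      then show ?thesis using t by (simp add: power2_eq_square)
    qed
    finally show False by simp
  qed
  have "h / 1000 * \<tau> \<le> h / 1000 * 2" using \<tau>2 h by (intro mult_left_mono) auto
  then have "4 * (\<tau> - 1 / 2)\<^sup>2 \<le> 4 * (h / 1000)"
    using le4 q \<kappa>\<tau> \<zeta>(1) e(1) h by linarith
  then have "(\<tau> - 1 / 2)\<^sup>2 \<le> h / 1000" by simp
  \<comment> \<open>31^2 = 961 is below 1000.\<close>
  also have "\<dots> \<le> (s / 31)\<^sup>2" using s h by (simp add: power_divide)
  finally have "\<bar>\<tau> - 1 / 2\<bar> \<le> \<bar>s / 31\<bar>" unfolding abs_le_square_iff .
  then have t1: "\<tau> \<le> 1 / 2 + s / 31" "1 / 2 - s / 31 \<le> \<tau>" using s(1) by linarith+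
  then show "\<tau> \<le> 9 / 10" using s by simp
  have "0 \<le> \<kappa> * \<tau>'" using \<kappa> \<tau> by simp
  \<comment> \<open>h / 4 comes from the shift of \<zeta>', and h / 1000 is lost to the error e';
    the term with \<kappa> only helps.\<close>
  then have "249 / 1000 * h \<le> \<zeta>' * (\<tau>' - 1 / 2)\<^sup>2"
    using q' \<zeta> e(2) h by linarith
  also have "\<dots> \<le> 6 * (\<tau>' - 1 / 2)\<^sup>2"
    using \<zeta> h by (intro mult_right_mono) auto
  finally have "249 / 1000 * s\<^sup>2 \<le> 6 * (\<tau>' - 1 / 2)\<^sup>2" using s(3) by simp
  moreover have "(s / 5)\<^sup>2 = s\<^sup>2 / 25" by (simp add: power_divide)
  ultimately have "(s / 5)\<^sup>2 \<le> (\<tau>' - 1 / 2)\<^sup>2"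
    using zero_le_power2[of "\<tau>' - 1 / 2"] by linarith
  then have "\<bar>s / 5\<bar> \<le> \<bar>\<tau>' - 1 / 2\<bar>" unfolding abs_le_square_iff .
  then have "s / 5 \<le> \<bar>\<tau>' - 1 / 2\<bar>" using s by simp
  \<comment> \<open>This excludes the upper branch, since \<tau>' is at most \<tau>.\<close>
  moreover have "\<tau>' < 1 / 2 + s / 5" using t1 \<tau> s by linarith
  ultimately have "\<tau>' \<le> 1 / 2 - s / 5" by linarith
  then show "sqrt h / 10 \<le> \<tau> - \<tau>'" using t1 s unfolding s_def[symmetric] by linarith
qed

lemma emeasure_Markov:
  fixes g :: "'a \<Rightarrow> real"
  assumes [measurable]: "E \<in> sets M" "g \<in> borel_measurable M" and "0 < t"
    and int: "(\<integral>\<^sup>+x. ennreal (g x) * indicator E x \<partial>M) \<le> ennreal C" and "C / t \<le> c"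
  shows "emeasure M {x \<in> space M. x \<in> E \<and> t < g x} \<le> ennreal c"
proof -
  let ?B = "{x \<in> space M. x \<in> E \<and> t < g x}"
  have "ennreal t * emeasure M ?B = (\<integral>\<^sup>+x. ennreal t * indicator ?B x \<partial>M)"
    by (subst nn_integral_cmult_indicator) auto
  also have "\<dots> \<le> (\<integral>\<^sup>+x. ennreal (g x) * indicator E x \<partial>M)"
    by (intro nn_integral_mono) (auto simp: indicator_def intro!: ennreal_leI)
  also note int
  finally have "ennreal (1 / t) * (ennreal t * emeasure M ?B) \<le> ennreal (1 / t) * ennreal C"
    by (intro mult_left_mono) auto
  then have "emeasure M ?B \<le> ennreal (C / t)"
    using assms(3) by (simp add: mult.assoc[symmetric] ennreal_mult'[symmetric])
  also have "\<dots> \<le> ennreal c" using assms(5) by (rule ennreal_leI)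
  finally show ?thesis .
qed

context entry_law begin

text \<open>From (\<zeta> - S) u = X N one gets <u, S u> = \<zeta> |u|^2 - <X N, u>. The last term
  is about tr G, hence at most d. But |u|^2 is about the squared Frobenius norm of G, which is at
  least (tr G - tr G') / h and so at least d / (10 sqrt h). Thus the loss relative to |u|^2 is at
  most 20 sqrt h.\<close>

lemma near_top_vector:
  fixes X :: "nat \<Rightarrow> nat \<Rightarrow> real"
  assumes h: "0 < h" "h \<le> 1" and d: "0 < d" "N \<le> d" "real d - real N \<le> h / 1000 * real d"
    and E: "gram_bounded d X {..<N} (4 + h / 1000)"
  defines "\<zeta> \<equiv> 4 + 2 * (h / 1000)"
  defines "G \<equiv> resolvent d (gram d X {..<N}) \<zeta>"
  defines "u \<equiv> mv d G (X N)"
  assumes e: "\<bar>sc_error d N \<zeta> X\<bar> \<le> h / 1000" "\<bar>sc_error d N (\<zeta> + h) X\<bar> \<le> h / 1000"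
    and f: "\<bar>ip d (X N) u - tr d G\<bar> \<le> real d / 20"
      "\<bar>ip d u u - (\<Sum>i<d. \<Sum>j<d. (G i j)\<^sup>2)\<bar> \<le> real d / 20"
  shows "real d \<le> 20 * sqrt h * ip d u u"
    and "(4 - 20 * sqrt h) * real d * ip d u u \<le> (\<Sum>a<N. (ip d (X a) u)\<^sup>2)"
proof -
  define D where "D = real d"
  have D: "0 < D" using d by (simp add: D_def)
  interpret sym_bounded d "gram d X {..<N}" "4 + h / 1000"
    by (rule gram_sym_bounded[OF E]) (use h d in auto)
  have b: "4 + h / 1000 < \<zeta>" "4 + h / 1000 < \<zeta> + h" "\<zeta> < \<zeta> + h" using h by (auto simp: \<zeta>_def)
  define G' where "G' = resolvent d (gram d X {..<N}) (\<zeta> + h)"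
  define \<tau> where "\<tau> = tr d G / D"
  define \<tau>' where "\<tau>' = tr d G' / D"
  have diag: "0 \<le> G' k k" if "k < d" for k
    using resolvent_form_nonneg[OF b(2), of "unit_vec k"] that
    by (simp add: ip_unit_vec mv_unit_vec G'_def)
  have t0: "0 \<le> \<tau>'" unfolding \<tau>'_def tr_def using diag D by (auto intro!: divide_nonneg_pos sum_nonneg)
  have tt: "\<tau>' \<le> \<tau>"
    unfolding \<tau>_def \<tau>'_def G_def G'_def using resolvent_trace_antimono[OF b(1,3)] D by (intro divide_right_mono) auto
  define \<kappa> where "\<kappa> = 1 - real N / D"
  have \<kappa>: "0 \<le> \<kappa>" "\<kappa> \<le> h / 1000"
    using d D unfolding \<kappa>_def D_def by (auto simp: field_simps)
  have N: "real N / D = 1 - \<kappa>" by (simp add: \<kappa>_def)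
  have S: "\<zeta> * \<tau> - 1 - \<tau> * (1 - \<kappa> + \<zeta> * \<tau> - 1) = sc_error d N \<zeta> X"
    "(\<zeta> + h) * \<tau>' - 1 - \<tau>' * (1 - \<kappa> + (\<zeta> + h) * \<tau>' - 1) = sc_error d N (\<zeta> + h) X"
    unfolding sc_error_def Let_def D_def[symmetric] N \<tau>_def \<tau>'_def G_def G'_def by simp_all
  note gap = stieltjes_gap[OF h e \<kappa> \<zeta>_def[THEN meta_eq_to_obj_eq] refl t0 tt S]
  define s where "s = sqrt h"
  have s: "0 < s" "s \<le> 1" "h = s\<^sup>2" using h by (auto simp: s_def)
  define F where "F = (\<Sum>i<d. \<Sum>j<d. (G i j)\<^sup>2)"
  have "D * (\<tau> - \<tau>') = tr d G - tr d G'"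
    using D by (simp add: \<tau>_def \<tau>'_def right_diff_distrib)
  also have "\<dots> \<le> h * F"
    using resolvent_trace_diff_le[OF b(1,3)] by (simp add: G_def G'_def F_def)
  finally have "D * (s / 10) \<le> h * F"
    using gap(2) D mult_left_mono[of "s / 10" "\<tau> - \<tau>'" D] unfolding s_def by linarith
  then have "s * (D / 10) \<le> s * (s * F)" by (simp add: s(3) power2_eq_square mult_ac)
  then have F: "D / 10 \<le> s * F" using s by simp
  have "F - D / 20 \<le> ip d u u" using f(2) unfolding F_def D_def by linarith
  then have "s * (F - D / 20) \<le> s * ip d u u" using s by (intro mult_left_mono) auto
  moreover have "s * (D / 20) \<le> 1 * (D / 20)" using s D by (intro mult_right_mono) auto
  ultimately have "D / 20 \<le> s * ip d u u" using F by (simp add: right_diff_distrib)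
  then show du: "real d \<le> 20 * sqrt h * ip d u u" by (simp add: D_def s_def)
  have "ip d (X N) u \<le> \<tau> * D + D / 20"
    using abs_le_D1[OF f(1)] D unfolding \<tau>_def D_def by simp
  also have "\<dots> \<le> 9 / 10 * D + D / 20"
    using D by (intro add_right_mono mult_right_mono[OF gap(1)]) simp
  also have "\<dots> \<le> D" using D by simp
  finally have ru: "ip d (X N) u \<le> D" .
  have "ip d u (mv d (gram d X {..<N}) u) = ip d u (\<lambda>i. \<zeta> * u i - X N i)"
  proof (rule ip_cong)
    fix i assume "i < d"
    from resolvent_apply[OF this b(1), of "X N"]
    show "mv d (gram d X {..<N}) u i = \<zeta> * u i - X N i" by (simp add: u_def G_def)
  qed simp
  also have "\<dots> = \<zeta> * ip d u u - ip d (X N) u"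
    unfolding ip_diff_right ip_scale_right by (simp add: ip_commute)
  also have "\<dots> \<ge> (4 - 20 * sqrt h) * ip d u u"
  proof -
    have "4 * ip d u u \<le> \<zeta> * ip d u u"
      unfolding \<zeta>_def using h ip_self_nonneg by (intro mult_right_mono) auto
    then show ?thesis using ru du unfolding D_def by (simp add: left_diff_distrib)
  qed
  finally have "(4 - 20 * sqrt h) * ip d u u \<le> (\<Sum>a<N. (ip d (X a) u)\<^sup>2) / real d"
    unfolding ip_gram by (simp add: power2_eq_square)
  then show "(4 - 20 * sqrt h) * real d * ip d u u \<le> (\<Sum>a<N. (ip d (X a) u)\<^sup>2)"
    using d by (simp add: pos_le_divide_eq mult_ac)
qed

text \<open>The failure of any input of \<open>near_top_vector\<close> or of the delocalization of
  \<open>u\<close>. Deviations are squared because only second moments are estimated.\<close>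

definition atypical :: "real \<Rightarrow> nat \<Rightarrow> nat \<Rightarrow> (nat \<Rightarrow> nat \<Rightarrow> real) \<Rightarrow> bool" where
  "atypical h d N X \<longleftrightarrow> (let \<zeta> = 4 + 2 * (h / 1000); G = resolvent d (gram d X {..<N}) \<zeta>; u = mv d G (X N) in
    h / 1000 < \<bar>sc_error d N \<zeta> X\<bar> \<or> h / 1000 < \<bar>sc_error d N (\<zeta> + h) X\<bar> \<or>
    (real d / 20)\<^sup>2 < (ip d (X N) u - tr d G)\<^sup>2 \<or>
    (real d / 20)\<^sup>2 < (ip d u u - (\<Sum>i<d. \<Sum>j<d. (G i j)\<^sup>2))\<^sup>2 \<or>
    10 * K / (h / 1000) ^ 4 * real d < (\<Sum>i<d. (u i) ^ 4))"

text \<open>Each of the five failures gets probability 1/10 by Markov's inequality on the event that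
  the Gram matrix is bounded. The first four become rare as \<open>d\<close> grows; the last is rare
  because its threshold is ten times the bound on the mean. The estimate is uniform in
  \<open>N\<close>, which will be chosen depending on \<open>d\<close>.\<close>

lemma atypical_small:
  assumes h: "0 < h"
  shows "\<forall>\<^sub>F d in sequentially. \<forall>N\<le>d.
    {X \<in> space (rowsM d {..<Suc N}). gram_bounded d X {..<N} (4 + h / 1000) \<and> atypical h d N X} \<in> sets (rowsM d {..<Suc N}) \<and>
    emeasure (rowsM d {..<Suc N}) {X \<in> space (rowsM d {..<Suc N}).
      gram_bounded d X {..<N} (4 + h / 1000) \<and> atypical h d N X} \<le> ennreal (1 / 2)"
proof -
  define \<epsilon> where "\<epsilon> = h / 1000"
  have \<epsilon>: "0 < \<epsilon>" using h by (simp add: \<epsilon>_def)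
  define \<zeta> where "\<zeta> = 4 + 2 * \<epsilon>"
  \<comment> \<open>\<epsilon> is the distance from \<zeta> to the bound on the Gram matrix, so
    \<open>c\<close> bounds the squared norm of the resolvent.\<close>
  define c where "c = 1 / \<epsilon>\<^sup>2"
  have c: "0 < c" using \<epsilon> by (simp add: c_def)
  have K0: "0 < K" using K_ge(1) by simp
  have lim1: "((\<lambda>d. C / sqrt (real d)) \<longlongrightarrow> 0) sequentially" for C
    by (intro tendsto_divide_0[OF tendsto_const] filterlim_at_top_imp_at_infinity
        filterlim_compose[OF sqrt_at_top filterlim_real_sequentially])
  have lim2: "((\<lambda>d. C / real d) \<longlongrightarrow> 0) sequentially" for C
    by (intro tendsto_divide_0[OF tendsto_const] filterlim_at_top_imp_at_infinity filterlim_real_sequentially)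
  have "\<forall>\<^sub>F d in sequentially. err_const \<epsilon> / \<epsilon> / sqrt (real d) < 1 / 10"
    by (rule order_tendstoD(2)[OF lim1]) simp
  moreover have "\<forall>\<^sub>F d in sequentially. err_const (\<epsilon> + h) / \<epsilon> / sqrt (real d) < 1 / 10"
    by (rule order_tendstoD(2)[OF lim1]) simp
  moreover have "\<forall>\<^sub>F d in sequentially. 400 * K * c / real d < 1 / 10"
    by (rule order_tendstoD(2)[OF lim2]) simp
  moreover have "\<forall>\<^sub>F d in sequentially. 400 * K * c\<^sup>2 / real d < 1 / 10"
    by (rule order_tendstoD(2)[OF lim2]) simp
  ultimately show ?thesis
    using eventually_gt_at_top[of 0]
  proof eventually_elim
    fix d :: nat
    assume ev: "err_const \<epsilon> / \<epsilon> / sqrt (real d) < 1 / 10" "err_const (\<epsilon> + h) / \<epsilon> / sqrt (real d) < 1 / 10"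
      "400 * K * c / real d < 1 / 10" "400 * K * c\<^sup>2 / real d < 1 / 10" and d: "0 < d"
    show "\<forall>N\<le>d. {X \<in> space (rowsM d {..<Suc N}). gram_bounded d X {..<N} (4 + h / 1000) \<and> atypical h d N X} \<in> sets (rowsM d {..<Suc N}) \<and>
      emeasure (rowsM d {..<Suc N}) {X \<in> space (rowsM d {..<Suc N}).
      gram_bounded d X {..<N} (4 + h / 1000) \<and> atypical h d N X} \<le> ennreal (1 / 2)"
    proof (intro allI impI)
      fix N assume N: "N \<le> d"
      let ?R = "rowsM d {..<Suc N}"
      let ?b = "4 + \<epsilon>"
      define E where "E = {X \<in> space ?R. gram_bounded d X {..<N} ?b}"
      have E: "E \<in> sets ?R" unfolding E_def by (rule sets_gram_bounded) auto
      define G where "G X = resolvent d (gram d X {..<N}) \<zeta>" for X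
      define u where "u X = mv d (G X) (X N)" for X
      have z: "0 < ?b" "?b < \<zeta>" "?b < \<zeta> + h" using \<epsilon> h by (auto simp: \<zeta>_def)
      have zb: "1 / (\<zeta> - ?b)\<^sup>2 = c" by (simp add: \<zeta>_def c_def)
      have ind: "(\<integral>\<^sup>+X. f X * indicator E X \<partial>?R) = (\<integral>\<^sup>+X. f X * indicator {X. gram_bounded d X {..<N} ?b} X \<partial>?R)" for f
        by (intro nn_integral_cong) (auto simp: indicator_def E_def)
      have mtr: "(\<lambda>X. tr d (resolvent d (gram d X {..<N}) z)) \<in> borel_measurable ?R" for z
        by (rule measurable_form) auto
      have m1: "(\<lambda>X. \<bar>sc_error d N z X\<bar>) \<in> borel_measurable ?R" for z
        unfolding sc_error_def Let_def using mtr[of z] by measurable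
      have mu: "(\<lambda>X. u X i) \<in> borel_measurable ?R" if "i < d" for i
        unfolding u_def G_def using that by (intro measurable_form) auto
      have mG: "(\<lambda>X. G X i j) \<in> borel_measurable ?R" if "i < d" "j < d" for i j
        unfolding G_def using that by (intro measurable_resolvent) auto
      have m3: "(\<lambda>X. (ip d (X N) (u X) - tr d (G X))\<^sup>2) \<in> borel_measurable ?R"
        unfolding u_def G_def
        by (intro borel_measurable_power borel_measurable_diff measurable_form) auto
      have m4: "(\<lambda>X. (ip d (u X) (u X) - (\<Sum>i<d. \<Sum>j<d. (G X i j)\<^sup>2))\<^sup>2) \<in> borel_measurable ?R"
        unfolding ip_def
        by (intro borel_measurable_power borel_measurable_diff borel_measurable_sum borel_measurable_times mu mG) auto
      have m5: "(\<lambda>X. \<Sum>i<d. (u X i) ^ 4) \<in> borel_measurable ?R"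
        by (intro borel_measurable_sum borel_measurable_power mu) auto
      define B1 where "B1 = {X \<in> space ?R. X \<in> E \<and> \<epsilon> < \<bar>sc_error d N \<zeta> X\<bar>}"
      define B2 where "B2 = {X \<in> space ?R. X \<in> E \<and> \<epsilon> < \<bar>sc_error d N (\<zeta> + h) X\<bar>}"
      define B3 where "B3 = {X \<in> space ?R. X \<in> E \<and> (real d / 20)\<^sup>2 < (ip d (X N) (u X) - tr d (G X))\<^sup>2}"
      define B4 where "B4 = {X \<in> space ?R. X \<in> E \<and> (real d / 20)\<^sup>2 < (ip d (u X) (u X) - (\<Sum>i<d. \<Sum>j<d. (G X i j)\<^sup>2))\<^sup>2}"
      define B5 where "B5 = {X \<in> space ?R. X \<in> E \<and> 10 * K * c\<^sup>2 * real d < (\<Sum>i<d. (u X i) ^ 4)}"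
      have sets: "B1 \<in> sets ?R" "B2 \<in> sets ?R" "B3 \<in> sets ?R" "B4 \<in> sets ?R" "B5 \<in> sets ?R"
        unfolding B1_def B2_def B3_def B4_def B5_def using E m1 m3 m4 m5 by measurable
      have "emeasure ?R B1 \<le> ennreal (1 / 10)"
        unfolding B1_def
      proof (rule emeasure_Markov[OF E m1 \<epsilon>])
        show "(\<integral>\<^sup>+X. ennreal \<bar>sc_error d N \<zeta> X\<bar> * indicator E X \<partial>?R) \<le> ennreal (err_const (\<zeta> - ?b) / sqrt (real d))"
          unfolding ind using z d N by (intro nn_integral_sc_error_le) auto
        show "err_const (\<zeta> - ?b) / sqrt (real d) / \<epsilon> \<le> 1 / 10"
          using ev(1) by (simp add: \<zeta>_def mult.commute)
      qed
      moreover have "emeasure ?R B2 \<le> ennreal (1 / 10)"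
        unfolding B2_def
      proof (rule emeasure_Markov[OF E m1 \<epsilon>])
        show "(\<integral>\<^sup>+X. ennreal \<bar>sc_error d N (\<zeta> + h) X\<bar> * indicator E X \<partial>?R) \<le> ennreal (err_const (\<zeta> + h - ?b) / sqrt (real d))"
          unfolding ind using z d N by (intro nn_integral_sc_error_le) auto
        have eq: "\<zeta> + h - ?b = \<epsilon> + h" by (simp add: \<zeta>_def)
        show "err_const (\<zeta> + h - ?b) / sqrt (real d) / \<epsilon> \<le> 1 / 10"
          unfolding eq using ev(2) by (simp add: mult.commute)
      qed
      moreover have "emeasure ?R B3 \<le> ennreal (1 / 10)"
        unfolding B3_def
      proof (rule emeasure_Markov[OF E m3])
        show "(\<integral>\<^sup>+X. ennreal ((ip d (X N) (u X) - tr d (G X))\<^sup>2) * indicator E X \<partial>?R) \<le> ennreal (K * c * real d)"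
          unfolding ind u_def G_def
        proof (rule leave_out_integral[where f = "\<lambda>G r. ennreal ((ip d r (mv d G r) - tr d G)\<^sup>2)", OF _ _ _ z(1,2) d])
          show "(\<lambda>X. ennreal ((ip d (X N) (mv d (resolvent d (gram d X {..<N}) \<zeta>) (X N))
             - tr d (resolvent d (gram d X {..<N}) \<zeta>))\<^sup>2)) \<in> borel_measurable ?R"
            using m3 unfolding u_def G_def by measurable
          show "(\<integral>\<^sup>+r. ennreal ((ip d r (mv d G r) - tr d G)\<^sup>2) \<partial>rowM d) \<le> ennreal (K * c * real d)"
            if "\<And>i j. i < d \<Longrightarrow> j < d \<Longrightarrow> G i j = G j i"
              "\<And>x. ip d (mv d G x) (mv d G x) \<le> 1 / (\<zeta> - ?b)\<^sup>2 * ip d x x" for G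
            using that unfolding zb by (rule nn_integral_form_le)
        qed auto
        show "0 < (real d / 20)\<^sup>2" using d by simp
        show "K * c * real d / (real d / 20)\<^sup>2 \<le> 1 / 10"
          using ev(3) d by (simp add: power2_eq_square field_simps)
      qed
      moreover have "emeasure ?R B4 \<le> ennreal (1 / 10)"
        unfolding B4_def
      proof (rule emeasure_Markov[OF E m4])
        show "(\<integral>\<^sup>+X. ennreal ((ip d (u X) (u X) - (\<Sum>i<d. \<Sum>j<d. (G X i j)\<^sup>2))\<^sup>2) * indicator E X \<partial>?R)
            \<le> ennreal (K * (c * (c * real d)))"
          unfolding ind u_def G_def
        proof (rule leave_out_integral[where f = "\<lambda>G r. ennreal ((ip d (mv d G r) (mv d G r) - (\<Sum>i<d. \<Sum>j<d. (G i j)\<^sup>2))\<^sup>2)",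
              OF _ _ _ z(1,2) d])
          show "(\<lambda>X. ennreal ((ip d (mv d (resolvent d (gram d X {..<N}) \<zeta>) (X N)) (mv d (resolvent d (gram d X {..<N}) \<zeta>) (X N))
             - (\<Sum>i<d. \<Sum>j<d. (resolvent d (gram d X {..<N}) \<zeta> i j)\<^sup>2))\<^sup>2)) \<in> borel_measurable ?R"
            using m4 unfolding u_def G_def by measurable
          show "(\<integral>\<^sup>+r. ennreal ((ip d (mv d G r) (mv d G r) - (\<Sum>i<d. \<Sum>j<d. (G i j)\<^sup>2))\<^sup>2) \<partial>rowM d) \<le> ennreal (K * (c * (c * real d)))"
            if "\<And>i j. i < d \<Longrightarrow> j < d \<Longrightarrow> G i j = G j i"
              "\<And>x. ip d (mv d G x) (mv d G x) \<le> 1 / (\<zeta> - ?b)\<^sup>2 * ip d x x" for G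
            using that unfolding zb by (rule nn_integral_square_form_le)
        qed auto
        show "0 < (real d / 20)\<^sup>2" using d by simp
        show "K * (c * (c * real d)) / (real d / 20)\<^sup>2 \<le> 1 / 10"
          using ev(4) d by (simp add: power2_eq_square field_simps)
      qed
      moreover have "emeasure ?R B5 \<le> ennreal (1 / 10)"
        unfolding B5_def
      proof (rule emeasure_Markov[OF E m5])
        show "(\<integral>\<^sup>+X. ennreal (\<Sum>i<d. (u X i) ^ 4) * indicator E X \<partial>?R) \<le> ennreal (K * c\<^sup>2 * real d)"
          unfolding ind u_def G_def
        proof (rule leave_out_integral[where f = "\<lambda>G r. ennreal (\<Sum>i<d. (mv d G r i) ^ 4)", OF _ _ _ z(1,2) d])
          show "(\<lambda>X. ennreal (\<Sum>i<d. (mv d (resolvent d (gram d X {..<N}) \<zeta>) (X N) i) ^ 4)) \<in> borel_measurable ?R"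
            using m5 unfolding u_def G_def by measurable
          show "(\<integral>\<^sup>+r. ennreal (\<Sum>i<d. (mv d G r i) ^ 4) \<partial>rowM d) \<le> ennreal (K * c\<^sup>2 * real d)"
            if "\<And>i j. i < d \<Longrightarrow> j < d \<Longrightarrow> G i j = G j i"
              "\<And>x. ip d (mv d G x) (mv d G x) \<le> 1 / (\<zeta> - ?b)\<^sup>2 * ip d x x" for G
            using that unfolding zb by (rule nn_integral_quartic_sum_le)
        qed auto
        show "0 < 10 * K * c\<^sup>2 * real d" using d K0 c by simp
        show "K * c\<^sup>2 * real d / (10 * K * c\<^sup>2 * real d) \<le> 1 / 10" using d K0 c by simp
      qed
      ultimately have "emeasure ?R B1 + emeasure ?R B2 + emeasure ?R B3 + emeasure ?R B4 + emeasure ?R B5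
          \<le> ennreal (1 / 10) + ennreal (1 / 10) + ennreal (1 / 10) + ennreal (1 / 10) + ennreal (1 / 10)"
        by (intro add_mono)
      also have "\<dots> = ennreal (1 / 2)" by (subst ennreal_plus[symmetric]; simp)+
      finally have sum: "emeasure ?R B1 + emeasure ?R B2 + emeasure ?R B3 + emeasure ?R B4 + emeasure ?R B5 \<le> ennreal (1 / 2)" .
      have "10 * K / \<epsilon> ^ 4 = 10 * K * c\<^sup>2"
        by (simp add: c_def power_divide power_mult[symmetric])
      then have eq: "{X \<in> space ?R. gram_bounded d X {..<N} (4 + h / 1000) \<and> atypical h d N X} = B1 \<union> B2 \<union> B3 \<union> B4 \<union> B5"
        unfolding atypical_def Let_def \<epsilon>_def[symmetric] \<zeta>_def[symmetric] B1_def B2_def B3_def B4_def B5_def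
          u_def G_def E_def by auto
      have "emeasure ?R (B1 \<union> B2 \<union> B3 \<union> B4 \<union> B5)
          \<le> emeasure ?R B1 + emeasure ?R B2 + emeasure ?R B3 + emeasure ?R B4 + emeasure ?R B5"
        using sets by (intro order_trans[OF emeasure_subadditive] add_mono order_refl) auto
      with sum show "{X \<in> space ?R. gram_bounded d X {..<N} (4 + h / 1000) \<and> atypical h d N X} \<in> sets ?R \<and>
        emeasure ?R {X \<in> space ?R. gram_bounded d X {..<N} (4 + h / 1000) \<and> atypical h d N X} \<le> ennreal (1 / 2)"
        unfolding eq using sets by (auto intro: order_trans)
    qed
  qed
qed

end


section \<open>Large norm of an iid block\<close>

context entry_law begin

text \<open>The first rows \<open>X\<close> are fixed. Either they already violate the bound, and
  every completion works; or they are typical, and then \<open>u\<close> is determined by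
  \<open>X\<close>, so the remaining rows are independent of it and each has a large product with
  \<open>u\<close> with probability at least \<open>pl ^ Suc k\<close>. Their joint contribution
  exceeds the deficit of order sqrt h by \<open>boost\<close>.\<close>

lemma boosted_rows:
  fixes X :: "nat \<Rightarrow> nat \<Rightarrow> real"
  assumes h: "0 < h" "h \<le> 1" and k: "0 < k" and N: "N < d" "real d - real N \<le> h / 1000 * real d"
    and boost: "(20 * sqrt h + h / 1000) * real d < real (d - Suc N) * (cl\<^sup>2 * real k / 2)"
    and big: "1600 * (real k)\<^sup>2 * (10 * K / (h / 1000) ^ 4) \<le> real d"
    and X: "X \<in> space (rowsM d {..<Suc N})"
      "\<not> (gram_bounded d X {..<N} (4 + h / 1000) \<and> atypical h d N X)"
  shows "ennreal ((pl ^ Suc k) ^ (d - Suc N)) \<le> (\<integral>\<^sup>+Y. indicator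
    {Z \<in> space (rowsM d {..<d}). \<not> gram_bounded d Z {..<d} (4 + h / 1000)}
    (merge {..<Suc N} {Suc N..<d} (X, Y)) \<partial>rowsM d {Suc N..<d})"
proof -
  let ?A = "{Suc N..<d}"
  interpret product_sigma_finite "\<lambda>_. rowM d" by (rule product_sigma_finite_rows)
  interpret PA: prob_space "rowsM d ?A" by (rule prob_space_rows)
  let ?F = "{Z \<in> space (rowsM d {..<d}). \<not> gram_bounded d Z {..<d} (4 + h / 1000)}"
  have un: "{..<Suc N} \<union> ?A = {..<d}" using N by auto
  have sp: "merge {..<Suc N} ?A (X, Y) \<in> space (rowsM d {..<d})" if "Y \<in> space (rowsM d ?A)" for Y
    using that X(1) un by (auto simp: space_PiM PiE_iff extensional_def merge_def split: if_splits)
  have mergeX: "merge {..<Suc N} ?A (X, Y) a = X a" if "a < Suc N" for Y a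
    using that by (simp add: merge_def)
  have mergeY: "merge {..<Suc N} ?A (X, Y) a = Y a" if "a \<in> ?A" for Y a
    using that by (simp add: merge_def)
  show ?thesis
  proof (cases "gram_bounded d X {..<N} (4 + h / 1000)")
    case False
    have "merge {..<Suc N} ?A (X, Y) \<in> ?F" if "Y \<in> space (rowsM d ?A)" for Y
    proof -
      let ?Z = "merge {..<Suc N} ?A (X, Y)"
      have "gram_bounded d ?Z {..<N} (4 + h / 1000) = gram_bounded d X {..<N} (4 + h / 1000)"
        by (intro gram_bounded_cong) (simp add: mergeX)
      then have "\<not> gram_bounded d ?Z {..<d} (4 + h / 1000)"
        using False gram_bounded_mono[of d ?Z "{..<d}" _ "{..<N}"] N by auto
      then show ?thesis using sp[OF that] by simp
    qed
    then have "(\<integral>\<^sup>+Y. indicator ?F (merge {..<Suc N} ?A (X, Y)) \<partial>rowsM d ?A) = (\<integral>\<^sup>+Y. 1 \<partial>rowsM d ?A)"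
      by (intro nn_integral_cong) simp
    also have "\<dots> = 1" by (simp add: PA.emeasure_space_1)
    finally show ?thesis using pl_pos pl_le by (simp add: power_le_one mult_le_one)
  next
    case True
    define \<zeta> where "\<zeta> = 4 + 2 * (h / 1000)"
    define G where "G = resolvent d (gram d X {..<N}) \<zeta>"
    define u where "u = mv d G (X N)"
    have tv: "\<bar>sc_error d N \<zeta> X\<bar> \<le> h / 1000" "\<bar>sc_error d N (\<zeta> + h) X\<bar> \<le> h / 1000"
      "(ip d (X N) u - tr d G)\<^sup>2 \<le> (real d / 20)\<^sup>2"
      "(ip d u u - (\<Sum>i<d. \<Sum>j<d. (G i j)\<^sup>2))\<^sup>2 \<le> (real d / 20)\<^sup>2"
      "(\<Sum>i<d. (u i) ^ 4) \<le> 10 * K / (h / 1000) ^ 4 * real d"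
      using X(2) True unfolding atypical_def Let_def u_def G_def \<zeta>_def by auto
    have d: "0 < d" using N by simp
    have f: "\<bar>ip d (X N) u - tr d G\<bar> \<le> real d / 20" "\<bar>ip d u u - (\<Sum>i<d. \<Sum>j<d. (G i j)\<^sup>2)\<bar> \<le> real d / 20"
      using tv(3,4) abs_le_square_iff[of _ "real d / 20"] by simp_all
    note top = near_top_vector[OF h d less_imp_le[OF N(1)] N(2) True, folded \<zeta>_def, folded G_def, folded u_def,
        OF tv(1,2) f]
    have s: "sqrt h \<le> 1" "0 \<le> sqrt h" using h by auto
    have "20 * sqrt h * ip d u u \<le> 20 * 1 * ip d u u"
      using s ip_self_nonneg[of d u] by (intro mult_right_mono mult_left_mono) auto
    with top(1) have u20: "real d / 20 \<le> ip d u u" by simp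
    moreover have "0 < real d / 20" using d by simp
    ultimately have u0: "0 < ip d u u" by linarith
    have deloc: "(u i)\<^sup>2 \<le> ip d u u / (2 * real k)" if i: "i < d" for i
    proof -
      \<comment> \<open>The constant 1600 = 40^2 in \<open>big\<close> makes this chain end at d /
        (40 k) = (d / 20) / (2 k), where d / 20 is the lower bound for |u|^2.\<close>
      have "((u i)\<^sup>2)\<^sup>2 \<le> (\<Sum>i<d. (u i) ^ 4)"
        using i member_le_sum[of i "{..<d}" "\<lambda>i. (u i) ^ 4"] by (simp add: power_mult[symmetric])
      also have "\<dots> \<le> 10 * K / (h / 1000) ^ 4 * real d" by (rule tv(5))
      also have "\<dots> \<le> real d / (1600 * (real k)\<^sup>2) * real d"
        using big k by (intro mult_right_mono) (auto simp: pos_le_divide_eq mult_ac)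
      also have "\<dots> = (real d / (40 * real k))\<^sup>2"
        by (simp add: power2_eq_square)
      finally have "(u i)\<^sup>2 \<le> real d / (40 * real k)"
        by (rule power2_le_imp_le) (use k in auto)
      also have "\<dots> = real d / 20 / (2 * real k)" by simp
      also have "\<dots> \<le> ip d u u / (2 * real k)" using u20 by (intro divide_right_mono) auto
      finally show ?thesis .
    qed
    let ?g = "{r \<in> space (rowM d). cl\<^sup>2 * real k / 2 * ip d u u \<le> (ip d r u)\<^sup>2}"
    have g: "?g \<in> sets (rowM d)" unfolding ip_def by measurable
    have p: "ennreal (pl ^ Suc k) \<le> emeasure (rowM d) ?g"
      using k u0 deloc by (rule delocalized_form_tail)
    have "ennreal ((pl ^ Suc k) ^ (d - Suc N)) = (\<Prod>a\<in>?A. ennreal (pl ^ Suc k))"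
      using pl_pos by (simp add: ennreal_power)
    also have "\<dots> \<le> (\<Prod>a\<in>?A. emeasure (rowM d) ?g)"
      by (rule prod_mono_ennreal) (use p in simp)
    also have "\<dots> = emeasure (rowsM d ?A) (PiE ?A (\<lambda>_. ?g))"
      using g by (intro emeasure_PiM[symmetric]) auto
    also have "\<dots> = (\<integral>\<^sup>+Y. indicator (PiE ?A (\<lambda>_. ?g)) Y \<partial>rowsM d ?A)"
      using g by (intro nn_integral_indicator[symmetric] sets_PiM_I_finite) auto
    also have "\<dots> \<le> (\<integral>\<^sup>+Y. indicator ?F (merge {..<Suc N} ?A (X, Y)) \<partial>rowsM d ?A)"
    proof (rule nn_integral_mono)
      fix Y assume Y: "Y \<in> space (rowsM d ?A)"
      let ?Z = "merge {..<Suc N} ?A (X, Y)"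
      have "?Z \<in> ?F" if "Y \<in> PiE ?A (\<lambda>_. ?g)"
      proof -
        have "(4 + h / 1000) * real d * ip d u u < (\<Sum>a<d. (ip d (?Z a) u)\<^sup>2)"
        proof -
          have "(20 * sqrt h + h / 1000) * real d * ip d u u < real (d - Suc N) * (cl\<^sup>2 * real k / 2) * ip d u u"
            using boost u0 by (rule mult_strict_right_mono)
          also have "\<dots> = (\<Sum>a\<in>?A. cl\<^sup>2 * real k / 2 * ip d u u)" by (simp add: mult_ac)
          also have "\<dots> \<le> (\<Sum>a\<in>?A. (ip d (Y a) u)\<^sup>2)"
            using that by (intro sum_mono) (auto simp: PiE_iff)
          finally have "(20 * sqrt h + h / 1000) * real d * ip d u u < (\<Sum>a\<in>?A. (ip d (Y a) u)\<^sup>2)" .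
          with top(2) have "(4 + h / 1000) * real d * ip d u u < (\<Sum>a<N. (ip d (X a) u)\<^sup>2) + (\<Sum>a\<in>?A. (ip d (Y a) u)\<^sup>2)"
            by (simp add: algebra_simps)
          \<comment> \<open>Row \<open>N\<close> defines \<open>u\<close> and is not independent of
            it; its contribution is merely nonnegative.\<close>
          also have "\<dots> \<le> (\<Sum>a<Suc N. (ip d (X a) u)\<^sup>2) + (\<Sum>a\<in>?A. (ip d (Y a) u)\<^sup>2)" by simp
          also have "\<dots> = (\<Sum>a<Suc N. (ip d (?Z a) u)\<^sup>2) + (\<Sum>a\<in>?A. (ip d (?Z a) u)\<^sup>2)"
            by (intro arg_cong2[where f = "(+)"] sum.cong) (simp_all only: mergeX mergeY lessThan_iff)
          also have "\<dots> = (\<Sum>a<d. (ip d (?Z a) u)\<^sup>2)"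
            unfolding un[symmetric] by (intro sum.union_disjoint[symmetric]) auto
          finally show ?thesis .
        qed
        then have "\<not> gram_bounded d ?Z {..<d} (4 + h / 1000)"
          unfolding gram_bounded_def by (auto simp: not_le)
        then show ?thesis using sp[OF Y] by simp
      qed
      then show "indicator (PiE ?A (\<lambda>_. ?g)) Y \<le> (indicator ?F ?Z :: ennreal)"
        by (auto simp: indicator_def)
    qed
    finally show ?thesis .
  qed
qed

text \<open>Fubini: first rows that are not bad have probability at least 1/2, and given any such
  rows the remaining ones succeed with the probability from \<open>boosted_rows\<close>.\<close>

lemma block_norm_large_aux:
  assumes h: "0 < h" "h \<le> 1" and k: "0 < k" and N: "N < d" "real d - real N \<le> h / 1000 * real d"
    and boost: "(20 * sqrt h + h / 1000) * real d < real (d - Suc N) * (cl\<^sup>2 * real k / 2)"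
    and big: "1600 * (real k)\<^sup>2 * (10 * K / (h / 1000) ^ 4) \<le> real d"
    and bad: "{X \<in> space (rowsM d {..<Suc N}). gram_bounded d X {..<N} (4 + h / 1000) \<and> atypical h d N X}
        \<in> sets (rowsM d {..<Suc N})"
      "emeasure (rowsM d {..<Suc N}) {X \<in> space (rowsM d {..<Suc N}).
        gram_bounded d X {..<N} (4 + h / 1000) \<and> atypical h d N X} \<le> ennreal (1 / 2)"
  shows "1 / 2 * (pl ^ Suc k) ^ (d - Suc N)
    \<le> measure (rowsM d {..<d}) {X \<in> space (rowsM d {..<d}). \<not> gram_bounded d X {..<d} (4 + h / 1000)}"
proof -
  let ?A = "{Suc N..<d}" and ?R = "rowsM d {..<Suc N}"
  interpret product_sigma_finite "\<lambda>_. rowM d" by (rule product_sigma_finite_rows)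
  interpret P: prob_space "rowsM d {..<d}" by (rule prob_space_rows)
  interpret R: prob_space ?R by (rule prob_space_rows)
  let ?F = "{Z \<in> space (rowsM d {..<d}). \<not> gram_bounded d Z {..<d} (4 + h / 1000)}"
  let ?B = "{X \<in> space ?R. gram_bounded d X {..<N} (4 + h / 1000) \<and> atypical h d N X}"
  let ?p = "(pl ^ Suc k) ^ (d - Suc N)"
  have un: "{..<Suc N} \<union> ?A = {..<d}" using N by auto
  have F: "?F \<in> sets (rowsM d {..<d})"
    by (intro sets.sets_Collect_neg sets_gram_bounded) auto
  have "measure ?R ?B \<le> 1 / 2"
    using bad(2) unfolding R.emeasure_eq_measure by (subst (asm) ennreal_le_iff) auto
  then have "1 / 2 \<le> measure ?R (space ?R - ?B)"
    using R.prob_compl[OF bad(1)] by simp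
  then have half: "ennreal (1 / 2) \<le> emeasure ?R (space ?R - ?B)"
    unfolding R.emeasure_eq_measure by (rule ennreal_leI)
  have "ennreal (1 / 2 * ?p) = ennreal (1 / 2) * ennreal ?p"
    using pl_pos by (intro ennreal_mult) auto
  also have "\<dots> \<le> emeasure ?R (space ?R - ?B) * ennreal ?p"
    by (intro mult_right_mono half) auto
  also have "\<dots> = (\<integral>\<^sup>+X. ennreal ?p * indicator (space ?R - ?B) X \<partial>?R)"
    using bad(1) by (subst nn_integral_cmult_indicator) (auto simp: mult.commute)
  also have "\<dots> \<le> (\<integral>\<^sup>+X. (\<integral>\<^sup>+Y. indicator ?F (merge {..<Suc N} ?A (X, Y)) \<partial>rowsM d ?A) \<partial>?R)"
  proof (rule nn_integral_mono)
    fix X assume "X \<in> space ?R"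
    then show "ennreal ?p * indicator (space ?R - ?B) X \<le> (\<integral>\<^sup>+Y. indicator ?F (merge {..<Suc N} ?A (X, Y)) \<partial>rowsM d ?A)"
      using boosted_rows[OF h k N boost big, of X] by (auto simp: indicator_def)
  qed
  also have "\<dots> = (\<integral>\<^sup>+X. indicator ?F X \<partial>rowsM d ({..<Suc N} \<union> ?A))"
    by (rule product_nn_integral_fold[symmetric]) (use F in \<open>auto simp: un\<close>)
  also have "\<dots> = emeasure (rowsM d {..<d}) ?F"
    unfolding un using F by simp
  finally show ?thesis
    using pl_pos by (simp add: P.emeasure_eq_measure)
qed

proposition block_norm_large:
  assumes "0 < c"
  shows "\<exists>\<epsilon>>0. \<forall>\<^sub>F d in sequentially. exp (- c * real d)
    \<le> measure (rowsM d {..<d}) {X \<in> space (rowsM d {..<d}). \<not> gram_bounded d X {..<d} (4 + \<epsilon>)}"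
proof -
  \<comment> \<open>168000 = 21 * 8000: the deficit is at most 21 sqrt h, and the gain from the
    held-back rows is at least D cl^2 / 8000 times sqrt h. The additional 1 makes the comparison
    strict.\<close>
  define D where "D = 168001 / cl\<^sup>2"
  have D: "0 < D" using cl_pos by (simp add: D_def)
  define L where "L = - ln pl"
  have L: "0 \<le> L" using pl_pos pl_le by (simp add: L_def)
  \<comment> \<open>\<open>k\<close> is large enough for h to be at most 1 and for the cost, of
    order L D^2 / k per dimension, to stay below the rate \<open>c\<close>.\<close>
  obtain k :: nat where k0: "D + L * D\<^sup>2 / c + 1 < real k" using reals_Archimedean2 by blast
  have "0 \<le> L * D\<^sup>2 / c" using L assms by simp
  then have kD: "D \<le> real k" "L * D\<^sup>2 / c \<le> real k" "1 < real k" using k0 D by auto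
  then have k: "0 < k" by (intro Suc_leI gr0I) auto
  \<comment> \<open>This choice gives h k = D sqrt h, so the gain of order h k dominates the deficit
    of order sqrt h, while h k = D^2 / k still tends to 0 for large k.\<close>
  define h where "h = (D / real k)\<^sup>2"
  have sh: "sqrt h = D / real k" using D k by (simp add: h_def)
  have h: "0 < h" "h \<le> 1"
    using D k kD by (auto simp: h_def power_le_one)
  have s1: "sqrt h \<le> 1" "0 < sqrt h" using h by auto
  let ?C = "1600 * (real k)\<^sup>2 * (10 * K / (h / 1000) ^ 4)"
  have ev: "\<forall>\<^sub>F d in sequentially. C \<le> real d" for C
    using eventually_ge_at_top[of "nat \<lceil>C\<rceil>"] by eventually_elim linarith
  have "\<forall>\<^sub>F d in sequentially. exp (- c * real d)
    \<le> measure (rowsM d {..<d}) {X \<in> space (rowsM d {..<d}). \<not> gram_bounded d X {..<d} (4 + h / 1000)}"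
    using atypical_small[OF h(1)] ev[of ?C] ev[of "4000 / h"] ev[of "2 * ln 2 / c"]
  proof eventually_elim
    fix d
    assume A: "\<forall>N\<le>d. {X \<in> space (rowsM d {..<Suc N}). gram_bounded d X {..<N} (4 + h / 1000) \<and> atypical h d N X} \<in> sets (rowsM d {..<Suc N}) \<and>
      emeasure (rowsM d {..<Suc N}) {X \<in> space (rowsM d {..<Suc N}).
      gram_bounded d X {..<N} (4 + h / 1000) \<and> atypical h d N X} \<le> ennreal (1 / 2)"
      and big: "?C \<le> real d" and d4: "4000 / h \<le> real d" and d2: "2 * ln 2 / c \<le> real d"
    \<comment> \<open>\<open>m\<close> rows are held back. As h d is at least 4000, rounding down
      loses at most half, and \<open>m + 1\<close> stays within the permitted proportion h /
      1000.\<close>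
    define m where "m = nat \<lfloor>h * real d / 2000\<rfloor>"
    have hd: "4000 \<le> h * real d" using d4 h by (simp add: pos_divide_le_eq mult.commute)
    have m: "real m \<le> h * real d / 2000" "h * real d / 4000 \<le> real m"
      using hd unfolding m_def by linarith+
    have "h * real d \<le> 1 * real d" using h by (intro mult_right_mono) auto
    then have md: "m + 1 \<le> d" using m hd by linarith
    \<comment> \<open>One further row is set aside as the fresh row \<open>N\<close>, so that
      exactly \<open>m\<close> rows come after it.\<close>
    define N where "N = d - Suc m"
    have N: "N < d" "d - Suc N = m" "real N = real d - real m - 1" using md by (auto simp: N_def)
    have "1 / 2 * (pl ^ Suc k) ^ (d - Suc N)
      \<le> measure (rowsM d {..<d}) {X \<in> space (rowsM d {..<d}). \<not> gram_bounded d X {..<d} (4 + h / 1000)}"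
    proof (rule block_norm_large_aux[OF h k N(1) _ _ big])
      show "real d - real N \<le> h / 1000 * real d" unfolding N(3) using m hd by simp
      have "h / 1000 \<le> sqrt h"
      proof -
        have "h = sqrt h * sqrt h" using h by simp
        also have "\<dots> \<le> sqrt h * 1" using s1 by (intro mult_left_mono) auto
        finally show ?thesis using h by simp
      qed
      then have "(20 * sqrt h + h / 1000) * real d \<le> (21 * sqrt h) * real d" by (intro mult_right_mono) auto
      also have "\<dots> < 168001 / 8000 * sqrt h * real d" using s1 md by simp
      also have "\<dots> = h * real d / 4000 * (cl\<^sup>2 * real k / 2)"
      proof -
        have "h = sqrt h * sqrt h" using h by simp
        also have "\<dots> = sqrt h * (D / real k)" by (simp only: sh)
        finally have "h = sqrt h * (D / real k)" .
        then have "h * real d / 4000 * (cl\<^sup>2 * real k / 2) = sqrt h * (D / real k) * real d / 4000 * (cl\<^sup>2 * real k / 2)"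
          by simp
        also have "\<dots> = sqrt h * real d / 8000 * (D * cl\<^sup>2)" using k by simp
        also have "D * cl\<^sup>2 = 168001" using cl_pos by (simp add: D_def)
        finally show ?thesis by (simp add: mult.commute) metis
      qed
      also have "\<dots> \<le> real m * (cl\<^sup>2 * real k / 2)" using m(2) by (intro mult_right_mono) auto
      finally show "(20 * sqrt h + h / 1000) * real d < real (d - Suc N) * (cl\<^sup>2 * real k / 2)"
        unfolding N(2) .
    qed (use A N(1) in auto)
    moreover have "exp (- c * real d) \<le> 1 / 2 * (pl ^ Suc k) ^ (d - Suc N)"
    proof -
      have "(pl ^ Suc k) ^ m = pl ^ (Suc k * m)" by (simp only: power_mult)
      also have "\<dots> = exp (ln pl) ^ (Suc k * m)" using pl_pos by simp
      also have "\<dots> = exp (- (real (Suc k * m) * L))"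
        unfolding exp_of_nat_mult[symmetric] by (simp add: L_def)
      finally have e: "(pl ^ Suc k) ^ m = exp (- (real (Suc k * m) * L))" .
      have "real (Suc k * m) * L \<le> (2 * real k * (h * real d / 2000)) * L"
        unfolding of_nat_mult using m(1) k L by (intro mult_right_mono mult_mono) auto
      also have "\<dots> = (real k * h * L / 1000) * real d" by simp
      also have "\<dots> \<le> c / 2 * real d"
      proof (rule mult_right_mono)
        have "real k * h = D\<^sup>2 / real k" using k by (simp add: h_def power2_eq_square)
        moreover have "L * D\<^sup>2 / real k \<le> c"
          using kD(2) k assms by (simp add: pos_divide_le_eq mult.commute)
        ultimately have "real k * h * L \<le> c" by (simp add: mult.commute)
        then show "real k * h * L / 1000 \<le> c / 2" using assms by linarith
      qed simp
      finally have 1: "exp (- (c / 2 * real d)) \<le> (pl ^ Suc k) ^ m" unfolding e by simp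
      have "exp (- (c / 2 * real d)) \<le> exp (- ln 2)"
        using d2 assms by (simp add: pos_divide_le_eq mult.commute)
      then have 2: "exp (- (c / 2 * real d)) \<le> 1 / 2" by (simp add: exp_minus inverse_eq_divide)
      \<comment> \<open>Half of the rate pays for the held-back rows, the other half for the factor
        1/2.\<close>
      have "exp (- c * real d) = exp (- (c / 2 * real d)) * exp (- (c / 2 * real d))"
        by (simp add: exp_add[symmetric])
      also have "\<dots> \<le> 1 / 2 * (pl ^ Suc k) ^ m" using 1 2 by (intro mult_mono) auto
      finally show ?thesis unfolding N(2) .
    qed
    ultimately show "exp (- c * real d)
      \<le> measure (rowsM d {..<d}) {X \<in> space (rowsM d {..<d}). \<not> gram_bounded d X {..<d} (4 + h / 1000)}"
      by linarith
  qed
  then show ?thesis using h by (intro exI[of _ "h / 1000"]) auto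
qed

end


section \<open>The regular graph\<close>

text \<open>The connection set of a circulant graph on the residues modulo r, closed under t -> r -
  t. An odd degree needs the antipodal offset r / 2, which is its own mirror image; r is then even
  because r d is even.\<close>

definition circ_set :: "nat \<Rightarrow> nat \<Rightarrow> nat set" where
  "circ_set d r = {1..d div 2} \<union> {r - d div 2..<r} \<union> (if odd d then {r div 2} else {})"

text \<open>Adding r before subtracting keeps the natural-number difference exact, so the offset is
  j - i modulo r.\<close>

definition circulant :: "nat \<Rightarrow> nat \<Rightarrow> nat \<Rightarrow> nat \<Rightarrow> real" where
  "circulant d r i j = (if (j + r - i) mod r \<in> circ_set d r then 1 else 0)"

context
  fixes d r :: nat
  assumes dr: "d < r" "even (r * d)"
begin

lemma card_circ_set: "card (circ_set d r) = d"
proof (cases "odd d")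
  case True
  then have "even r" using dr by simp
  then have r: "d div 2 < r div 2" "r div 2 < r - d div 2" "d div 2 < r - d div 2"
    using dr True by (auto elim!: evenE oddE)
  have "card (circ_set d r) = card ({1..d div 2} \<union> {r - d div 2..<r}) + card {r div 2}"
    unfolding circ_set_def using True r by (subst if_P, simp, intro card_Un_disjoint) auto
  also have "card ({1..d div 2} \<union> {r - d div 2..<r}) = card {1..d div 2} + card {r - d div 2..<r}"
    using r by (intro card_Un_disjoint) auto
  also have "\<dots> + card {r div 2} = d" using True dr by (auto elim!: oddE)
  finally show ?thesis .
next
  case False
  then have r: "d div 2 < r - d div 2" using dr by (auto elim!: evenE)
  have c: "circ_set d r = {1..d div 2} \<union> {r - d div 2..<r}" using False by (simp add: circ_set_def)
  have "card (circ_set d r) = card {1..d div 2} + card {r - d div 2..<r}"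
    unfolding c using r by (intro card_Un_disjoint) auto
  also have "\<dots> = d" using False dr by (auto elim!: evenE)
  finally show ?thesis .
qed

lemma circ_set_subset: "circ_set d r \<subseteq> {1..<r}"
proof -
  have "1 \<le> r div 2" if "odd d" using that dr by (auto elim!: oddE)
  then show ?thesis using dr by (auto simp: circ_set_def)
qed

lemma circ_set_sym: "t \<in> circ_set d r \<Longrightarrow> r - t \<in> circ_set d r"
proof -
  assume t: "t \<in> circ_set d r"
  have "r - r div 2 = r div 2" if "odd d" using that dr by (auto elim!: oddE evenE)
  then show ?thesis using t dr by (auto simp: circ_set_def split: if_splits)
qed

lemma circulant_regular: "regular_adj r d (circulant d r)"
  unfolding regular_adj_def
proof (intro conjI allI impI)
  fix i j assume ij: "i < r" "j < r"
  show "circulant d r i j \<in> {0, 1}" by (simp add: circulant_def)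
  have md: "(b + r - a) mod r = b - a" if "a \<le> b" "b < r" for a b
  proof -
    have "b + r - a = (b - a) + r" using that by simp
    then have "(b + r - a) mod r = (b - a + r) mod r" by (simp only:)
    also have "\<dots> = (b - a) mod r" by (rule mod_add_self2)
    also have "\<dots> = b - a" using that by (intro mod_less) simp
    finally show ?thesis .
  qed
  have *: "(i + r - j) mod r \<in> circ_set d r" if "(j + r - i) mod r \<in> circ_set d r" "i < r" "j < r" for i j
  proof (cases "i \<le> j")
    case True
    then have e: "(j + r - i) mod r = j - i" using that by (intro md)
    then have ji: "j - i \<in> circ_set d r" using that by simp
    then have "i < j" using circ_set_subset True by force
    note ji
    then have "r - (j - i) \<in> circ_set d r" by (intro circ_set_sym)
    moreover have "(i + r - j) mod r = r - (j - i)"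
      using \<open>i < j\<close> that by (subst mod_less) auto
    ultimately show ?thesis by simp
  next
    case False
    then have e: "(j + r - i) mod r = r - (i - j)" using that by (subst mod_less) auto
    then have "r - (r - (i - j)) \<in> circ_set d r" using that by (simp only: circ_set_sym)
    moreover have "(i + r - j) mod r = i - j" using False that by (intro md) auto
    ultimately show ?thesis using False that by simp
  qed
  show "circulant d r i j = circulant d r j i"
    unfolding circulant_def using *[of i j] *[of j i] ij by auto
next
  fix i assume "i < r"
  then show "circulant d r i i = 0" using circ_set_subset by (auto simp: circulant_def)
next
  fix i assume i: "i < r"
  \<comment> \<open>Translation by i permutes the residues, so every row sum equals the size of the
    connection set.\<close>
  have bij: "bij_betw (\<lambda>j. (j + r - i) mod r) {..<r} {..<r}"
  proof (rule bij_betwI[where g = "\<lambda>t. (t + i) mod r"])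
    show "(\<lambda>j. (j + r - i) mod r) \<in> {..<r} \<rightarrow> {..<r}" "(\<lambda>t. (t + i) mod r) \<in> {..<r} \<rightarrow> {..<r}"
      using i by auto
    show "((j + r - i) mod r + i) mod r = j" if "j \<in> {..<r}" for j
    proof -
      have "((j + r - i) mod r + i) mod r = (j + r - i + i) mod r" by (simp add: mod_add_left_eq)
      also have "\<dots> = j" using i that by simp
      finally show ?thesis .
    qed
    show "((t + i) mod r + r - i) mod r = t" if "t \<in> {..<r}" for t
    proof -
      have "((t + i) mod r + r - i) mod r = ((t + i) mod r + (r - i)) mod r" using i by simp
      also have "\<dots> = (t + i + (r - i)) mod r" by (simp add: mod_add_left_eq)
      also have "\<dots> = t" using i that by simp
      finally show ?thesis .
    qed
  qed
  have "(\<Sum>j<r. circulant d r i j) = (\<Sum>t<r. if t \<in> circ_set d r then 1 else 0)"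
    unfolding circulant_def by (rule sum.reindex_bij_betw[OF bij])
  also have "\<dots> = real (card ({..<r} \<inter> circ_set d r))"
    by (simp add: sum.If_cases)
  also have "{..<r} \<inter> circ_set d r = circ_set d r" using circ_set_subset by auto
  finally show "(\<Sum>j<r. circulant d r i j) = real d" by (simp add: card_circ_set)
qed

end

text \<open>One block fewer than possible is used: its vertices and the remainder of \<open>n\<close> modulo \<open>2 d\<close> together
  are numerous enough to carry a \<open>d\<close>-regular circulant graph.\<close>

definition block_count :: "nat \<Rightarrow> nat \<Rightarrow> nat" where
  "block_count n d = n div (2 * d) - 1"

text \<open>The first B vertices are grouped into runs of length 2 d; in each run the first d
  vertices are joined to the last d. The remaining n - B vertices carry the circulant graph.\<close>

definition block_graph :: "nat \<Rightarrow> nat \<Rightarrow> nat \<Rightarrow> nat \<Rightarrow> real" where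
  "block_graph n d i j = (let B = 2 * d * block_count n d in
    if i < B \<and> j < B then
      (if i div (2 * d) = j div (2 * d) \<and> (i mod (2 * d) < d) \<noteq> (j mod (2 * d) < d) then 1 else 0)
    else if B \<le> i \<and> B \<le> j then circulant d (n - B) (i - B) (j - B) else 0)"

lemma sum_lessThan_add:
  fixes f :: "nat \<Rightarrow> real"
  shows "(\<Sum>j<a + r. f j) = (\<Sum>j<a. f j) + (\<Sum>j<r. f (a + j))"
  by (induction r) (simp_all add: add.assoc)

lemma block_graph_regular:
  assumes d: "0 < d" "2 * d \<le> n" "even (n * d)"
  shows "regular_adj n d (block_graph n d)"
proof -
  define m where "m = block_count n d"
  define B where "B = 2 * d * m"
  define r where "r = n - B"
  have "1 \<le> n div (2 * d)" using d by (simp add: Suc_le_eq div_greater_zero_iff)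
  then have "Suc m = n div (2 * d)" by (simp add: m_def block_count_def)
  then have "2 * d * Suc m \<le> n" by (metis times_div_less_eq_dividend)
  then have r: "n = B + r" "d < r" using d by (auto simp: B_def r_def)
  \<comment> \<open>B is even, so the parity condition passes to the remaining vertices.\<close>
  have ev: "even (r * d)"
    using d(3) unfolding r(1) by (simp add: B_def)
  have C: "regular_adj r d (circulant d r)" using r(2) ev by (rule circulant_regular)
  have G: "block_graph n d i j = (if i < B \<and> j < B then
      (if i div (2 * d) = j div (2 * d) \<and> (i mod (2 * d) < d) \<noteq> (j mod (2 * d) < d) then 1 else 0)
    else if B \<le> i \<and> B \<le> j then circulant d r (i - B) (j - B) else 0)" for i j
    by (simp add: block_graph_def Let_def B_def m_def r_def)
  show ?thesis
    unfolding regular_adj_def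
  proof (intro conjI allI impI)
    fix i j assume ij: "i < n" "j < n"
    show "block_graph n d i j \<in> {0, 1}" by (simp add: G circulant_def)
    show "block_graph n d i j = block_graph n d j i"
    proof (cases "B \<le> i \<and> B \<le> j")
      case True
      then have "i - B < r" "j - B < r" using ij r by auto
      then have "circulant d r (i - B) (j - B) = circulant d r (j - B) (i - B)"
        using C unfolding regular_adj_def by blast
      then show ?thesis using True by (simp add: G)
    next
      case False
      then show ?thesis by (auto simp: G)
    qed
  next
    fix i assume "i < n"
    then have "circulant d r (i - B) (i - B) = 0" if "B \<le> i"
      using C r that unfolding regular_adj_def by auto
    then show "block_graph n d i i = 0" by (auto simp: G)
  next
    fix i assume i: "i < n"
    show "(\<Sum>j<n. block_graph n d i j) = real d"
    proof (cases "i < B")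
      case True
      define q where "q = i div (2 * d)"
      \<comment> \<open>The neighbours of i form the opposite half of its run, an interval of length
        d starting at offset s.\<close>
      define s where "s = (if i mod (2 * d) < d then d else 0)"
      have q: "q < m" using True by (simp add: q_def B_def less_mult_imp_div_less mult.commute)
      have "(\<Sum>j<n. block_graph n d i j) = (\<Sum>j<n. if j \<in> {2 * d * q + s..<2 * d * q + s + d} then 1 else 0)"
      proof (rule sum.cong[OF refl])
        fix j assume "j \<in> {..<n}"
        have sub: "2 * d * q + 2 * d \<le> B"
        proof -
          have "2 * d * Suc q \<le> 2 * d * m" using q by (intro mult_le_mono) auto
          then show ?thesis by (simp add: B_def)
        qed
        have "(j < B \<and> q = j div (2 * d) \<and> (i mod (2 * d) < d) \<noteq> (j mod (2 * d) < d))
            \<longleftrightarrow> j \<in> {2 * d * q + s..<2 * d * q + s + d}"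
        proof
          assume j: "j < B \<and> q = j div (2 * d) \<and> (i mod (2 * d) < d) \<noteq> (j mod (2 * d) < d)"
          define t where "t = j mod (2 * d)"
          have t: "t < 2 * d" "(i mod (2 * d) < d) \<noteq> (t < d)" "j = 2 * d * q + t"
            using d j by (simp_all add: t_def)
          show "j \<in> {2 * d * q + s..<2 * d * q + s + d}"
            unfolding t(3) using t(1,2) by (auto simp: s_def)
        next
          assume j: "j \<in> {2 * d * q + s..<2 * d * q + s + d}"
          then obtain t where t: "j = 2 * d * q + t" "s \<le> t" "t < s + d"
            using le_Suc_ex[of "2 * d * q" j] by fastforce
          then have "t < 2 * d" by (auto simp: s_def split: if_splits)
          then have "j div (2 * d) = q" "j mod (2 * d) = t" "j < B" using t(1) sub d by auto
          then show "j < B \<and> q = j div (2 * d) \<and> (i mod (2 * d) < d) \<noteq> (j mod (2 * d) < d)"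
            using t by (auto simp: s_def split: if_splits)
        qed
        then show "block_graph n d i j = (if j \<in> {2 * d * q + s..<2 * d * q + s + d} then 1 else 0)"
          using True by (auto simp: G q_def)
      qed
      also have "\<dots> = real (card ({..<n} \<inter> {2 * d * q + s..<2 * d * q + s + d}))"
        by (subst sum.inter_restrict[symmetric]) simp_all
      also have "{..<n} \<inter> {2 * d * q + s..<2 * d * q + s + d} = {2 * d * q + s..<2 * d * q + s + d}"
      proof -
        have "2 * d * Suc q \<le> 2 * d * m" using q by (intro mult_le_mono) auto
        then have "2 * d * q + s + d \<le> n" using r(1) by (auto simp: B_def s_def)
        then show ?thesis by auto
      qed
      finally show ?thesis by simp
    next
      case False
      then have iB: "B \<le> i" "i - B < r" using i r by auto
      have "(\<Sum>j<n. block_graph n d i j) = (\<Sum>j<B. block_graph n d i j) + (\<Sum>j<r. block_graph n d i (B + j))"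
        unfolding r(1) by (rule sum_lessThan_add)
      also have "(\<Sum>j<B. block_graph n d i j) = 0" using iB by (intro sum.neutral) (auto simp: G)
      also have "(\<Sum>j<r. block_graph n d i (B + j)) = (\<Sum>j<r. circulant d r (i - B) j)"
        using iB by (intro sum.cong) (auto simp: G)
      also have "\<dots> = real d" using C iB unfolding regular_adj_def by blast
      finally show ?thesis by simp
    qed
  qed
qed

section \<open>From one large block to the spectral norm of the whole matrix\<close>

lemma spec_norm_gt:
  assumes "0 \<le> c" "c\<^sup>2 * (\<Sum>j<n. (x j)\<^sup>2) < (\<Sum>i<n. (\<Sum>j<n. M i j * x j)\<^sup>2)"
  shows "c \<le> spec_norm n M"
proof -
  let ?S = "{sqrt (\<Sum>i<n. (\<Sum>j<n. M i j * x j)\<^sup>2) | x. (\<Sum>j<n. (x j)\<^sup>2) = 1}"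
  \<comment> \<open>A real supremum is informative only for a set bounded above; the Frobenius norm
    is a bound here.\<close>
  have bdd: "bdd_above ?S"
  proof (rule bdd_aboveI)
    fix z assume "z \<in> ?S"
    then obtain x where x: "z = sqrt (\<Sum>i<n. (\<Sum>j<n. M i j * x j)\<^sup>2)" "(\<Sum>j<n. (x j)\<^sup>2) = 1" by blast
    have "(\<Sum>j<n. M i j * x j)\<^sup>2 \<le> (\<Sum>j<n. (M i j)\<^sup>2)" for i
      using Cauchy_Schwarz_ineq_sum[of "M i" x "{..<n}"] x(2) by simp
    then show "z \<le> sqrt (\<Sum>i<n. \<Sum>j<n. (M i j)\<^sup>2)"
      unfolding x(1) by (intro real_sqrt_le_mono sum_mono)
  qed
  define v where "v = (\<Sum>j<n. (x j)\<^sup>2)"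
  \<comment> \<open>The strict inequality fails for the zero vector, so the test vector can be
    normalised.\<close>
  have "v \<noteq> 0"
  proof
    assume "v = 0"
    then have "x j = 0" if "j < n" for j using that by (simp add: v_def sum_nonneg_eq_0_iff)
    then show False using assms(2) by simp
  qed
  moreover have "0 \<le> v" by (simp add: v_def sum_nonneg)
  ultimately have v: "0 < v" by simp
  define y where "y j = x j / sqrt v" for j
  have "(\<Sum>j<n. (y j)\<^sup>2) = 1"
    using v by (simp add: y_def power_divide sum_divide_distrib[symmetric] v_def[symmetric])
  then have "sqrt (\<Sum>i<n. (\<Sum>j<n. M i j * y j)\<^sup>2) \<le> spec_norm n M"
    unfolding spec_norm_def by (intro cSup_upper bdd) auto
  moreover have "c \<le> sqrt (\<Sum>i<n. (\<Sum>j<n. M i j * y j)\<^sup>2)"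
  proof (rule real_le_rsqrt)
    have e: "(\<Sum>j<n. M i j * y j) = (\<Sum>j<n. M i j * x j) / sqrt v" for i
      by (simp add: y_def sum_divide_distrib)
    have "(\<Sum>i<n. (\<Sum>j<n. M i j * y j)\<^sup>2) = (\<Sum>i<n. (\<Sum>j<n. M i j * x j)\<^sup>2 / v)"
      unfolding e using v by (simp add: power_divide)
    then have "(\<Sum>i<n. (\<Sum>j<n. M i j * y j)\<^sup>2) = (\<Sum>i<n. (\<Sum>j<n. M i j * x j)\<^sup>2) / v"
      by (simp only: sum_divide_distrib)
    then show "c\<^sup>2 \<le> (\<Sum>i<n. (\<Sum>j<n. M i j * y j)\<^sup>2)"
      using assms(2) v by (simp add: v_def[symmetric] pos_le_divide_eq)
  qed
  ultimately show ?thesis by linarith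
qed

text \<open>A vector witnessing that block q is large, placed on the second half of the run, is
  mapped by the rows of the first half exactly as by the block; all other rows only add to the
  norm.\<close>

lemma block_spec_norm:
  fixes w :: "nat \<Rightarrow> nat \<Rightarrow> real"
  assumes d: "0 < d" and q: "q < block_count n d" and "0 \<le> b"
    and nb: "\<not> gram_bounded d (\<lambda>a l. w (2 * d * q + a) (2 * d * q + d + l)) {..<d} b"
  shows "sqrt b \<le> spec_norm n (\<lambda>i j. block_graph n d i j * w i j / sqrt (real d))"
proof -
  define B where "B = 2 * d * block_count n d"
  define p where "p = 2 * d * q"
  have "q + 1 \<le> block_count n d" using q by simp
  then have "2 * d * (q + 1) \<le> B" unfolding B_def by (rule mult_le_mono2)
  then have oB: "p + 2 * d \<le> B" by (simp add: p_def)
  have "B \<le> 2 * d * (n div (2 * d))" unfolding B_def block_count_def by (intro mult_le_mono) auto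
  also have "\<dots> \<le> n" by simp
  finally have Bn: "B \<le> n" .
  from nb obtain x where x: "b * real d * ip d x x < (\<Sum>a<d. (ip d (w (p + a)  \<circ> (\<lambda>l. p + d + l)) x)\<^sup>2)"
    by (auto simp: gram_bounded_def p_def comp_def not_le)
  define y where "y j = (if p + d \<le> j \<and> j < p + d + d then x (j - (p + d)) else 0)" for j
  have sumy: "(\<Sum>j<n. f j * g (y j)) = (\<Sum>l<d. f (p + d + l) * g (x l))" if "g 0 = 0" for f g :: "_ \<Rightarrow> real"
  proof -
    have "(\<Sum>j<n. f j * g (y j)) = (\<Sum>j\<in>{p + d..<p + d + d}. f j * g (y j))"
      using oB Bn that by (intro sum.mono_neutral_right) (auto simp: y_def)
    also have "\<dots> = (\<Sum>l\<in>{0..<d}. f (l + (p + d)) * g (y (l + (p + d))))"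
      using sum.shift_bounds_nat_ivl[of "\<lambda>j. f j * g (y j)" 0 "p + d" d] by (simp add: add.commute)
    also have "\<dots> = (\<Sum>l<d. f (p + d + l) * g (x l))"
      by (intro sum.cong) (auto simp: y_def add.commute)
    finally show ?thesis .
  qed
  have ny: "(\<Sum>j<n. (y j)\<^sup>2) = ip d x x"
    using sumy[of "\<lambda>z. z\<^sup>2" "\<lambda>_. 1"] by (simp add: ip_def power2_eq_square)
  have row: "(\<Sum>j<n. block_graph n d (p + a) j * w (p + a) j / sqrt (real d) * y j)
      = ip d (w (p + a) \<circ> (\<lambda>l. p + d + l)) x / sqrt (real d)" if a: "a < d" for a
  proof -
    have G: "block_graph n d (p + a) (p + d + l) = 1" if l: "l < d" for l
    proof -
      have "(p + a) div (2 * d) = q" "(p + a) mod (2 * d) = a"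
        using a by (auto simp: p_def)
      moreover have "p + d + l = 2 * d * q + (d + l)" by (simp add: p_def)
      then have "(p + d + l) div (2 * d) = q" "(p + d + l) mod (2 * d) = d + l"
        using l by (simp_all only:) simp_all
      ultimately show ?thesis using a l oB by (simp add: block_graph_def Let_def B_def[symmetric])
    qed
    have "(\<Sum>j<n. block_graph n d (p + a) j * w (p + a) j / sqrt (real d) * y j)
        = (\<Sum>l<d. block_graph n d (p + a) (p + d + l) * w (p + a) (p + d + l) / sqrt (real d) * x l)"
      by (rule sumy) simp
    also have "\<dots> = (\<Sum>l<d. w (p + a) (p + d + l) * x l / sqrt (real d))"
      by (intro sum.cong) (auto simp: G)
    finally show ?thesis by (simp add: ip_def sum_divide_distrib)
  qed
  show ?thesis
  proof (rule spec_norm_gt)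
    have "(sqrt b)\<^sup>2 * (\<Sum>j<n. (y j)\<^sup>2) = b * ip d x x" using assms(3) by (simp add: ny)
    also have "\<dots> < (\<Sum>a<d. (ip d (w (p + a) \<circ> (\<lambda>l. p + d + l)) x)\<^sup>2) / real d"
      using x d by (simp add: pos_less_divide_eq mult_ac)
    also have "\<dots> = (\<Sum>a<d. (\<Sum>j<n. block_graph n d (p + a) j * w (p + a) j / sqrt (real d) * y j)\<^sup>2)"
      unfolding sum_divide_distrib by (intro sum.cong refl) (use d in \<open>simp add: row power_divide del: times_divide_eq_left\<close>)
    also have "\<dots> = (\<Sum>i\<in>(\<lambda>a. p + a) ` {..<d}. (\<Sum>j<n. block_graph n d i j * w i j / sqrt (real d) * y j)\<^sup>2)"
      by (subst sum.reindex) auto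
    also have "\<dots> \<le> (\<Sum>i<n. (\<Sum>j<n. block_graph n d i j * w i j / sqrt (real d) * y j)\<^sup>2)"
      using oB Bn by (intro sum_mono2) auto
    finally show "(sqrt b)\<^sup>2 * (\<Sum>j<n. (y j)\<^sup>2) < (\<Sum>i<n. (\<Sum>j<n. block_graph n d i j * w i j / sqrt (real d) * y j)\<^sup>2)" .
  qed (use assms(3) in simp)
qed


section \<open>Independence of the blocks and conclusion\<close>

text \<open>Applied twice: entries are gathered into rows, then rows into blocks.\<close>

lemma (in prob_space) indep_vars_group:
  assumes ind: "indep_vars (\<lambda>_. N) X I" and g: "\<And>j k. j \<in> J \<Longrightarrow> k \<in> L \<Longrightarrow> g j k \<in> I"
    and inj: "inj_on (\<lambda>(j, k). g j k) (J \<times> L)"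
  shows "indep_vars (\<lambda>_. PiM L (\<lambda>_. N)) (\<lambda>j \<omega>. \<lambda>k\<in>L. X (g j k) \<omega>) J"
proof -
  have "disjoint_family_on (\<lambda>j. g j ` L) J"
    unfolding disjoint_family_on_def
  proof (intro ballI impI)
    fix j j' assume "j \<in> J" "j' \<in> J" "j \<noteq> j'"
    then show "g j ` L \<inter> g j' ` L = {}"
      using inj by (auto dest!: inj_onD[where x = "(j, _)" and y = "(j', _)"])
  qed
  then have "indep_vars (\<lambda>j. PiM (g j ` L) (\<lambda>_. N)) (\<lambda>j \<omega>. restrict (\<lambda>i. X i \<omega>) (g j ` L)) J"
    using g by (intro indep_vars_restrict[OF ind]) auto
  then have "indep_vars (\<lambda>_. PiM L (\<lambda>_. N)) (\<lambda>j \<omega>. (\<lambda>f. \<lambda>k\<in>L. f (g j k)) (restrict (\<lambda>i. X i \<omega>) (g j ` L))) J"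
    by (rule indep_vars_compose2) (intro measurable_restrict measurable_component_singleton imageI)
  moreover have "(\<lambda>j \<omega>. (\<lambda>f. \<lambda>k\<in>L. f (g j k)) (restrict (\<lambda>i. X i \<omega>) (g j ` L))) = (\<lambda>j \<omega>. \<lambda>k\<in>L. X (g j k) \<omega>)"
    by (auto simp: fun_eq_iff)
  ultimately show ?thesis by (simp only:)
qed

text \<open>Restricting to the singletons \<open>{g k}\<close> reindexes the independent family
  along \<open>g\<close>; the joint law is then the product of the marginals.\<close>

lemma (in prob_space) distr_group:
  assumes ind: "indep_vars (\<lambda>_. N) X I" and g: "\<And>k. k \<in> L \<Longrightarrow> g k \<in> I"
    and inj: "inj_on g L" and law: "\<And>i. i \<in> I \<Longrightarrow> distr M N (X i) = \<nu>" and L: "L \<noteq> {}"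
  shows "distr M (PiM L (\<lambda>_. N)) (\<lambda>\<omega>. \<lambda>k\<in>L. X (g k) \<omega>) = PiM L (\<lambda>_. \<nu>)"
proof -
  have rv: "random_variable N (X i)" if "i \<in> I" for i
    using ind that by (auto simp: indep_vars_def)
  have "disjoint_family_on (\<lambda>k. {g k}) L"
    using inj by (auto simp: disjoint_family_on_def inj_on_def)
  then have "indep_vars (\<lambda>k. PiM {g k} (\<lambda>_. N)) (\<lambda>k \<omega>. restrict (\<lambda>i. X i \<omega>) {g k}) L"
    using g by (intro indep_vars_restrict[OF ind]) auto
  then have "indep_vars (\<lambda>_. N) (\<lambda>k \<omega>. (\<lambda>f. f (g k)) (restrict (\<lambda>i. X i \<omega>) {g k})) L"
    by (rule indep_vars_compose2) (intro measurable_component_singleton, simp)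
  then have "indep_vars (\<lambda>_. N) (\<lambda>k. X (g k)) L" by simp
  then have "distr M (PiM L (\<lambda>_. N)) (\<lambda>\<omega>. \<lambda>k\<in>L. X (g k) \<omega>) = PiM L (\<lambda>k. distr M N (X (g k)))"
    using L rv g by (subst (asm) indep_vars_iff_distr_eq_PiM') auto
  also have "\<dots> = PiM L (\<lambda>_. \<nu>)" using g law by (intro PiM_cong) auto
  finally show ?thesis .
qed

context entry_law begin

text \<open>The blocks are independent, each with the law of a d by d array of iid entries, so the
  probability is at most (1 - p)^m with m = \<open>block_count n d\<close>, hence at most exp (- p
  m).\<close>

lemma all_blocks_bounded_unlikely:
  fixes Q :: "'b measure" and w :: "'b \<Rightarrow> nat \<Rightarrow> nat \<Rightarrow> real"
  assumes Q: "prob_space Q" and d: "0 < d"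
    and ind: "prob_space.indep_vars Q (\<lambda>_. borel) (\<lambda>(i, j) \<omega>. w \<omega> i j) {(i, j). i < j \<and> j < n}"
    and law: "\<And>i j. i < j \<Longrightarrow> j < n \<Longrightarrow> distr Q borel (\<lambda>\<omega>. w \<omega> i j) = \<mu>"
    and p: "p \<le> measure (rowsM d {..<d}) {X \<in> space (rowsM d {..<d}). \<not> gram_bounded d X {..<d} b}"
  defines "B \<equiv> {\<omega> \<in> space Q. \<forall>q<block_count n d. gram_bounded d (\<lambda>a l. w \<omega> (2 * d * q + a) (2 * d * q + d + l)) {..<d} b}"
  shows "B \<in> sets Q" and "measure Q B \<le> exp (- (p * real (block_count n d)))"
proof -
  interpret Q: prob_space Q by fact
  define m where "m = block_count n d"
  have bound: "2 * d * q + d + l < n" if "q < m" "l < d" for q l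
  proof -
    have "Suc q \<le> n div (2 * d)" using that by (simp add: m_def block_count_def)
    then have "2 * d * Suc q \<le> 2 * d * (n div (2 * d))" by (intro mult_le_mono) auto
    also have "\<dots> \<le> n" by simp
    finally show ?thesis using that by simp
  qed
  let ?I = "{(i, j). i < j \<and> j < n}"
  \<comment> \<open>The position in the large matrix of entry l in row a of block q. The row index
    is below the column index, so only entries above the diagonal occur and no symmetric pair is met
    twice.\<close>
  define g where "g = (\<lambda>(q, a) l. (2 * d * q + a, 2 * d * q + d + l))"
  have gI: "g j l \<in> ?I" if "j \<in> {..<m} \<times> {..<d}" "l \<in> {..<d}" for j l
    using that bound by (auto simp: g_def)
  have inj: "inj_on (\<lambda>(j, l). g j l) (({..<m} \<times> {..<d}) \<times> {..<d})"
  proof (rule inj_onI, clarsimp simp: g_def)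
    fix q a l q' a' l'
    assume a: "a < d" "a' < d" and e: "2 * d * q + a = 2 * d * q' + a'" "2 * d * q + l = 2 * d * q' + l'"
    have "q = (2 * d * q + a) div (2 * d)" "q' = (2 * d * q' + a') div (2 * d)" using a by auto
    with e(1) have "q = q'" by simp
    with e show "q = q' \<and> a = a' \<and> l = l'" by simp
  qed
  let ?X = "\<lambda>(i, j) \<omega>. w \<omega> i j"
  let ?N = "PiM {..<d} (\<lambda>_. borel :: real measure)"
  define Y where "Y j \<omega> = (\<lambda>l\<in>{..<d}. ?X (g j l) \<omega>)" for j \<omega>
  have Yind: "Q.indep_vars (\<lambda>_. ?N) Y ({..<m} \<times> {..<d})"
    using Q.indep_vars_group[OF ind gI inj] by (simp add: Y_def[abs_def])
  have Ylaw: "distr Q ?N (Y j) = rowM d" if "j \<in> {..<m} \<times> {..<d}" for j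
    unfolding Y_def
  proof (rule Q.distr_group[OF ind])
    show "inj_on (g j) {..<d}" by (auto simp: inj_on_def g_def split: prod.splits)
    show "distr Q borel (?X i) = \<mu>" if "i \<in> ?I" for i using that law by auto
  qed (use gI that d in auto)
  let ?N2 = "PiM {..<d} (\<lambda>_. ?N)"
  define Z where "Z q \<omega> = (\<lambda>a\<in>{..<d}. Y (q, a) \<omega>)" for q \<omega>
  have Zind: "Q.indep_vars (\<lambda>_. ?N2) Z {..<m}"
    using Q.indep_vars_group[OF Yind, of "{..<m}" "{..<d}" Pair]
    by (simp add: Z_def[abs_def] inj_on_def)
  have Zlaw: "distr Q ?N2 (Z q) = rowsM d {..<d}" if "q < m" for q
    unfolding Z_def
  proof (rule Q.distr_group[OF Yind])
    show "inj_on (Pair q) {..<d}" by (simp add: inj_on_def)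
  qed (use Ylaw that d in auto)
  have sets2: "sets ?N2 = sets (rowsM d {..<d})"
    by (intro sets_PiM_cong refl) (simp_all add: sets_\<mu>)
  have space2: "space ?N2 = space (rowsM d {..<d})" by (rule sets_eq_imp_space_eq[OF sets2])
  have Zrv [measurable]: "Z q \<in> measurable Q ?N2" if "q < m" for q
    using Zind that by (auto simp: Q.indep_vars_def)
  let ?E = "{X \<in> space (rowsM d {..<d}). gram_bounded d X {..<d} b}"
  have E: "?E \<in> sets (rowsM d {..<d})" by (rule sets_gram_bounded) auto
  have Zeq: "gram_bounded d (Z q \<omega>) {..<d} b
      = gram_bounded d (\<lambda>a l. w \<omega> (2 * d * q + a) (2 * d * q + d + l)) {..<d} b" for q \<omega>
    by (rule gram_bounded_cong) (simp add: Z_def Y_def g_def)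
  have B: "B = {\<omega> \<in> space Q. \<forall>q<m. \<omega> \<in> Z q -` ?E \<inter> space Q}"
    unfolding B_def m_def[symmetric] using Zrv[THEN measurable_space] by (auto simp: Zeq space2)
  have vim: "Z q -` ?E \<inter> space Q \<in> sets Q" if "q < m" for q
    using that E by (intro measurable_sets[OF Zrv]) (auto simp: sets2)
  show "B \<in> sets Q"
  proof -
    \<comment> \<open>An intersection over no blocks is not confined to the sample space, so m = 0
      is treated separately.\<close>
    have "B = space Q \<inter> (\<Inter>q\<in>{..<m}. Z q -` ?E \<inter> space Q) \<or> m = 0 \<and> B = space Q"
      unfolding B by auto
    moreover have "(\<Inter>q\<in>{..<m}. Z q -` ?E \<inter> space Q) \<in> sets Q" if "m \<noteq> 0"
      using that vim by (intro sets.finite_INT) auto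
    ultimately show ?thesis by (cases "m = 0") auto
  qed
  have "measure Q B \<le> exp (- (p * real m))"
  proof (cases "m = 0")
    case True
    then show ?thesis by simp
  next
    case False
    interpret P: prob_space "rowsM d {..<d}" by (rule prob_space_rows)
    have compl: "measure (rowsM d {..<d}) ?E \<le> 1 - p"
    proof -
      have "{X \<in> space (rowsM d {..<d}). \<not> gram_bounded d X {..<d} b} = space (rowsM d {..<d}) - ?E" by auto
      then show ?thesis using p P.prob_compl[OF E] by simp
    qed
    have "measure Q B = measure Q (\<Inter>q\<in>{..<m}. Z q -` ?E \<inter> space Q)"
      using False by (intro arg_cong[where f = "measure Q"]) (auto simp: B)
    also have "\<dots> = (\<Prod>q<m. measure Q (Z q -` ?E \<inter> space Q))"
      using False E by (intro Q.indep_varsD_finite[OF Zind]) (auto simp: sets2)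
    also have "\<dots> = (\<Prod>q<m. measure (rowsM d {..<d}) ?E)"
    proof (rule prod.cong[OF refl])
      fix q assume "q \<in> {..<m}"
      then have q: "q < m" by simp
      have "measure (distr Q ?N2 (Z q)) ?E = measure Q (Z q -` ?E \<inter> space Q)"
        using q E by (intro measure_distr) (auto simp: sets2)
      then show "measure Q (Z q -` ?E \<inter> space Q) = measure (rowsM d {..<d}) ?E"
        unfolding Zlaw[OF q] by simp
    qed
    also have "\<dots> = measure (rowsM d {..<d}) ?E ^ m" by simp
    also have "\<dots> \<le> exp (- p) ^ m"
      using compl exp_ge_add_one_self[of "- p"] by (intro power_mono) auto
    also have "\<dots> = exp (- (p * real m))" by (simp add: exp_of_nat_mult[symmetric] mult.commute)
    finally show ?thesis .
  qed
  then show "measure Q B \<le> exp (- (p * real (block_count n d)))" by (simp add: m_def)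
qed

end

text \<open>The rate 1 / (4 C) makes the success probability of a block at least n^(-1/4), while
  there are at least n^(1/2) blocks for large n. The expected number of successes is thus at least
  n^(1/4), and exp (- n^(1/4)) is summable.\<close>

lemma log_degree_asymptotics:
  fixes d :: "nat \<Rightarrow> nat"
  assumes "0 < C" "\<forall>\<^sub>F n in sequentially. real (d n) \<le> C * ln (real n)" "\<And>n. 0 < d n"
  shows "\<forall>\<^sub>F n in sequentially. 2 * d n \<le> n"
    and "\<forall>\<^sub>F n in sequentially. exp (- (exp (- (1 / (4 * C)) * real (d n)) * real (block_count n (d n)))) \<le> 1 / real n ^ 2"
proof -
  have "\<forall>\<^sub>F n in sequentially. 2 * (C * ln (real n)) \<le> real n"
    using assms(1) by real_asymp
  with assms(2) show "\<forall>\<^sub>F n in sequentially. 2 * d n \<le> n"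
    by eventually_elim linarith
  have "\<forall>\<^sub>F n in sequentially. real n powr (1 / 2) \<le> real n / (2 * (C * ln (real n))) - 2"
    using assms(1) by real_asymp
  moreover have "\<forall>\<^sub>F n in sequentially. exp (- (real n powr (1 / 4))) \<le> 1 / real n ^ 2"
    by real_asymp
  ultimately show "\<forall>\<^sub>F n in sequentially. exp (- (exp (- (1 / (4 * C)) * real (d n)) * real (block_count n (d n)))) \<le> 1 / real n ^ 2"
    using assms(2) eventually_gt_at_top[of 1]
  proof eventually_elim
    fix n :: nat
    assume n: "real n powr (1 / 2) \<le> real n / (2 * (C * ln (real n))) - 2"
      "exp (- (real n powr (1 / 4))) \<le> 1 / real n ^ 2" "real (d n) \<le> C * ln (real n)" "1 < n"
    have d: "0 < real (d n)" using assms(3) by simp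
    have "real n / (2 * (C * ln (real n))) \<le> real n / real (2 * d n)"
    proof (rule divide_left_mono)
      show "0 < 2 * (C * ln (real n)) * real (2 * d n)"
        using d assms(1) n(4) by (intro mult_pos_pos) auto
    qed (use n(3) in auto)
    \<comment> \<open>Rounding costs 1 here and the block left out of \<open>block_count\<close>
      costs another 1, hence the 2 subtracted from n / (2 C ln n).\<close>
    also have "\<dots> \<le> real (n div (2 * d n)) + 1"
    proof -
      have "n < (n div (2 * d n) + 1) * (2 * d n)"
        using dividend_less_div_times[of "2 * d n" n] assms(3)[of n] by simp
      then have "real n < real ((n div (2 * d n) + 1) * (2 * d n))" by (simp only: of_nat_less_iff)
      then have "real n < (real (n div (2 * d n)) + 1) * real (2 * d n)" by (simp only: of_nat_mult of_nat_add of_nat_1)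
      then show ?thesis using d by (simp add: pos_divide_le_eq)
    qed
    finally have "real n powr (1 / 2) \<le> real (block_count n (d n))"
      using n(1) unfolding block_count_def by linarith
    moreover have "real n powr (- 1 / 4) \<le> exp (- (1 / (4 * C)) * real (d n))"
    proof -
      have "1 / (4 * C) * real (d n) \<le> 1 / (4 * C) * (C * ln (real n))"
        using n(3) assms(1) by (intro mult_left_mono) auto
      then have "1 / (4 * C) * real (d n) \<le> ln (real n) / 4" using assms(1) by simp
      then show ?thesis using n(4) by (simp add: powr_def)
    qed
    ultimately have "real n powr (- 1 / 4) * real n powr (1 / 2)
        \<le> exp (- (1 / (4 * C)) * real (d n)) * real (block_count n (d n))"
      by (intro mult_mono) auto
    then have "real n powr (1 / 4) \<le> exp (- (1 / (4 * C)) * real (d n)) * real (block_count n (d n))"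
      by (simp add: powr_add[symmetric])
    then have "exp (- (exp (- (1 / (4 * C)) * real (d n)) * real (block_count n (d n)))) \<le> exp (- (real n powr (1 / 4)))"
      by simp
    with n(2) show "exp (- (exp (- (1 / (4 * C)) * real (d n)) * real (block_count n (d n)))) \<le> 1 / real n ^ 2"
      by linarith
  qed
qed

text \<open>A single \<epsilon> serves all large n, so the lower limit is at least sqrt (4 +
  \<epsilon>) and strictly above 2. The first Borel-Cantelli lemma asks only for summable
  probabilities, so the joint law of the matrices for different n does not enter.\<close>

theorem theorem1p3:
  fixes M :: "'a measure"
    and \<xi> :: "'a \<Rightarrow> real"
    and W :: "nat \<Rightarrow> 'a \<Rightarrow> nat \<Rightarrow> nat \<Rightarrow> real"
    and d :: "nat \<Rightarrow> nat"
  assumes "prob_space M"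
    and "\<xi> \<in> borel_measurable M"
    and "integrable M (\<lambda>\<omega>. (\<xi> \<omega>) ^ 4)"
    and "prob_space.expectation M \<xi> = 0"
    and "prob_space.expectation M (\<lambda>\<omega>. (\<xi> \<omega>)\<^sup>2) = 1"
    and "\<And>n \<omega> i j. W n \<omega> i j = W n \<omega> j i"
    and "\<And>n. prob_space.indep_vars M (\<lambda>_. borel) (\<lambda>(i, j) \<omega>. W n \<omega> i j)
                 {(i, j). i < j \<and> j < n}"
    and "\<And>n i j. i < j \<Longrightarrow> j < n \<Longrightarrow> distr M borel (\<lambda>\<omega>. W n \<omega> i j) = distr M borel \<xi>"
    and "\<And>n. d n > 0"
    and "(\<lambda>n. real (d n)) \<in> O(\<lambda>n. ln (real n))"
    and "filterlim d at_top sequentially"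
    and "\<And>n. even (n * d n)"
  shows "\<exists>A :: nat \<Rightarrow> nat \<Rightarrow> nat \<Rightarrow> real.
           (\<forall>\<^sub>F n in sequentially. regular_adj n (d n) (A n)) \<and>
           (AE \<omega> in M. liminf (\<lambda>n. ereal (spec_norm n
               (\<lambda>i j. A n i j * W n \<omega> i j / sqrt (real (d n))))) > 2)"
proof -
  interpret M: prob_space M by fact
  note [measurable] = assms(2)
  define \<mu> where "\<mu> = distr M borel \<xi>"
  interpret L: entry_law \<mu>
  proof (intro entry_law.intro entry_law_axioms.intro)
    show "prob_space \<mu>" unfolding \<mu>_def by (rule M.prob_space_distr) fact
    show "sets \<mu> = sets borel" by (simp add: \<mu>_def)
    show "integrable \<mu> (\<lambda>x. x ^ 4)"
      unfolding \<mu>_def using assms(3) by (subst integrable_distr_eq) auto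
    show "(\<integral>x. x \<partial>\<mu>) = 0" unfolding \<mu>_def using assms(4) by (subst integral_distr) auto
    show "(\<integral>x. x\<^sup>2 \<partial>\<mu>) = 1" unfolding \<mu>_def using assms(5) by (subst integral_distr) auto
  qed
  obtain C where C: "0 < C" "\<forall>\<^sub>F n in sequentially. norm (real (d n)) \<le> C * norm (ln (real n))"
    using assms(10) by (elim landau_o.bigE)
  have dC: "\<forall>\<^sub>F n in sequentially. real (d n) \<le> C * ln (real n)"
    using C(2) eventually_gt_at_top[of 0] by eventually_elim simp
  note asym = log_degree_asymptotics[OF C(1) dC assms(9)]
  \<comment> \<open>The rate at which the block probability may decay so that the many blocks still
    win, as in \<open>log_degree_asymptotics\<close>.\<close>
  define c where "c = 1 / (4 * C)"
  have "0 < c" using C by (simp add: c_def)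
  from L.block_norm_large[OF this] obtain \<epsilon> where \<epsilon>: "0 < \<epsilon>"
    and ev: "\<forall>\<^sub>F k in sequentially. exp (- c * real k)
      \<le> measure (L.rowsM k {..<k}) {X \<in> space (L.rowsM k {..<k}). \<not> gram_bounded k X {..<k} (4 + \<epsilon>)}"
    by auto
  define bad where "bad n = {\<omega> \<in> space M. \<forall>q<block_count n (d n).
    gram_bounded (d n) (\<lambda>a l. W n \<omega> (2 * d n * q + a) (2 * d n * q + d n + l)) {..<d n} (4 + \<epsilon>)}" for n
  have law: "distr M borel (\<lambda>\<omega>. W n \<omega> i j) = \<mu>" if "i < j" "j < n" for n i j
    using assms(8)[OF that] by (simp add: \<mu>_def)
  note unlikely = L.all_blocks_bounded_unlikely[OF assms(1,9,7) law, where b = "4 + \<epsilon>"]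
  have bad_sets: "bad n \<in> sets M" for n
    unfolding bad_def by (rule unlikely(1)) auto
  \<comment> \<open>The estimate for a block holds for all large dimensions; the growth of
    \<open>d n\<close> transfers it to all large n.\<close>
  have "\<forall>\<^sub>F n in sequentially. exp (- c * real (d n))
      \<le> measure (L.rowsM (d n) {..<d n}) {X \<in> space (L.rowsM (d n) {..<d n}). \<not> gram_bounded (d n) X {..<d n} (4 + \<epsilon>)}"
    by (rule eventually_compose_filterlim[OF ev assms(11)])
  then have "\<forall>\<^sub>F n in sequentially. norm (measure M (bad n)) \<le> 1 / real n ^ 2"
    using asym(2)
  proof eventually_elim
    fix n
    assume p: "exp (- c * real (d n))
      \<le> measure (L.rowsM (d n) {..<d n}) {X \<in> space (L.rowsM (d n) {..<d n}). \<not> gram_bounded (d n) X {..<d n} (4 + \<epsilon>)}"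
      and s: "exp (- (exp (- (1 / (4 * C)) * real (d n)) * real (block_count n (d n)))) \<le> 1 / real n ^ 2"
    have "measure M (bad n) \<le> exp (- (exp (- c * real (d n)) * real (block_count n (d n))))"
      unfolding bad_def by (rule unlikely(2)) (use p in auto)
    also have "\<dots> \<le> 1 / real n ^ 2" using s by (simp add: c_def)
    finally show "norm (measure M (bad n)) \<le> 1 / real n ^ 2" by simp
  qed
  then have "summable (\<lambda>n. measure M (bad n))"
    by (rule summable_comparison_test_ev) (use inverse_power_summable[of 2, where ?'a = real] in \<open>simp add: inverse_eq_divide\<close>)
  then have AE: "AE \<omega> in M. \<forall>\<^sub>F n in sequentially. \<omega> \<in> space M - bad n"
    using bad_sets by (intro borel_cantelli_AE1) (auto simp: M.emeasure_eq_measure)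
  have "AE \<omega> in M. liminf (\<lambda>n. ereal (spec_norm n
      (\<lambda>i j. block_graph n (d n) i j * W n \<omega> i j / sqrt (real (d n))))) > 2"
    using AE
  proof eventually_elim
    fix \<omega> assume "\<forall>\<^sub>F n in sequentially. \<omega> \<in> space M - bad n"
    then have "\<forall>\<^sub>F n in sequentially. ereal (sqrt (4 + \<epsilon>)) \<le> ereal (spec_norm n
      (\<lambda>i j. block_graph n (d n) i j * W n \<omega> i j / sqrt (real (d n))))"
    proof eventually_elim
      fix n assume "\<omega> \<in> space M - bad n"
      then obtain q where "q < block_count n (d n)"
        "\<not> gram_bounded (d n) (\<lambda>a l. W n \<omega> (2 * d n * q + a) (2 * d n * q + d n + l)) {..<d n} (4 + \<epsilon>)"
        by (auto simp: bad_def)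
      then show "ereal (sqrt (4 + \<epsilon>)) \<le> ereal (spec_norm n
        (\<lambda>i j. block_graph n (d n) i j * W n \<omega> i j / sqrt (real (d n))))"
        using assms(9) \<epsilon> by (auto intro!: block_spec_norm)
    qed
    then have "ereal (sqrt (4 + \<epsilon>)) \<le> liminf (\<lambda>n. ereal (spec_norm n
      (\<lambda>i j. block_graph n (d n) i j * W n \<omega> i j / sqrt (real (d n)))))"
      by (rule Liminf_bounded)
    moreover have "2 < sqrt (4 + \<epsilon>)" using \<epsilon> by (intro real_less_rsqrt) simp
    then have "2 < ereal (sqrt (4 + \<epsilon>))" by simp
    ultimately show "liminf (\<lambda>n. ereal (spec_norm n
      (\<lambda>i j. block_graph n (d n) i j * W n \<omega> i j / sqrt (real (d n))))) > 2"
      by (rule less_le_trans[rotated])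
  qed
  moreover have "\<forall>\<^sub>F n in sequentially. regular_adj n (d n) (block_graph n (d n))"
    using asym(1) by eventually_elim (rule block_graph_regular[OF assms(9) _ assms(12)])
  ultimately show ?thesis by (intro exI[of _ "\<lambda>n. block_graph n (d n)"]) blast
qed

end
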